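(* Let $n\ge1$, let $\mathbb{I}=\{S_i\}_{i=1}^N$ be an affine IFS on $\mathbb{R}^n$ with affinity dimension $s\le n$, let $C\subset\mathbb{R}^n$ be a non-empty compact condensation set such that the condensation open set condition (COSC) is satisfied, and let $F_C$ be the inhomogeneous self-affine set of $\mathbb{I}$ with condensation set $C$. If $$\inf_{\pi\in P_{n-1}}\mathcal{L}^{n-1}(\pi C)>0,$$ where $P_{n-1}$ is the set of orthogonal projections of $\mathbb{R}^n$ onto $(n-1)$-dimensional linear subspaces and $\mathcal{L}^{n-1}$ is $(n-1)$-dimensional Lebesgue measure (on the image subspace), then $$\overline{\dim}_{\mathrm{B}}F_C=\max\{s,\ \overline{\dim}_{\mathrm{B}}C\}$$ and $$\max\{s,\ \underline{\dim}_{\mathrm{B}}C\}\ \le\ \underline{\dim}_{\mathrm{B}}F_C\ \le\ \max\{s,\ \overline{\dim}_{\mathrm{B}}C\}.$$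
   Context: An affine IFS on $\mathbb{R}^n$ is a finite collection $\{S_i\}_{i=1}^N$ of affine maps $S_i(x)=A_ix+b_i$ with $A_i\in \mathrm{GL}(\mathbb{R},n)$, $b_i\in\mathbb{R}^n$, each contracting: there is $c\in(0,1)$ with $|S_i(x)-S_i(y)|\le c|x-y|$ for all $x,y$ (Euclidean norm). For compact $C\subset\mathbb{R}^n$, the inhomogeneous self-affine set $F_C$ with condensation set $C$ is the unique non-empty compact set with $F_C=\bigcup_{i=1}^N S_i(F_C)\cup C$. COSC: there exists an open set $U\subset\mathbb{R}^n$ with $C\subset U\setminus\bigcup_{i=1}^N\overline{S_i(U)}$, $S_i(U)\subset U$ for all $i$, and $S_i(U)\cap S_j(U)=\emptyset$ whenever $i\ne j$. Words: $\mathcal{I}=\{1,\dots,N\}$, and for $\mathbf{i}=(i_1,\dots,i_k)\in\mathcal{I}^k$, $S_{\mathbf{i}}=S_{i_1}\circ\cdots\circ S_{i_k}$. Affinity dimension: for $A\in\mathrm{GL}(\mathbb{R},n)$ let $\alpha_1(A)\ge\dots\ge\alpha_n(A)>0$ be its singular values. For $0< t\le n$ put $\phi^t(A)=\alpha_1(A)\cdots\alpha_{m-1}(A)\,\alpha_m(A)^{t-m+1}$, where $m$ is the integer with $m-1<t\le m$; put $\phi^0(A)=1$ and $\phi^t(A)=|\det A|^{t/n}$ for $t>n$. For an affine map $S$ with linear part $A$, $\phi^t(S)=\phi^t(A)$. For $k\in\mathbb{N}$ let $s_k$ be the solution of $\sum_{\mathbf{i}\in\mathcal{I}^k}\phi^{s_k}(S_{\mathbf{i}})=1$.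 The limit $s=\lim_{k\to\infty}s_k$ exists and is called the affinity dimension of the IFS. Box dimensions: for non-empty bounded $F\subset\mathbb{R}^n$, $N_\delta(F)$ is the minimum number of hypercubes of sidelength $\delta$ needed to cover $F$; $\overline{\dim}_{\mathrm{B}}F$ and $\underline{\dim}_{\mathrm{B}}F$ are respectively the $\limsup$ and $\liminf$ as $\delta\to0$ of $\frac{\log N_\delta(F)}{-\log\delta}$. *)

theory Defs
  imports "HOL-Analysis.Analysis"
begin

section \<open>Affine iterated function systems\<close>

definition contraction :: "('a::real_normed_vector \<Rightarrow> 'a) \<Rightarrow> bool" where
  "contraction f \<longleftrightarrow>
     (\<exists>c. 0 < c \<and> c < 1 \<and> (\<forall>x y. norm (f x - f y) \<le> c * norm (x - y)))"

text \<open>The maps of an IFS are \<open>S 1, \<dots>, S N\<close>; values of \<open>S\<close> at other indices are irrelevant.\<close>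

definition affine_IFS :: "nat \<Rightarrow> (nat \<Rightarrow> real^'n \<Rightarrow> real^'n) \<Rightarrow> bool" where
  "affine_IFS N S \<longleftrightarrow> 1 \<le> N \<and>
     (\<forall>i\<in>{1..N}. (\<exists>A b. invertible A \<and> S i = (\<lambda>x. A *v x + b)) \<and> contraction (S i))"

definition inhomogeneous_set ::
    "nat \<Rightarrow> (nat \<Rightarrow> real^'n \<Rightarrow> real^'n) \<Rightarrow> (real^'n) set \<Rightarrow> (real^'n) set \<Rightarrow> bool" where
  "inhomogeneous_set N S C F \<longleftrightarrow>
     F \<noteq> {} \<and> compact F \<and> F = (\<Union>i\<in>{1..N}. S i ` F) \<union> C"

definition COSC :: "nat \<Rightarrow> (nat \<Rightarrow> real^'n \<Rightarrow> real^'n) \<Rightarrow> (real^'n) set \<Rightarrow> bool" where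
  "COSC N S C \<longleftrightarrow>
     (\<exists>U. open U \<and> C \<subseteq> U - (\<Union>i\<in>{1..N}. closure (S i ` U)) \<and>
          (\<forall>i\<in>{1..N}. S i ` U \<subseteq> U) \<and>
          (\<forall>i\<in>{1..N}. \<forall>j\<in>{1..N}. i \<noteq> j \<longrightarrow> S i ` U \<inter> S j ` U = {}))"

definition words :: "nat \<Rightarrow> nat \<Rightarrow> nat list set" where
  "words N k = {w. length w = k \<and> set w \<subseteq> {1..N}}"

definition word_map :: "(nat \<Rightarrow> 'a \<Rightarrow> 'a) \<Rightarrow> nat list \<Rightarrow> 'a \<Rightarrow> 'a" where
  "word_map S w = foldr (\<lambda>i f. S i \<circ> f) w id"


section \<open>Singular values and affinity dimension\<close>

definition gram_eigenspace :: "real^'n^'n \<Rightarrow> real \<Rightarrow> (real^'n) set" where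
  "gram_eigenspace A \<mu> = {v. (transpose A ** A) *v v = \<mu> *\<^sub>R v}"

text \<open>The nonnegative square roots of the eigenvalues of \<open>transpose A ** A\<close> in decreasing
  order. Each is repeated according to the dimension of its eigenspace, which for this symmetric
  matrix is also the algebraic multiplicity, so the list has length \<open>CARD('n)\<close>.\<close>

definition singular_values :: "real^'n^'n \<Rightarrow> real list" where
  "singular_values A =
     concat (map (\<lambda>\<sigma>. replicate (dim (gram_eigenspace A (\<sigma>\<^sup>2))) \<sigma>)
       (rev (sorted_list_of_set {\<sigma>. 0 \<le> \<sigma> \<and> (\<exists>v\<in>gram_eigenspace A (\<sigma>\<^sup>2). v \<noteq> 0)})))"

text \<open>Indices run from \<open>1\<close> (largest) to \<open>CARD('n)\<close> (smallest).\<close>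

definition singular_value :: "real^'n^'n \<Rightarrow> nat \<Rightarrow> real" where
  "singular_value A i = singular_values A ! (i - 1)"

text \<open>Only used for \<open>t \<ge> 0\<close>. For \<open>0 < t\<close> the integer \<open>m\<close> with \<open>m - 1 < t \<le> m\<close> is the
  ceiling of \<open>t\<close>.\<close>

definition sv_function :: "real \<Rightarrow> real^'n^'n \<Rightarrow> real" where
  "sv_function t A =
     (if t = 0 then 1
      else if t \<le> real CARD('n) then
        (let m = nat \<lceil>t\<rceil>
         in (\<Prod>i\<in>{1..<m}. singular_value A i) * singular_value A m powr (t - real m + 1))
      else \<bar>det A\<bar> powr (t / real CARD('n)))"

definition linear_part :: "(real^'n \<Rightarrow> real^'n) \<Rightarrow> real^'n^'n" where
  "linear_part f = matrix (\<lambda>x. f x - f 0)"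

definition affinity_exponent :: "nat \<Rightarrow> (nat \<Rightarrow> real^'n \<Rightarrow> real^'n) \<Rightarrow> nat \<Rightarrow> real" where
  "affinity_exponent N S k =
     (THE t. 0 \<le> t \<and> (\<Sum>w\<in>words N k. sv_function t (linear_part (word_map S w))) = 1)"

definition has_affinity_dimension ::
    "nat \<Rightarrow> (nat \<Rightarrow> real^'n \<Rightarrow> real^'n) \<Rightarrow> real \<Rightarrow> bool" where
  "has_affinity_dimension N S s \<longleftrightarrow> (\<lambda>k. affinity_exponent N S k) \<longlonglongrightarrow> s"


section \<open>Box dimensions\<close>

text \<open>Cubes are closed and axis-parallel.\<close>

definition cube :: "real \<Rightarrow> real^'n \<Rightarrow> (real^'n) set" where
  "cube \<delta> a = cbox a (\<chi> i. a $ i + \<delta>)"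

definition covering_number :: "real \<Rightarrow> (real^'n) set \<Rightarrow> nat" where
  "covering_number \<delta> F =
     (LEAST m. \<exists>T. finite T \<and> card T = m \<and> T \<subseteq> range (cube \<delta>) \<and> F \<subseteq> \<Union>T)"

definition upper_box_dim :: "(real^'n) set \<Rightarrow> ereal" where
  "upper_box_dim F =
     Limsup (at_right 0) (\<lambda>\<delta>. ereal (ln (real (covering_number \<delta> F)) / - ln \<delta>))"

definition lower_box_dim :: "(real^'n) set \<Rightarrow> ereal" where
  "lower_box_dim F =
     Liminf (at_right 0) (\<lambda>\<delta>. ereal (ln (real (covering_number \<delta> F)) / - ln \<delta>))"


section \<open>Orthogonal projections and Lebesgue measure on subspaces\<close>

definition orthogonal_projection_onto ::
    "'a::euclidean_space set \<Rightarrow> ('a \<Rightarrow> 'a) \<Rightarrow> bool" where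
  "orthogonal_projection_onto V \<pi> \<longleftrightarrow>
     (\<forall>x. \<pi> x \<in> V \<and> (\<forall>v\<in>V. orthogonal (x - \<pi> x) v))"

definition orthogonal_projections :: "nat \<Rightarrow> ('a::euclidean_space \<Rightarrow> 'a) set" where
  "orthogonal_projections k =
     {\<pi>. \<exists>V. subspace V \<and> dim V = k \<and> orthogonal_projection_onto V \<pi>}"

definition orthonormal_basis_of :: "'a::euclidean_space set \<Rightarrow> 'a set \<Rightarrow> bool" where
  "orthonormal_basis_of V B \<longleftrightarrow>
     pairwise orthogonal B \<and> (\<forall>b\<in>B. norm b = 1) \<and> span B = V"

text \<open>Lebesgue measure of dimension \<open>dim V\<close> on the subspace \<open>V\<close>, built like \<open>lborel\<close> itself but
  from an orthonormal basis of \<open>V\<close> (the choice is immaterial by rotation invariance). It is carried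
  as a measure on the whole space concentrated on \<open>V\<close>. For \<open>V = {0}\<close> it is the unit point mass
  at \<open>0\<close>, i.e. counting measure on \<open>V\<close>.\<close>

definition subspace_lebesgue :: "'a::euclidean_space set \<Rightarrow> 'a measure" where
  "subspace_lebesgue V =
     (let B = (SOME B. orthonormal_basis_of V B)
      in completion (distr (\<Pi>\<^sub>M b\<in>B. lborel) borel (\<lambda>f. \<Sum>b\<in>B. f b *\<^sub>R b)))"

end

theory Submission
  imports Defs
begin

text \<open>
  Write \<open>\<alpha>\<^sub>1(w) \<ge> \<dots> \<ge> \<alpha>\<^sub>n(w)\<close> for the singular values of the linear part of the word map \<open>S\<^sub>w\<close> and
  \<open>\<phi>\<^sup>t(w)\<close> for its singular value function. The set \<open>F\<close> consists of the copies \<open>S\<^sub>w(C)\<close> of the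
  condensation set and of the points in the limit of longer and longer words, so both bounds count
  cubes of side \<open>\<delta>\<close> copy by copy. Changing \<open>t\<close> changes \<open>\<phi>\<^sup>t(w)\<close> by a factor that is geometric in the
  length of \<open>w\<close>; hence the sums of \<open>\<phi>\<^sup>t\<close> over the words of length \<open>k\<close> are summable over \<open>k\<close> if \<open>t > s\<close>,
  and unbounded if \<open>t < s\<close>.

  For the upper bound let \<open>t \<le> n\<close> exceed \<open>s\<close> and the upper box dimension of \<open>C\<close>, and let \<open>m\<close> be the
  ceiling of \<open>t\<close>. A cube of side \<open>\<delta>/\<alpha>\<^sub>m(w)\<close> is mapped by \<open>S\<^sub>w\<close> into about
  \<open>(\<alpha>\<^sub>1 \<cdots> \<alpha>\<^sub>m) / \<alpha>\<^sub>m ^ m = \<phi>\<^sup>t(w) * \<alpha>\<^sub>m(w) powr -t\<close> cubes of side \<open>\<delta>\<close>, and \<open>C\<close> needs at most a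
  constant times \<open>(\<delta>/\<alpha>\<^sub>m(w)) powr -t\<close> cubes of side \<open>\<delta>/\<alpha>\<^sub>m(w)\<close>. The powers of \<open>\<alpha>\<^sub>m\<close> cancel, so each
  copy with \<open>\<alpha>\<^sub>m(w) > \<delta>\<close> costs a constant times \<open>\<phi>\<^sup>t(w) * \<delta> powr -t\<close>. What lies beyond these words is covered by
  the sets \<open>S\<^sub>w(F)\<close> with \<open>\<alpha>\<^sub>m(w)\<close> comparable to \<open>\<delta>\<close>, at the same cost
  (\<open>covering_number_affine_image\<close>, \<open>covering_number_inhomogeneous_set_le\<close>).

  For the lower bound let \<open>t < s\<close>. The open set condition makes the copies \<open>S\<^sub>w(C)\<close> with
  \<open>\<alpha>\<^sub>n(w) \<ge> \<delta>\<close> separated by a multiple of \<open>\<delta>\<close> (\<open>COSC_separation\<close>), so no small cube meets two of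
  them. Projecting \<open>C\<close> along the most contracted direction of \<open>S\<^sub>w\<close> shows that \<open>S\<^sub>w(C)\<close> needs at least
  a constant times \<open>(\<alpha>\<^sub>1 \<cdots> \<alpha>\<^sub>n\<^sub>-\<^sub>1) / \<delta> ^ (n - 1)\<close> cubes (\<open>affine_image_cube_count\<close>); this is where the
  projections of \<open>C\<close> must have volume bounded below. It remains to bound the sum of
  \<open>\<alpha>\<^sub>1 \<cdots> \<alpha>\<^sub>n\<^sub>-\<^sub>1\<close> over such words from below by a constant times \<open>\<delta>\<close> to the power \<open>n - 1 - t\<close>.
  The weight \<open>\<psi>(w) = \<bar>det\<bar> * \<alpha>\<^sub>n powr (t - n)\<close> dominates \<open>\<phi>\<^sup>t(w)\<close> for \<open>t \<le> n\<close>, and it is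
  submultiplicative simply because the determinant is multiplicative and \<open>\<alpha>\<^sub>n\<close> supermultiplicative.
  If its sum over the words with \<open>\<alpha>\<^sub>n(w)\<close> comparable to \<open>\<delta>\<close> were too small, submultiplicativity would
  bound its sums over all words of length \<open>k\<close>, against \<open>t < s\<close>
  (\<open>submultiplicative_exit_sum\<close>, \<open>exit_words_det_weight\<close>).
\<close>

section \<open>Singular value decomposition\<close>

text \<open>Indices start at \<open>1\<close>, in step with those of the singular values.\<close>
definition orthonormal_frame :: "nat \<Rightarrow> (nat \<Rightarrow> real^'n) \<Rightarrow> bool" where
  "orthonormal_frame k v \<longleftrightarrow>
     (\<forall>i\<in>{1..k}. \<forall>j\<in>{1..k}. v i \<bullet> v j = of_bool (i = j))"

text \<open>The first-order condition at a maximum: \<open>s\<close> is the deviation from the maximiser in a fixed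
direction, and the linear term dominates for small \<open>s\<close> of the sign of \<open>b\<close>.\<close>
lemma quadratic_nonpos_imp_linear_zero:
  fixes b c :: real
  assumes "\<And>s. 2 * b * s + c * s\<^sup>2 \<le> 0"
  shows "b = 0"
proof (rule ccontr)
  assume b: "b \<noteq> 0"
  define e where "e = b / (1 + \<bar>c\<bar>)"
  have "2 * b * e + c * e\<^sup>2 \<le> 0" by (rule assms)
  moreover have "2 * b * e + c * e\<^sup>2 = (b / (1 + \<bar>c\<bar>))\<^sup>2 * (2 * (1 + \<bar>c\<bar>) + c)"
    unfolding e_def by (simp add: divide_simps power2_eq_square; simp add: algebra_simps)
  moreover have "(b / (1 + \<bar>c\<bar>))\<^sup>2 * (2 * (1 + \<bar>c\<bar>) + c) > 0"
    using b by (intro mult_pos_pos) auto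
  ultimately show False by linarith
qed

lemma norm_add_scaleR_sq:
  fixes a b :: "'a::real_inner"
  shows "(norm (a + s *\<^sub>R b))\<^sup>2 = (norm a)\<^sup>2 + 2 * s * (a \<bullet> b) + s\<^sup>2 * (norm b)\<^sup>2"
  by (simp only: power2_norm_eq_inner)
     (simp add: inner_add_left inner_add_right inner_commute power2_eq_square algebra_simps)

lemma orthonormal_frame_inj: "orthonormal_frame k v \<Longrightarrow> inj_on v {1..k}"
  unfolding orthonormal_frame_def inj_on_def
  by (metis of_bool_eq_1_iff)

lemma orthonormal_frame_independent:
  assumes "orthonormal_frame k v" "J \<subseteq> {1..k}"
  shows "independent (v ` J)" "dim (span (v ` J)) = card J"
proof -
  show ind: "independent (v ` J)"
  proof (rule pairwise_orthogonal_independent)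
    show "pairwise orthogonal (v ` J)"
      using assms unfolding orthonormal_frame_def pairwise_def orthogonal_def
      by (auto simp: subset_iff)
    show "0 \<notin> v ` J"
    proof
      assume "0 \<in> v ` J"
      then obtain i where "i \<in> J" "v i = 0" by auto
      then have "v i \<bullet> v i = 0" "i \<in> {1..k}" using assms by auto
      then show False using assms(1) unfolding orthonormal_frame_def by fastforce
    qed
  qed
  have "inj_on v J"
    using orthonormal_frame_inj[OF assms(1)] assms(2) inj_on_subset by blast
  then show "dim (span (v ` J)) = card J"
    using ind by (simp add: dim_span_eq_card_independent card_image dim_eq_card_independent)
qed

lemma orthonormal_frame_expand:
  fixes v :: "nat \<Rightarrow> real^'n"
  assumes "orthonormal_frame CARD('n) v"
  shows "x = (\<Sum>i\<in>{1..CARD('n)}. (v i \<bullet> x) *\<^sub>R v i)"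
proof -
  let ?I = "{1..CARD('n)}"
  have "span (v ` ?I) = UNIV"
    using orthonormal_frame_independent(2)[OF assms subset_refl]
    by (metis card_atLeastAtMost diff_Suc_1 dim_eq_full dim_span DIM_cart DIM_real mult.right_neutral span_span)
  define y where "y = x - (\<Sum>i\<in>?I. (v i \<bullet> x) *\<^sub>R v i)"
  have orth: "orthogonal y u" if u: "u \<in> v ` ?I" for u
  proof -
    obtain j where j: "j \<in> ?I" "u = v j" using u by auto
    have "(\<Sum>i\<in>?I. (v i \<bullet> x) *\<^sub>R v i) \<bullet> v j = (\<Sum>i\<in>?I. (v i \<bullet> x) * (v i \<bullet> v j))"
      by (simp add: inner_sum_left)
    also have "\<dots> = (\<Sum>i\<in>?I. if i = j then v i \<bullet> x else 0)"
      using assms j unfolding orthonormal_frame_def by (intro sum.cong) auto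
    also have "\<dots> = v j \<bullet> x" using j by simp
    finally show ?thesis unfolding y_def j orthogonal_def by (simp only: inner_diff_left inner_commute[of x])
  qed
  have "y \<in> span (v ` ?I)" using \<open>span _ = UNIV\<close> by simp
  then have "orthogonal y y" by (rule orthogonal_to_span) (rule orth)
  then show ?thesis unfolding y_def orthogonal_def by simp
qed

lemma orthonormal_frame_inner:
  fixes v :: "nat \<Rightarrow> real^'n"
  assumes "orthonormal_frame CARD('n) v"
  shows "x \<bullet> y = (\<Sum>i\<in>{1..CARD('n)}. (v i \<bullet> x) * (v i \<bullet> y))"
proof -
  have "x \<bullet> y = (\<Sum>i\<in>{1..CARD('n)}. (v i \<bullet> x) *\<^sub>R v i) \<bullet> y"
    using orthonormal_frame_expand[OF assms] by metis
  then show ?thesis by (simp add: inner_sum_left)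
qed

text \<open>Right singular vectors, chosen one after the other: the next one maximises \<open>norm (A *v x)\<close> over
the unit vectors orthogonal to the previous ones. The first-order condition makes it an eigenvector
of \<open>transpose A ** A\<close>, here in the polarised form with inner products, and the greedy choice
puts the singular values in decreasing order.\<close>
lemma greedy_gram_frame:
  fixes A :: "real^'n^'n"
  assumes "k \<le> CARD('n)"
  shows "\<exists>v. orthonormal_frame k v \<and>
    (\<forall>i\<in>{1..k}. \<forall>x. (A *v v i) \<bullet> (A *v x) = (norm (A *v v i))\<^sup>2 * (v i \<bullet> x)) \<and>
    (\<forall>i\<in>{1..k}. \<forall>x. (\<forall>j\<in>{1..<i}. v j \<bullet> x = 0) \<longrightarrow> norm (A *v x) \<le> norm (A *v v i) * norm x)"
  using assms
proof (induction k)
  case 0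
  then show ?case by (auto simp: orthonormal_frame_def)
next
  case (Suc k)
  then obtain v where v: "orthonormal_frame k v"
    "\<And>i x. i \<in> {1..k} \<Longrightarrow> (A *v v i) \<bullet> (A *v x) = (norm (A *v v i))\<^sup>2 * (v i \<bullet> x)"
    "\<And>i x. i \<in> {1..k} \<Longrightarrow> (\<forall>j\<in>{1..<i}. v j \<bullet> x = 0) \<Longrightarrow> norm (A *v x) \<le> norm (A *v v i) * norm x"
    by auto
  define W where "W = {x. \<forall>j\<in>{1..k}. v j \<bullet> x = 0}"
  have subW: "subspace W"
    unfolding W_def subspace_def by (auto simp: inner_add_right)
  have "dim (span (v ` {1..k})) < CARD('n)"
    using orthonormal_frame_independent(2)[OF v(1) subset_refl] Suc.prems by simp
  then obtain w where w: "w \<noteq> 0" "\<And>x. x \<in> span (v ` {1..k}) \<Longrightarrow> orthogonal w x"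
    using orthogonal_to_subspace_exists[of "span (v ` {1..k})"] by (auto simp: span_span)
  have wW: "w \<in> W"
    unfolding W_def using w(2)[OF span_base, OF imageI] by (simp add: orthogonal_def inner_commute)
  let ?K = "W \<inter> sphere 0 1"
  have "compact ?K"
    by (intro closed_Int_compact closed_subspace subW compact_sphere)
  moreover have "w /\<^sub>R norm w \<in> ?K"
    using wW w(1) subspace_scale[OF subW] by (simp add: divide_simps)
  moreover have "continuous_on ?K (\<lambda>x. norm (A *v x))"
    by (intro continuous_intros matrix_vector_mult_linear_continuous_on)
  ultimately obtain u where u: "u \<in> ?K" "\<And>x. x \<in> ?K \<Longrightarrow> norm (A *v x) \<le> norm (A *v u)"
    using continuous_attains_sup[of ?K "\<lambda>x. norm (A *v x)"] by blast
  have u1: "norm u = 1" "u \<in> W" using u(1) by auto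
  have max: "norm (A *v x) \<le> norm (A *v u) * norm x" if "x \<in> W" for x
  proof (cases "x = 0")
    case False
    have "x /\<^sub>R norm x \<in> ?K"
      using that False subspace_scale[OF subW] by (simp add: divide_simps)
    from u(2)[OF this] show ?thesis
      using False by (simp add: matrix_vector_mult_scaleR divide_simps mult.commute)
  qed simp
  let ?\<mu> = "(norm (A *v u))\<^sup>2"
  \<comment> \<open>Moving from the maximiser \<open>u\<close> to \<open>u + s y\<close> cannot increase the Rayleigh quotient.\<close>
  have eigW: "(A *v u) \<bullet> (A *v y) = ?\<mu> * (u \<bullet> y)" if y: "y \<in> W" for y
  proof -
    have "2 * ((A *v u) \<bullet> (A *v y) - ?\<mu> * (u \<bullet> y)) * s
          + ((norm (A *v y))\<^sup>2 - ?\<mu> * (norm y)\<^sup>2) * s\<^sup>2 \<le> 0" for s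
    proof -
      have "u + s *\<^sub>R y \<in> W" using subW u1(2) y by (simp add: subspace_add subspace_scale)
      from max[OF this] have "(norm (A *v (u + s *\<^sub>R y)))\<^sup>2 \<le> ?\<mu> * (norm (u + s *\<^sub>R y))\<^sup>2"
        by (metis norm_ge_zero power_mono power_mult_distrib)
      then show ?thesis
        using u1(1) unfolding matrix_vector_right_distrib matrix_vector_mult_scaleR norm_add_scaleR_sq
        by (simp add: algebra_simps)
    qed
    then have "(A *v u) \<bullet> (A *v y) - ?\<mu> * (u \<bullet> y) = 0"
      by (rule quadratic_nonpos_imp_linear_zero)
    then show ?thesis by simp
  qed
  \<comment> \<open>The part of \<open>x\<close> outside \<open>W\<close> is invisible to \<open>u\<close>, on both sides, as the earlier \<open>v i\<close> are eigenvectors.\<close>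
  have eig: "(A *v u) \<bullet> (A *v x) = ?\<mu> * (u \<bullet> x)" for x
  proof -
    define p where "p = (\<Sum>i\<in>{1..k}. (v i \<bullet> x) *\<^sub>R v i)"
    have "x - p \<in> W"
    proof -
      have "v j \<bullet> p = v j \<bullet> x" if "j \<in> {1..k}" for j
      proof -
        have "v j \<bullet> p = (\<Sum>i\<in>{1..k}. if i = j then v i \<bullet> x else 0)"
          unfolding p_def inner_sum_right using v(1) that
          by (intro sum.cong) (auto simp: orthonormal_frame_def)
        then show ?thesis using that by simp
      qed
      then show ?thesis unfolding W_def by (simp add: inner_diff_right)
    qed
    have up: "u \<bullet> p = 0"
      using u1(2) unfolding p_def W_def by (simp add: inner_sum_right inner_commute)
    have "(A *v u) \<bullet> (A *v p) = 0"
    proof -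
      have "A *v p = (\<Sum>i\<in>{1..k}. (v i \<bullet> x) *\<^sub>R (A *v v i))"
        unfolding p_def by (simp add: matrix_vector_mult_scaleR linear_sum[OF matrix_vector_mul_linear])
      then have "(A *v u) \<bullet> (A *v p) = (\<Sum>i\<in>{1..k}. (v i \<bullet> x) * ((A *v v i) \<bullet> (A *v u)))"
        by (simp add: inner_sum_right inner_commute)
      also have "\<dots> = 0"
        using v(2) u1(2) by (intro sum.neutral) (auto simp: W_def)
      finally show ?thesis .
    qed
    with eigW[OF \<open>x - p \<in> W\<close>] up show ?thesis
      by (simp add: matrix_vector_mult_diff_distrib inner_diff_right)
  qed
  define v' where "v' = v(Suc k := u)"
  have eqs: "v' (Suc k) = u" "\<And>i. i \<in> {1..k} \<Longrightarrow> v' i = v i"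
    unfolding v'_def by auto
  have spl: "{1..Suc k} = insert (Suc k) {1..k}" by auto
  have "orthonormal_frame (Suc k) v'"
    using v(1) u1 unfolding orthonormal_frame_def spl
    by (auto simp: eqs W_def inner_commute norm_eq_1)
  moreover have "(A *v v' i) \<bullet> (A *v x) = (norm (A *v v' i))\<^sup>2 * (v' i \<bullet> x)"
    if "i \<in> {1..Suc k}" for i x
    using that v(2)[of i x] eig[of x] unfolding spl by (auto simp: eqs)
  moreover have "norm (A *v x) \<le> norm (A *v v' i) * norm x"
    if "i \<in> {1..Suc k}" "\<forall>j\<in>{1..<i}. v' j \<bullet> x = 0" for i x
  proof (cases "i = Suc k")
    case True
    then have "x \<in> W" using that(2) eqs(2) unfolding W_def by auto
    then show ?thesis using max True eqs by simp
  next
    case False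
    then have "i \<in> {1..k}" "\<forall>j\<in>{1..<i}. v j \<bullet> x = 0"
      using that eqs(2) by auto
    then show ?thesis using v(3) eqs(2) by auto
  qed
  ultimately show ?case by blast
qed

lemma sorted_wrt_concat_replicate:
  fixes xs :: "'a::linorder list"
  assumes "sorted_wrt (\<ge>) xs"
  shows "sorted_wrt (\<ge>) (concat (map (\<lambda>x. replicate (f x) x) xs))"
proof -
  have "sorted_wrt (\<ge>) (replicate k x)" for k and x :: 'a
    by (induction k) auto
  then show ?thesis using assms by (induction xs) (auto simp: sorted_wrt_append)
qed

lemma count_list_concat_replicate:
  assumes "distinct xs"
  shows "count_list (concat (map (\<lambda>x. replicate (f x) x) xs)) y = (if y \<in> set xs then f y else 0)"
proof -
  have rep: "count_list (replicate k x) y = (if x = y then k else 0)" for k x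
    by (induction k) auto
  show ?thesis using assms by (induction xs) (auto simp: rep)
qed

lemma sorted_wrt_ge_unique:
  fixes xs ys :: "'a::linorder list"
  assumes "sorted_wrt (\<ge>) xs" "sorted_wrt (\<ge>) ys" "\<And>y. count_list xs y = count_list ys y"
  shows "xs = ys"
proof -
  have "mset xs = mset ys"
    using assms(3) by (intro multiset_eqI) (simp add: count_mset)
  then have "mset (rev xs) = mset (rev ys)" by simp
  moreover have "sorted (rev xs)" "sorted (rev ys)"
    using assms(1,2) by (simp_all add: sorted_wrt_rev)
  ultimately have "rev xs = rev ys" using properties_for_sort by metis
  then show ?thesis by simp
qed

text \<open>The second condition says that \<open>v i\<close> is an eigenvector of \<open>transpose A ** A\<close> whose eigenvalue is the
square of the \<open>i\<close>-th singular value.\<close>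
definition singular_frame :: "real^'n^'n \<Rightarrow> (nat \<Rightarrow> real^'n) \<Rightarrow> bool" where
  "singular_frame A v \<longleftrightarrow> orthonormal_frame CARD('n) v \<and>
     (\<forall>i\<in>{1..CARD('n)}. \<forall>x. (A *v v i) \<bullet> (A *v x) = (singular_value A i)\<^sup>2 * (v i \<bullet> x))"

lemma gram_eigenspace_iff:
  "x \<in> gram_eigenspace A \<mu> \<longleftrightarrow> (\<forall>y. (A *v x) \<bullet> (A *v y) = \<mu> * (x \<bullet> y))"
proof -
  have "(A *v x) \<bullet> (A *v y) = ((transpose A ** A) *v x) \<bullet> y" for y
    by (metis dot_lmul_matrix inner_commute matrix_vector_mul_assoc vector_transpose_matrix transpose_matrix_vector)
  then have "(\<forall>y. (A *v x) \<bullet> (A *v y) = \<mu> * (x \<bullet> y)) \<longleftrightarrow>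
      (\<forall>y. ((transpose A ** A) *v x) \<bullet> y = (\<mu> *\<^sub>R x) \<bullet> y)" by simp
  also have "\<dots> \<longleftrightarrow> (transpose A ** A) *v x = \<mu> *\<^sub>R x"
    by (metis vector_eq_rdot)
  finally show ?thesis by (simp add: gram_eigenspace_def)
qed

text \<open>The eigenspace of \<open>transpose A ** A\<close> for \<open>\<tau>\<^sup>2\<close> is spanned by the greedy vectors with
\<open>norm (A *v v i) = \<tau>\<close>, so its dimension is the number of such \<open>i\<close>. Hence the list
\<open>singular_values A\<close> and the list of these norms contain every number equally often, and two
decreasing lists with this property are equal.\<close>
lemma singular_frame_exists:
  fixes A :: "real^'n^'n"
  obtains v where "singular_frame A v"
    "\<And>i j. 1 \<le> i \<Longrightarrow> i \<le> j \<Longrightarrow> j \<le> CARD('n) \<Longrightarrow> singular_value A j \<le> singular_value A i"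
    "\<And>i. 1 \<le> i \<Longrightarrow> i \<le> CARD('n) \<Longrightarrow> 0 \<le> singular_value A i"
proof -
  let ?n = "CARD('n)"
  let ?I = "{1..?n}"
  obtain v where v: "orthonormal_frame ?n v"
    "\<And>i x. i \<in> ?I \<Longrightarrow> (A *v v i) \<bullet> (A *v x) = (norm (A *v v i))\<^sup>2 * (v i \<bullet> x)"
    "\<And>i x. i \<in> ?I \<Longrightarrow> (\<forall>j\<in>{1..<i}. v j \<bullet> x = 0) \<Longrightarrow> norm (A *v x) \<le> norm (A *v v i) * norm x"
    using greedy_gram_frame[of ?n A] by auto
  define \<sigma> where "\<sigma> i = norm (A *v v i)" for i
  have n1: "norm (v i) = 1" if "i \<in> ?I" for i
    using v(1) that unfolding orthonormal_frame_def by (simp add: norm_eq_1)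
  have dec: "\<sigma> j \<le> \<sigma> i" if "1 \<le> i" "i \<le> j" "j \<le> ?n" for i j
  proof -
    have "\<forall>l\<in>{1..<i}. v l \<bullet> v j = 0"
      using v(1) that unfolding orthonormal_frame_def by auto
    from v(3)[OF _ this] show ?thesis using that n1[of j] by (simp add: \<sigma>_def)
  qed
  have eigenspace: "gram_eigenspace A (\<tau>\<^sup>2) = span (v ` {i\<in>?I. \<sigma> i = \<tau>})" if "0 \<le> \<tau>" for \<tau>
  proof (intro equalityI subsetI)
    fix x assume x: "x \<in> gram_eigenspace A (\<tau>\<^sup>2)"
    have "v i \<bullet> x = 0" if i: "i \<in> ?I" "\<sigma> i \<noteq> \<tau>" for i
    proof -
      have "(\<sigma> i)\<^sup>2 * (v i \<bullet> x) = \<tau>\<^sup>2 * (v i \<bullet> x)"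
        using v(2)[OF i(1), of x] x unfolding gram_eigenspace_iff \<sigma>_def
        by (metis inner_commute)
      moreover have "(\<sigma> i)\<^sup>2 \<noteq> \<tau>\<^sup>2"
        using i(2) \<open>0 \<le> \<tau>\<close> by (simp add: \<sigma>_def power2_eq_iff_nonneg)
      ultimately show ?thesis by simp
    qed
    then have "x = (\<Sum>i\<in>{i\<in>?I. \<sigma> i = \<tau>}. (v i \<bullet> x) *\<^sub>R v i)"
      by (subst orthonormal_frame_expand[OF v(1), of x], intro sum.mono_neutral_right) auto
    also have "\<dots> \<in> span (v ` {i\<in>?I. \<sigma> i = \<tau>})"
      by (intro span_sum span_scale span_base) auto
    finally show "x \<in> span (v ` {i\<in>?I. \<sigma> i = \<tau>})" .
  next
    have "subspace (gram_eigenspace A (\<tau>\<^sup>2))"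
      unfolding gram_eigenspace_def subspace_def
      by (auto simp: matrix_vector_right_distrib matrix_vector_mult_scaleR scaleR_add_right)
    moreover have "v ` {i\<in>?I. \<sigma> i = \<tau>} \<subseteq> gram_eigenspace A (\<tau>\<^sup>2)"
      using v(2) by (auto simp: gram_eigenspace_iff \<sigma>_def)
    ultimately show "x \<in> gram_eigenspace A (\<tau>\<^sup>2)" if "x \<in> span (v ` {i\<in>?I. \<sigma> i = \<tau>})" for x
      using that span_minimal by blast
  qed
  have dimeig: "dim (gram_eigenspace A (\<tau>\<^sup>2)) = card {i\<in>?I. \<sigma> i = \<tau>}" if "0 \<le> \<tau>" for \<tau>
    unfolding eigenspace[OF that] by (rule orthonormal_frame_independent(2)[OF v(1)]) auto
  let ?E = "{\<tau>. 0 \<le> \<tau> \<and> (\<exists>x\<in>gram_eigenspace A (\<tau>\<^sup>2). x \<noteq> 0)}"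
  have E: "?E = \<sigma> ` ?I"
  proof (intro equalityI subsetI)
    fix \<tau> assume t: "\<tau> \<in> ?E"
    then have "dim (gram_eigenspace A (\<tau>\<^sup>2)) \<noteq> 0" by (auto simp: dim_eq_0)
    then have "{i\<in>?I. \<sigma> i = \<tau>} \<noteq> {}" using t dimeig[of \<tau>] by (metis (no_types, lifting) card.empty mem_Collect_eq)
    then show "\<tau> \<in> \<sigma> ` ?I" by auto
  next
    fix \<tau> assume "\<tau> \<in> \<sigma> ` ?I"
    then obtain i where i: "i \<in> ?I" "\<tau> = \<sigma> i" by auto
    then have "v i \<in> gram_eigenspace A (\<tau>\<^sup>2)" "v i \<noteq> 0"
      using v(2) n1[of i] by (auto simp: gram_eigenspace_iff \<sigma>_def)
    then show "\<tau> \<in> ?E" using i by (auto simp: \<sigma>_def)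
  qed
  let ?s = "map \<sigma> [1..<Suc ?n]"
  have "singular_values A = ?s"
  proof (rule sorted_wrt_ge_unique)
    have "sorted_wrt (\<ge>) (rev (sorted_list_of_set ?E))"
      by (simp add: sorted_wrt_rev)
    then show "sorted_wrt (\<ge>) (singular_values A)"
      unfolding singular_values_def by (rule sorted_wrt_concat_replicate)
    show "sorted_wrt (\<ge>) ?s"
      using dec by (auto simp: sorted_wrt_iff_nth_less simp del: upt_Suc)
    fix \<tau>
    have finE: "finite ?E" unfolding E by simp
    have "count_list (singular_values A) \<tau> = (if \<tau> \<in> ?E then dim (gram_eigenspace A (\<tau>\<^sup>2)) else 0)"
      unfolding singular_values_def using finE by (subst count_list_concat_replicate) auto
    also have "\<dots> = card {i\<in>?I. \<sigma> i = \<tau>}"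
    proof (cases "\<tau> \<in> ?E")
      case True then show ?thesis using dimeig[of \<tau>] by (metis (no_types, lifting) mem_Collect_eq)
    next
      case False
      then have "{i\<in>?I. \<sigma> i = \<tau>} = {}" unfolding E by auto
      with False show ?thesis by (metis (no_types, lifting) card.empty)
    qed
    also have "\<dots> = count_list ?s \<tau>"
    proof -
      have "count_list ?s \<tau> = length (filter (\<lambda>i. \<sigma> i = \<tau>) [1..<Suc ?n])"
        by (simp add: count_list_eq_length_filter filter_map o_def eq_commute[of \<tau>] del: upt_Suc)
      also have "\<dots> = card (set (filter (\<lambda>i. \<sigma> i = \<tau>) [1..<Suc ?n]))"
        by (rule distinct_card[symmetric]) (simp del: upt_Suc)
      also have "set (filter (\<lambda>i. \<sigma> i = \<tau>) [1..<Suc ?n]) = {i\<in>?I. \<sigma> i = \<tau>}"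
        unfolding set_filter set_upt by auto
      finally show ?thesis by simp
    qed
    finally show "count_list (singular_values A) \<tau> = count_list ?s \<tau>" .
  qed
  then have sv: "singular_value A i = \<sigma> i" if "i \<in> ?I" for i
  proof -
    have "i - 1 < length [1..<Suc ?n]" "1 + (i - 1) < Suc ?n" "1 + (i - 1) = i" using that by auto
    then show ?thesis
      unfolding singular_value_def \<open>singular_values A = ?s\<close> by (simp only: nth_map nth_upt)
  qed
  show ?thesis
  proof (rule that)
    show "singular_frame A v"
      unfolding singular_frame_def using v(1,2) sv by (auto simp: \<sigma>_def)
  qed (use sv dec in \<open>auto simp: \<sigma>_def\<close>)
qed

lemma singular_value_antimono:
  fixes A :: "real^'n^'n"
  assumes "1 \<le> i" "i \<le> j" "j \<le> CARD('n)"
  shows "singular_value A j \<le> singular_value A i"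
  using singular_frame_exists[of A] assms by metis

lemma singular_value_nonneg:
  fixes A :: "real^'n^'n"
  assumes "1 \<le> i" "i \<le> CARD('n)"
  shows "0 \<le> singular_value A i"
  using singular_frame_exists[of A] assms by metis

lemma singular_frame_norm:
  fixes A :: "real^'n^'n"
  assumes "singular_frame A v"
  shows "(norm (A *v x))\<^sup>2 = (\<Sum>i\<in>{1..CARD('n)}. (singular_value A i)\<^sup>2 * (v i \<bullet> x)\<^sup>2)"
proof -
  let ?I = "{1..CARD('n)}"
  have "A *v x = A *v (\<Sum>i\<in>?I. (v i \<bullet> x) *\<^sub>R v i)"
    using assms orthonormal_frame_expand unfolding singular_frame_def by metis
  also have "\<dots> = (\<Sum>i\<in>?I. (v i \<bullet> x) *\<^sub>R (A *v v i))"
    by (simp add: matrix_vector_mult_scaleR linear_sum[OF matrix_vector_mul_linear])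
  finally have "(A *v x) \<bullet> (A *v x) = (\<Sum>i\<in>?I. (v i \<bullet> x) *\<^sub>R (A *v v i)) \<bullet> (A *v x)"
    by simp
  also have "\<dots> = (\<Sum>i\<in>?I. (v i \<bullet> x) * ((A *v v i) \<bullet> (A *v x)))"
    by (simp add: inner_sum_left)
  also have "\<dots> = (\<Sum>i\<in>?I. (singular_value A i)\<^sup>2 * (v i \<bullet> x)\<^sup>2)"
    using assms unfolding singular_frame_def by (intro sum.cong) (auto simp: power2_eq_square)
  finally show ?thesis by (simp add: power2_norm_eq_inner)
qed

lemma orthonormal_frame_norm:
  fixes v :: "nat \<Rightarrow> real^'n"
  assumes "orthonormal_frame CARD('n) v"
  shows "(norm x)\<^sup>2 = (\<Sum>i\<in>{1..CARD('n)}. (v i \<bullet> x)\<^sup>2)"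
  using orthonormal_frame_inner[OF assms, of x x]
  by (simp add: power2_norm_eq_inner) (simp add: power2_eq_square)

lemma norm_ge_last_singular_value:
  fixes A :: "real^'n^'n"
  shows "singular_value A CARD('n) * norm x \<le> norm (A *v x)"
proof -
  obtain v where v: "singular_frame A v" using singular_frame_exists by metis
  have "(singular_value A CARD('n) * norm x)\<^sup>2 = (\<Sum>i\<in>{1..CARD('n)}. (singular_value A CARD('n))\<^sup>2 * (v i \<bullet> x)\<^sup>2)"
    using v orthonormal_frame_norm[of v x] unfolding singular_frame_def
    by (simp add: power_mult_distrib sum_distrib_left)
  also have "\<dots> \<le> (norm (A *v x))\<^sup>2"
    unfolding singular_frame_norm[OF v]
    by (intro sum_mono mult_right_mono power_mono singular_value_antimono singular_value_nonneg) auto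
  finally show ?thesis
    by (rule power2_le_imp_le) simp
qed

lemma singular_frame_norm_vector:
  fixes A :: "real^'n^'n"
  assumes "singular_frame A v" "i \<in> {1..CARD('n)}"
  shows "norm (v i) = 1" "norm (A *v v i) = singular_value A i"
proof -
  show 1: "norm (v i) = 1"
    using assms by (simp add: singular_frame_def orthonormal_frame_def norm_eq_1)
  have "(norm (A *v v i))\<^sup>2 = (singular_value A i)\<^sup>2"
    using assms 1 unfolding singular_frame_def
    by (simp add: power2_norm_eq_inner norm_eq_1)
  then show "norm (A *v v i) = singular_value A i"
    using assms by (simp add: power2_eq_iff_nonneg singular_value_nonneg)
qed

lemma singular_value_pos:
  fixes A :: "real^'n^'n"
  assumes "invertible A" "1 \<le> i" "i \<le> CARD('n)"
  shows "0 < singular_value A i"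
proof -
  obtain v where v: "singular_frame A v" using singular_frame_exists by metis
  from singular_frame_norm_vector[OF v, of i] assms have "norm (v i) = 1" "norm (A *v v i) = singular_value A i" by auto
  moreover have "A *v v i \<noteq> 0"
    using assms(1) \<open>norm (v i) = 1\<close>
    by (metis inj_matrix_vector_mult injD matrix_vector_mult_0_right norm_zero zero_neq_one)
  ultimately show ?thesis by (metis zero_less_norm_iff)
qed

text \<open>The orthogonal matrix \<open>V\<close> with columns \<open>v i\<close> turns \<open>transpose A ** A\<close> into the diagonal matrix of the
squared singular values; compare determinants.\<close>
lemma prod_singular_values:
  fixes A :: "real^'n^'n"
  shows "(\<Prod>i\<in>{1..CARD('n)}. singular_value A i) = \<bar>det A\<bar>"
proof -
  obtain v where v: "singular_frame A v" using singular_frame_exists by metis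
  obtain h :: "'n \<Rightarrow> nat" where h: "bij_betw h UNIV {1..CARD('n)}"
    by (metis bij_betw_iff_card card_atLeastAtMost diff_Suc_1 finite finite_atLeastAtMost)
  have hI: "h c \<in> {1..CARD('n)}" for c using h by (auto simp: bij_betw_def)
  have hinj: "h c = h d \<longleftrightarrow> c = d" for c d using h by (auto simp: bij_betw_def inj_on_def)
  define V :: "real^'n^'n" where "V = (\<chi> r c. v (h c) $ r)"
  have col: "column c V = v (h c)" for c
    unfolding V_def column_def by (simp add: vec_eq_iff)
  have colA: "column c (A ** V) = A *v v (h c)" for c
    unfolding col[symmetric] by (simp add: column_def matrix_matrix_mult_def matrix_vector_mult_def vec_eq_iff)
  have "transpose V ** V = mat 1"
    unfolding matrix_mult_transpose_dot_column col
    using v hI unfolding singular_frame_def orthonormal_frame_def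
    by (auto simp: mat_def vec_eq_iff hinj)
  then have "det (transpose V ** V) = 1" by simp
  then have dV: "(det V)\<^sup>2 = 1" by (simp add: det_mul power2_eq_square)
  let ?D = "transpose (A ** V) ** (A ** V)"
  have D: "?D $ c $ d = (if c = d then (singular_value A (h c))\<^sup>2 else 0)" for c d
    unfolding matrix_mult_transpose_dot_column colA
    using v hI[of c] hI[of d] unfolding singular_frame_def orthonormal_frame_def
    by (auto simp: hinj)
  have "(\<Prod>i\<in>{1..CARD('n)}. singular_value A i)\<^sup>2 = (\<Prod>i\<in>{1..CARD('n)}. (singular_value A i)\<^sup>2)"
    by (rule prod_power_distrib)
  also have "\<dots> = (\<Prod>c\<in>UNIV. (singular_value A (h c))\<^sup>2)"
    by (rule prod.reindex_bij_betw[OF h, symmetric])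
  also have "\<dots> = (\<Prod>c\<in>UNIV. ?D $ c $ c)"
    using D by (intro prod.cong) auto
  also have "\<dots> = det ?D"
    by (rule det_diagonal[symmetric]) (simp add: D)
  also have "\<dots> = (det A * det V) * (det A * det V)"
    by (simp only: det_mul det_transpose)
  also have "\<dots> = (det A)\<^sup>2 * (det V)\<^sup>2"
    by (simp add: power2_eq_square)
  also have "\<dots> = \<bar>det A\<bar>\<^sup>2"
    unfolding dV power2_abs mult_1_right ..
  finally have sq: "(\<Prod>i\<in>{1..CARD('n)}. singular_value A i)\<^sup>2 = \<bar>det A\<bar>\<^sup>2" .
  have "0 \<le> (\<Prod>i\<in>{1..CARD('n)}. singular_value A i)"
    by (rule prod_nonneg) (simp add: singular_value_nonneg)
  then show ?thesis by (rule power2_eq_imp_eq[OF sq _ abs_ge_zero])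
qed

text \<open>One half of the Courant-Fischer principle: for dimension reasons \<open>V\<close> meets the span of the right
singular vectors with indices \<open>m, \<dots>, n\<close>, on which \<open>A\<close> stretches at most by the \<open>m\<close>-th singular
value.\<close>
lemma singular_value_geI:
  fixes A :: "real^'n^'n"
  assumes "subspace V" "m \<le> dim V" "1 \<le> m" "m \<le> CARD('n)"
    and "\<And>x. x \<in> V \<Longrightarrow> \<beta> * norm x \<le> norm (A *v x)"
  shows "\<beta> \<le> singular_value A m"
proof -
  let ?n = "CARD('n)"
  obtain v where v: "singular_frame A v" using singular_frame_exists by metis
  then have fr: "orthonormal_frame ?n v" by (simp add: singular_frame_def)
  let ?W = "span (v ` {m..?n})"
  have "dim ?W = ?n - m + 1"
    using orthonormal_frame_independent(2)[OF fr, of "{m..?n}"] assms(3,4) by auto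
  moreover have "dim {x + y |x y. x \<in> V \<and> y \<in> ?W} \<le> ?n"
    using dim_subset_UNIV[of "{x + y |x y. x \<in> V \<and> y \<in> ?W}"] by simp
  ultimately have "dim (V \<inter> ?W) \<noteq> 0"
    using dim_sums_Int[OF assms(1) subspace_span[of "v ` {m..?n}"]] assms(2-4) by linarith
  then obtain x where x: "x \<in> V" "x \<in> ?W" "x \<noteq> 0" by (auto simp: dim_eq_0)
  have zero: "v i \<bullet> x = 0" if "i \<in> {1..<m}" for i
  proof -
    have "orthogonal (v i) x"
      using x(2)
    proof (rule orthogonal_to_span)
      show "orthogonal (v i) y" if "y \<in> v ` {m..?n}" for y
        using that \<open>i \<in> {1..<m}\<close> fr unfolding orthonormal_frame_def orthogonal_def by auto
    qed
    then show ?thesis by (simp add: orthogonal_def)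
  qed
  have "(norm (A *v x))\<^sup>2 \<le> (\<Sum>i\<in>{1..?n}. (singular_value A m)\<^sup>2 * (v i \<bullet> x)\<^sup>2)"
    unfolding singular_frame_norm[OF v]
  proof (rule sum_mono)
    fix i assume i: "i \<in> {1..?n}"
    show "(singular_value A i)\<^sup>2 * (v i \<bullet> x)\<^sup>2 \<le> (singular_value A m)\<^sup>2 * (v i \<bullet> x)\<^sup>2"
    proof (cases "i < m")
      case True then show ?thesis using zero[of i] i by simp
    next
      case False then show ?thesis using i assms(3,4)
        by (intro mult_right_mono power_mono singular_value_antimono singular_value_nonneg) auto
    qed
  qed
  also have "\<dots> = (singular_value A m * norm x)\<^sup>2"
    using orthonormal_frame_norm[OF fr, of x] by (simp add: power_mult_distrib sum_distrib_left)
  finally have "norm (A *v x) \<le> singular_value A m * norm x"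
    using assms(3,4) by (rule power2_le_imp_le[OF _ mult_nonneg_nonneg[OF singular_value_nonneg norm_ge_zero]])
  then have "\<beta> * norm x \<le> singular_value A m * norm x" using assms(5)[OF x(1)] by linarith
  then show ?thesis using x(3) by simp
qed

text \<open>The test space for the \<open>m\<close>-th singular value of \<open>A ** B\<close> is the preimage under \<open>B\<close> of the span of the
first \<open>m\<close> right singular vectors of \<open>A\<close>. The case \<open>m = n\<close> is the supermultiplicativity of
the smallest singular value.\<close>
lemma singular_value_mult_ge:
  fixes A B :: "real^'n^'n"
  assumes "invertible B" "1 \<le> m" "m \<le> CARD('n)"
  shows "singular_value A m * singular_value B CARD('n) \<le> singular_value (A ** B) m"
proof -
  let ?n = "CARD('n)"
  obtain v where v: "singular_frame A v" using singular_frame_exists by metis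
  then have fr: "orthonormal_frame ?n v" by (simp add: singular_frame_def)
  let ?W = "span (v ` {1..m})"
  obtain B' where B': "B' ** B = mat 1" "B ** B' = mat 1" using assms(1) invertible_def by blast
  let ?V = "(\<lambda>x. B' *v x) ` ?W"
  have "inj ((*v) B')"
    by (metis B' inj_matrix_vector_mult invertible_def)
  then have inj: "inj_on ((*v) B') (span ?W)" by (rule inj_on_subset) simp
  have "dim ?V = dim ?W" by (rule dim_image_eq[OF matrix_vector_mul_linear inj])
  then have dimV: "dim ?V = m"
    using orthonormal_frame_independent(2)[OF fr, of "{1..m}"] assms by auto
  have lower: "singular_value A m * norm x \<le> norm (A *v x)" if "x \<in> ?W" for x
  proof -
    have zero: "v i \<bullet> x = 0" if i: "i \<in> {m<..?n}" for i
    proof -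
      have "orthogonal (v i) x"
        using \<open>x \<in> ?W\<close>
      proof (rule orthogonal_to_span)
        show "orthogonal (v i) y" if "y \<in> v ` {1..m}" for y
          using that i fr assms unfolding orthonormal_frame_def orthogonal_def by auto
      qed
      then show ?thesis by (simp add: orthogonal_def)
    qed
    have "(singular_value A m * norm x)\<^sup>2 = (\<Sum>i\<in>{1..?n}. (singular_value A m)\<^sup>2 * (v i \<bullet> x)\<^sup>2)"
      using orthonormal_frame_norm[OF fr, of x] by (simp add: power_mult_distrib sum_distrib_left)
    also have "\<dots> \<le> (norm (A *v x))\<^sup>2"
      unfolding singular_frame_norm[OF v]
    proof (rule sum_mono)
      fix i assume i: "i \<in> {1..?n}"
      show "(singular_value A m)\<^sup>2 * (v i \<bullet> x)\<^sup>2 \<le> (singular_value A i)\<^sup>2 * (v i \<bullet> x)\<^sup>2"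
      proof (cases "i > m")
        case True then show ?thesis using zero[of i] i by simp
      next
        case False then show ?thesis using i assms
          by (intro mult_right_mono power_mono singular_value_antimono singular_value_nonneg) auto
      qed
    qed
    finally show ?thesis by (rule power2_le_imp_le) simp
  qed
  show ?thesis
  proof (rule singular_value_geI)
    show "subspace ?V"
      by (intro linear_subspace_image matrix_vector_mul_linear subspace_span)
    show "m \<le> dim ?V" using dimV by simp
    fix y assume "y \<in> ?V"
    then obtain x where x: "x \<in> ?W" "y = B' *v x" by auto
    have By: "B *v y = x" using x(2) B' by (simp add: matrix_vector_mul_assoc)
    have "singular_value A m * singular_value B ?n * norm y \<le> singular_value A m * norm x"
      unfolding By[symmetric] mult.assoc
      using assms by (intro mult_left_mono norm_ge_last_singular_value singular_value_nonneg) auto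
    also have "\<dots> \<le> norm ((A ** B) *v y)"
      using lower[OF x(1)] By by (simp add: matrix_vector_mul_assoc[symmetric])
    finally show "singular_value A m * singular_value B ?n * norm y \<le> norm ((A ** B) *v y)" .
  qed (use assms in auto)
qed

section \<open>The singular value function\<close>

text \<open>For \<open>0 \<le> t \<le> n\<close> the singular value function is the product of the singular values raised to these
exponents. They lie in \<open>[0, 1]\<close>, are continuous and monotone in \<open>t\<close> and add up to \<open>t\<close>, which replaces
the case distinction on the ceiling of \<open>t\<close>.\<close>
definition sv_weight :: "real \<Rightarrow> nat \<Rightarrow> real" where
  "sv_weight t i = min 1 (max 0 (t - (real i - 1)))"

lemma sum_sv_weight: "0 \<le> t \<Longrightarrow> (\<Sum>i\<in>{1..k}. sv_weight t i) = min t (real k)"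
  by (induction k) (auto simp: sv_weight_def)

lemma sv_weight_mono: "t \<le> t' \<Longrightarrow> sv_weight t i \<le> sv_weight t' i"
  by (auto simp: sv_weight_def)

lemma sv_weight_bounds: "0 \<le> sv_weight t i" "sv_weight t i \<le> 1"
  by (auto simp: sv_weight_def)

lemma sv_function_eq_prod:
  fixes A :: "real^'n^'n"
  assumes "invertible A" "0 \<le> t" "t \<le> real CARD('n)"
  shows "sv_function t A = (\<Prod>i\<in>{1..CARD('n)}. singular_value A i powr sv_weight t i)"
proof (cases "t = 0")
  case True
  have "singular_value A i powr sv_weight t i = 1" if "i \<in> {1..CARD('n)}" for i
    using singular_value_pos[OF assms(1), of i] that True by (auto simp: sv_weight_def)
  then show ?thesis using True by (simp add: sv_function_def)
next
  case False
  define m where "m = nat \<lceil>t\<rceil>"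
  have t0: "t > 0" using False assms by simp
  have m: "1 \<le> m" "m \<le> CARD('n)" "real m - 1 < t" "t \<le> real m"
    unfolding m_def using t0 assms(3) by (linarith | simp add: nat_le_iff ceiling_le_iff)+
  have "{1..CARD('n)} = {1..<m} \<union> {m} \<union> {m<..CARD('n)}" using m by auto
  then have "(\<Prod>i\<in>{1..CARD('n)}. singular_value A i powr sv_weight t i)
     = (\<Prod>i\<in>{1..<m} \<union> {m}. singular_value A i powr sv_weight t i) * (\<Prod>i\<in>{m<..CARD('n)}. singular_value A i powr sv_weight t i)"
    by (simp only:) (rule prod.union_disjoint; auto)
  also have "(\<Prod>i\<in>{1..<m} \<union> {m}. singular_value A i powr sv_weight t i) =
      (\<Prod>i\<in>{1..<m}. singular_value A i powr sv_weight t i) * singular_value A m powr sv_weight t m"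
    by (subst prod.union_disjoint) auto
  also have "(\<Prod>i\<in>{m<..CARD('n)}. singular_value A i powr sv_weight t i) = 1"
  proof (intro prod.neutral ballI)
    fix i assume i: "i \<in> {m<..CARD('n)}"
    then have "sv_weight t i = 0" using m by (auto simp: sv_weight_def)
    then show "singular_value A i powr sv_weight t i = 1"
      using singular_value_pos[OF assms(1), of i] i m by auto
  qed
  also have "(\<Prod>i\<in>{1..<m}. singular_value A i powr sv_weight t i) = (\<Prod>i\<in>{1..<m}. singular_value A i)"
  proof (intro prod.cong refl)
    fix i assume i: "i \<in> {1..<m}"
    then have "sv_weight t i = 1" using m by (auto simp: sv_weight_def)
    then show "singular_value A i powr sv_weight t i = singular_value A i"
      using singular_value_pos[OF assms(1), of i] i m by auto
  qed
  also have "sv_weight t m = t - real m + 1" using m by (auto simp: sv_weight_def)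
  finally show ?thesis using False assms by (simp add: sv_function_def Let_def m_def[symmetric])
qed

lemma sv_function_large:
  fixes A :: "real^'n^'n"
  assumes "invertible A" "real CARD('n) \<le> t"
  shows "sv_function t A = \<bar>det A\<bar> powr (t / real CARD('n))"
proof (cases "t = real CARD('n)")
  case True
  have "singular_value A i powr sv_weight t i = singular_value A i" if "i \<in> {1..CARD('n)}" for i
  proof -
    have "real i \<le> t" using that True by simp
    then have "sv_weight t i = 1" by (auto simp: sv_weight_def)
    then show ?thesis using singular_value_pos[OF assms(1), of i] that by auto
  qed
  then have "sv_function t A = (\<Prod>i\<in>{1..CARD('n)}. singular_value A i)"
    using sv_function_eq_prod[of A t] assms True by (simp del: One_nat_def)
  also have "\<dots> = \<bar>det A\<bar>" by (rule prod_singular_values)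
  finally show ?thesis using True by simp
next
  case False
  then have "t \<noteq> 0" "\<not> t \<le> real CARD('n)" using assms(2) by auto
  then show ?thesis unfolding sv_function_def by simp
qed

lemma sv_function_pos:
  fixes A :: "real^'n^'n"
  assumes "invertible A" "0 \<le> t"
  shows "0 < sv_function t A"
proof (cases "t \<le> real CARD('n)")
  case True
  have "0 < (\<Prod>i\<in>{1..CARD('n)}. singular_value A i powr sv_weight t i)"
  proof (rule prod_pos)
    fix i assume "i \<in> {1..CARD('n)}"
    then have "0 < singular_value A i" using singular_value_pos[OF assms(1), of i] by simp
    then show "0 < singular_value A i powr sv_weight t i" by simp
  qed
  then show ?thesis unfolding sv_function_eq_prod[OF assms True] .
next
  case False
  then have "real CARD('n) \<le> t" by simp
  from sv_function_large[OF assms(1) this] show ?thesis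
    using assms(1) by (simp add: invertible_det_nz)
qed

text \<open>Passing from \<open>t\<close> to \<open>t'\<close> adds exponents of total \<open>t' - t\<close> to numbers that are at most \<open>c\<close>.\<close>
lemma sv_function_decay:
  fixes A :: "real^'n^'n"
  assumes "invertible A" "0 \<le> t" "t \<le> t'" "t' \<le> real CARD('n)" "singular_value A 1 \<le> c"
  shows "sv_function t' A \<le> c powr (t' - t) * sv_function t A"
proof -
  let ?I = "{1..CARD('n)}"
  let ?\<sigma> = "singular_value A"
  have pos: "?\<sigma> i > 0" "?\<sigma> i \<le> c" if "i \<in> ?I" for i
    using singular_value_pos[OF assms(1), of i] singular_value_antimono[of 1 i A] that assms(5) by auto
  have c0: "c > 0" using pos[of 1] by fastforce
  have "sv_function t' A = (\<Prod>i\<in>?I. ?\<sigma> i powr (sv_weight t' i - sv_weight t i) * ?\<sigma> i powr sv_weight t i)"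
    using assms by (simp add: sv_function_eq_prod powr_add[symmetric])
  also have "\<dots> \<le> (\<Prod>i\<in>?I. c powr (sv_weight t' i - sv_weight t i) * ?\<sigma> i powr sv_weight t i)"
    using pos sv_weight_mono[OF assms(3)]
    by (intro prod_mono conjI mult_right_mono powr_mono2 mult_nonneg_nonneg) (auto simp: less_imp_le)
  also have "\<dots> = (\<Prod>i\<in>?I. c powr (sv_weight t' i - sv_weight t i)) * sv_function t A"
    using assms by (simp add: sv_function_eq_prod prod.distrib)
  also have "(\<Prod>i\<in>?I. c powr (sv_weight t' i - sv_weight t i)) = c powr (\<Sum>i\<in>?I. sv_weight t' i - sv_weight t i)"
    using c0 by (subst powr_sum) auto
  also have "(\<Sum>i\<in>?I. sv_weight t' i - sv_weight t i) = t' - t"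
    using assms by (simp add: sum_subtractf sum_sv_weight del: One_nat_def)
  finally show ?thesis .
qed

text \<open>The formulas for \<open>t \<le> n\<close> and for \<open>t \<ge> n\<close> agree at \<open>n\<close>; the second is a power of \<open>\<bar>det A\<bar> < 1\<close>.\<close>
lemma sv_function_strict_antimono:
  fixes A :: "real^'n^'n"
  assumes "invertible A" "0 \<le> t" "t < t'" "singular_value A 1 < 1"
  shows "sv_function t' A < sv_function t A"
proof -
  let ?n = "real CARD('n)"
  have n0: "?n > 0" by simp
  have pos1: "0 < singular_value A 1" using assms(1) by (simp add: singular_value_pos)
  have less: "sv_function b A < sv_function a A" if "0 \<le> a" "a < b" "b \<le> ?n" for a b
  proof -
    have "sv_function b A \<le> singular_value A 1 powr (b - a) * sv_function a A"
      using that assms by (intro sv_function_decay) auto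
    also have "\<dots> < 1 * sv_function a A"
      using that assms pos1 sv_function_pos[OF assms(1), of a]
      by (intro mult_strict_right_mono) (use powr_less_mono'[of "singular_value A 1" 0 "b - a"] in auto)
    finally show ?thesis by simp
  qed
  have det1: "0 < \<bar>det A\<bar>" using assms(1) by (simp add: invertible_det_nz)
  have "sv_function ?n A < sv_function 0 A" by (rule less) auto
  then have "\<bar>det A\<bar> < 1" using sv_function_large[OF assms(1), of ?n] by (simp add: sv_function_def)
  then have less2: "sv_function b A < sv_function a A" if "?n \<le> a" "a < b" for a b
    using that det1 n0 assms(1) by (simp add: sv_function_large powr_less_mono' divide_strict_right_mono)
  show ?thesis
  proof (cases "t' \<le> ?n")
    case True then show ?thesis using less assms by auto
  next
    case False
    show ?thesis
    proof (cases "t < ?n")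
      case True
      have "sv_function t' A < sv_function ?n A" using less2[of ?n t'] False by auto
      also have "\<dots> < sv_function t A" using less[of t ?n] True assms by auto
      finally show ?thesis .
    next
      case False then show ?thesis using less2 assms by auto
    qed
  qed
qed

lemma sv_function_continuous:
  fixes A :: "real^'n^'n"
  assumes "invertible A"
  shows "continuous_on {0..} (\<lambda>t. sv_function t A)"
proof -
  let ?n = "real CARD('n)"
  have pos: "singular_value A i \<noteq> 0" if "i \<in> {1..CARD('n)}" for i
    using singular_value_pos[OF assms, of i] that by auto
  have "continuous_on {0..?n} (\<lambda>t. \<Prod>i\<in>{1..CARD('n)}. singular_value A i powr sv_weight t i)"
    unfolding sv_weight_def using pos by (intro continuous_intros) auto
  then have 1: "continuous_on {0..?n} (\<lambda>t. sv_function t A)"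
    by (rule continuous_on_eq) (use assms in \<open>simp add: sv_function_eq_prod\<close>)
  have "continuous_on {?n..} (\<lambda>t. \<bar>det A\<bar> powr (t / ?n))"
    using assms by (intro continuous_intros) (auto simp: invertible_det_nz)
  then have 2: "continuous_on {?n..} (\<lambda>t. sv_function t A)"
    by (rule continuous_on_eq) (use assms in \<open>simp add: sv_function_large\<close>)
  have "{0..} = {0..?n} \<union> {?n..}" by auto
  then show ?thesis using continuous_on_closed_Un[OF _ _ 1 2] by simp
qed

lemma sv_function_tendsto_0:
  fixes A :: "real^'n^'n"
  assumes "invertible A" "singular_value A 1 < 1"
  shows "((\<lambda>t. sv_function t A) \<longlongrightarrow> 0) at_top"
proof -
  let ?n = "real CARD('n)"
  have det1: "0 < \<bar>det A\<bar>" using assms(1) by (simp add: invertible_det_nz)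
  have "sv_function ?n A < sv_function 0 A"
    using assms by (intro sv_function_strict_antimono) auto
  then have "\<bar>det A\<bar> < 1" using sv_function_large[OF assms(1), of ?n] by (simp add: sv_function_def)
  then have "((\<lambda>t. exp (ln \<bar>det A\<bar> / ?n * t)) \<longlongrightarrow> 0) at_top"
    using det1
    by (intro filterlim_compose[OF exp_at_bot] filterlim_tendsto_neg_mult_at_bot[OF tendsto_const])
       (auto simp: divide_neg_pos filterlim_ident)
  moreover have "\<forall>\<^sub>F t in at_top. exp (ln \<bar>det A\<bar> / ?n * t) = sv_function t A"
    using eventually_ge_at_top[of ?n]
  proof eventually_elim
    case (elim t)
    then show ?case using det1 sv_function_large[OF assms(1) elim] by (simp add: powr_def mult.commute)
  qed
  ultimately show ?thesis by (rule Lim_transform_eventually)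
qed

text \<open>The sum decreases strictly and continuously from \<open>card W \<ge> 1\<close> at \<open>t = 0\<close> to \<open>0\<close>. This is what makes
\<open>affinity_exponent\<close> a root of the equation in its definition.\<close>
lemma ex1_sv_pressure_zero:
  fixes A :: "'a \<Rightarrow> real^'n^'n"
  assumes "finite W" "W \<noteq> {}" "\<And>w. w \<in> W \<Longrightarrow> invertible (A w)"
    "\<And>w. w \<in> W \<Longrightarrow> singular_value (A w) 1 < 1"
  shows "\<exists>!t. 0 \<le> t \<and> (\<Sum>w\<in>W. sv_function t (A w)) = 1"
proof -
  let ?g = "\<lambda>t. \<Sum>w\<in>W. sv_function t (A w)"
  have mono: "?g b < ?g a" if "0 \<le> a" "a < b" for a b
    using that assms by (intro sum_strict_mono sv_function_strict_antimono) auto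
  have cont: "continuous_on {0..} ?g"
    using assms by (intro continuous_on_sum sv_function_continuous) auto
  have "?g 0 = real (card W)" by (simp add: sv_function_def)
  moreover have "card W \<ge> 1" using assms by (simp add: Suc_leI card_gt_0_iff)
  ultimately have g0: "1 \<le> ?g 0" by simp
  have "(?g \<longlongrightarrow> (\<Sum>w\<in>W. 0)) at_top"
    using assms by (intro tendsto_sum sv_function_tendsto_0) auto
  then have "\<forall>\<^sub>F t in at_top. ?g t < 1" by (intro order_tendstoD) auto
  then have "\<forall>\<^sub>F t in at_top. ?g t < 1 \<and> 0 \<le> t"
    using eventually_ge_at_top[of 0] by (rule eventually_conj)
  then obtain T where T: "?g T < 1" "0 \<le> T"
    using eventually_happens'[OF trivial_limit_at_top_linorder] by blast
  have "continuous_on {0..T} ?g" using cont continuous_on_subset by fastforce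
  then obtain t where "0 \<le> t" "?g t = 1"
    using IVT2'[of ?g T 1 0] T g0 by auto
  moreover have "t' = t" if "0 \<le> t'" "?g t' = 1" for t'
    using mono[of t t'] mono[of t' t] that calculation by (metis less_irrefl linorder_neqE_linordered_idom)
  ultimately show ?thesis by blast
qed

text \<open>The right-hand side gives every singular value the full exponent \<open>1\<close> and takes the excess \<open>n - t\<close>
off the smallest one, which can only increase the product. Unlike \<open>sv_function\<close> it is evidently
submultiplicative in \<open>A\<close>.\<close>
lemma sv_function_le_det:
  fixes A :: "real^'n^'n"
  assumes "invertible A" "0 \<le> t" "t \<le> real CARD('n)"
  shows "sv_function t A \<le> \<bar>det A\<bar> * singular_value A CARD('n) powr (t - real CARD('n))"
proof -
  let ?I = "{1..CARD('n)}"
  let ?\<sigma> = "singular_value A"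
  let ?a = "singular_value A CARD('n)"
  have pos: "?\<sigma> i > 0" "?a \<le> ?\<sigma> i" if "i \<in> ?I" for i
    using singular_value_pos[OF assms(1), of i] singular_value_antimono[of i "CARD('n)" A] that by auto
  have a0: "?a > 0" using singular_value_pos[OF assms(1)] by simp
  have "sv_function t A = (\<Prod>i\<in>?I. ?\<sigma> i powr sv_weight t i)" using assms by (rule sv_function_eq_prod)
  also have "\<dots> \<le> (\<Prod>i\<in>?I. ?\<sigma> i * ?a powr (sv_weight t i - 1))"
  proof (intro prod_mono conjI)
    fix i assume i: "i \<in> ?I"
    have "?\<sigma> i powr sv_weight t i = ?\<sigma> i * ?\<sigma> i powr (sv_weight t i - 1)"
      using pos[OF i] by (simp add: powr_diff)
    also have "\<dots> \<le> ?\<sigma> i * ?a powr (sv_weight t i - 1)"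
      using pos[OF i] a0 sv_weight_bounds[of t i] by (intro mult_left_mono powr_mono2') auto
    finally show "?\<sigma> i powr sv_weight t i \<le> ?\<sigma> i * ?a powr (sv_weight t i - 1)" .
  qed simp
  also have "\<dots> = \<bar>det A\<bar> * ?a powr (\<Sum>i\<in>?I. sv_weight t i - 1)"
    using a0 by (simp add: prod.distrib prod_singular_values powr_sum del: One_nat_def)
  also have "(\<Sum>i\<in>?I. sv_weight t i - 1) = t - real CARD('n)"
    using assms by (simp only: sum_subtractf sum_sv_weight) simp
  finally show ?thesis .
qed

text \<open>Up to a constant, the left-hand side is the number of cubes with the \<open>m\<close>-th semi-axis as side that
cover the ellipsoid onto which \<open>A\<close> maps the unit ball.\<close>
lemma sv_function_axis_ratios:
  fixes A :: "real^'n^'n"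
  assumes "invertible A" "0 < t" "t \<le> real CARD('n)" "m = nat \<lceil>t\<rceil>"
  shows "(\<Prod>i\<in>{1..CARD('n)}. max 1 (singular_value A i / singular_value A m))
    = sv_function t A * singular_value A m powr (- t)"
proof -
  let ?I = "{1..CARD('n)}"
  let ?\<sigma> = "singular_value A"
  have m: "1 \<le> m" "m \<le> CARD('n)" "real m - 1 < t" "t \<le> real m"
    using assms(4) assms(2,3) by (linarith | simp add: nat_le_iff ceiling_le_iff)+
  have pos: "?\<sigma> i > 0" if "i \<in> ?I" for i
    using singular_value_pos[OF assms(1), of i] that by auto
  have m0: "?\<sigma> m > 0" using singular_value_pos[OF assms(1) m(1,2)] .
  have "sv_function t A * ?\<sigma> m powr (- t)
     = (\<Prod>i\<in>?I. ?\<sigma> i powr sv_weight t i) * ?\<sigma> m powr (\<Sum>i\<in>?I. - sv_weight t i)"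
    unfolding sum_negf using assms(1-3)
    by (simp only: sv_function_eq_prod sum_sv_weight less_imp_le min_absorb1)
  also have "\<dots> = (\<Prod>i\<in>?I. ?\<sigma> i powr sv_weight t i * ?\<sigma> m powr (- sv_weight t i))"
    using m0 by (simp add: powr_sum prod.distrib)
  also have "\<dots> = (\<Prod>i\<in>?I. max 1 (?\<sigma> i / ?\<sigma> m))"
  proof (intro prod.cong refl)
    fix i assume i: "i \<in> ?I"
    consider "i < m" | "i = m" | "i > m" by linarith
    then show "?\<sigma> i powr sv_weight t i * ?\<sigma> m powr (- sv_weight t i) = max 1 (?\<sigma> i / ?\<sigma> m)"
    proof cases
      case 1
      then have "sv_weight t i = 1" using m by (auto simp: sv_weight_def)
      moreover have "1 \<le> ?\<sigma> i / ?\<sigma> m" using 1 i m m0 singular_value_antimono[of i m A] by simp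
      ultimately show ?thesis using pos[OF i] m0 by (simp add: powr_minus divide_simps max_def)
    next
      case 2 then show ?thesis using m0 by (simp add: powr_minus)
    next
      case 3
      then have "sv_weight t i = 0" using m by (auto simp: sv_weight_def)
      moreover have "?\<sigma> i / ?\<sigma> m \<le> 1" using 3 i m m0 singular_value_antimono[of m i A] by simp
      ultimately show ?thesis using pos[OF i] m0 by (simp add: max_def)
    qed
  qed
  finally show ?thesis by simp
qed

section \<open>Covering numbers\<close>

text \<open>The net consists of all combinations of the \<open>w i\<close> with coefficients in a grid of mesh \<open>h i\<close>.
Rounding moves the \<open>i\<close>-th term by at most \<open>\<epsilon> / n\<close>. With \<open>A *v v i\<close> for \<open>w i\<close> this covers
ellipsoids, with right singular vectors it covers projections of preimages of cubes.\<close>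
lemma grid_net:
  fixes w :: "'i \<Rightarrow> 'a::real_normed_vector"
  assumes "finite I" "card I \<le> n" "0 < n" "0 < \<epsilon>" "\<And>i. i \<in> I \<Longrightarrow> 0 \<le> r i"
    "\<And>i. i \<in> I \<Longrightarrow> w i \<noteq> 0"
  shows "\<exists>P. finite P \<and> real (card P) \<le> (\<Prod>i\<in>I. real n * r i / \<epsilon> + 2) \<and>
    (\<forall>c. (\<forall>i\<in>I. \<bar>c i\<bar> * norm (w i) \<le> r i) \<longrightarrow> (\<exists>p\<in>P. norm ((\<Sum>i\<in>I. c i *\<^sub>R w i) - p) \<le> \<epsilon>))"
proof -
  define h where "h i = 2 * \<epsilon> / (real n * norm (w i))" for i
  define q where "q i = real n * r i / \<epsilon>" for i
  define L where "L i = \<lfloor>q i / 2 + 1/2\<rfloor>" for i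
  define J where "J = Pi\<^sub>E I (\<lambda>i. {- L i..L i})"
  let ?f = "\<lambda>j. \<Sum>i\<in>I. (of_int (j i) * h i) *\<^sub>R w i"
  have finJ: "finite J" unfolding J_def using assms by (intro finite_PiE) auto
  have hpos: "h i > 0" if "i \<in> I" for i using assms that unfolding h_def by simp
  have L0: "0 \<le> L i" if "i \<in> I" for i using assms that unfolding L_def q_def by simp
  have "real (card (?f ` J)) \<le> real (card J)" using finJ by (simp add: card_image_le)
  also have "\<dots> = (\<Prod>i\<in>I. real_of_int (2 * L i + 1))"
    unfolding J_def using assms(1) L0 by (simp add: card_PiE)
  also have "\<dots> \<le> (\<Prod>i\<in>I. real n * r i / \<epsilon> + 2)"
  proof (intro prod_mono conjI)
    fix i assume i: "i \<in> I"
    show "0 \<le> real_of_int (2 * L i + 1)" using L0[OF i] by simp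
    have "real_of_int (L i) \<le> q i / 2 + 1/2" unfolding L_def by linarith
    then have "real_of_int (2 * L i + 1) \<le> q i + 2" by simp
    then show "real_of_int (2 * L i + 1) \<le> real n * r i / \<epsilon> + 2" by (simp only: q_def)
  qed
  finally have card: "real (card (?f ` J)) \<le> (\<Prod>i\<in>I. real n * r i / \<epsilon> + 2)" .
  have "\<exists>p\<in>?f ` J. norm ((\<Sum>i\<in>I. c i *\<^sub>R w i) - p) \<le> \<epsilon>" if c: "\<forall>i\<in>I. \<bar>c i\<bar> * norm (w i) \<le> r i" for c
  proof
    define j where "j = restrict (\<lambda>i. round (c i / h i)) I"
    have close: "\<bar>c i - of_int (j i) * h i\<bar> \<le> h i / 2" if i: "i \<in> I" for i
    proof -
      have "c i - of_int (j i) * h i = (c i / h i - of_int (j i)) * h i"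
        using hpos[OF i] by (simp add: left_diff_distrib)
      then have "\<bar>c i - of_int (j i) * h i\<bar> = \<bar>c i / h i - of_int (j i)\<bar> * h i"
        using hpos[OF i] by (simp only: abs_mult abs_of_pos)
      also have "\<dots> \<le> 1/2 * h i"
        using of_int_round_abs_le[of "c i / h i"] hpos[OF i] i unfolding j_def
        by (intro mult_right_mono) (auto simp: abs_minus_commute)
      finally show ?thesis by simp
    qed
    have "j \<in> J"
      unfolding J_def
    proof (rule PiE_I)
      fix i assume i: "i \<in> I"
      have "\<bar>c i / h i\<bar> = \<bar>c i\<bar> * norm (w i) * (real n / (2 * \<epsilon>))"
        using assms i by (simp add: h_def abs_mult field_simps)
      also have "\<dots> \<le> r i * (real n / (2 * \<epsilon>))"
        using c i assms by (intro mult_right_mono) auto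
      finally have "\<bar>c i / h i\<bar> \<le> q i / 2" by (simp add: q_def mult.commute)
      moreover have "\<bar>of_int (j i) - c i / h i\<bar> \<le> 1/2"
        using of_int_round_abs_le[of "c i / h i"] i by (simp add: j_def)
      ultimately have "\<bar>real_of_int (j i)\<bar> \<le> q i / 2 + 1/2" by linarith
      then have "\<bar>j i\<bar> \<le> L i" unfolding L_def by (simp add: le_floor_iff)
      then show "j i \<in> {- L i..L i}" by auto
    qed (simp add: j_def)
    then show "?f j \<in> ?f ` J" by simp
    have "norm ((\<Sum>i\<in>I. c i *\<^sub>R w i) - ?f j) = norm (\<Sum>i\<in>I. (c i - of_int (j i) * h i) *\<^sub>R w i)"
      by (simp add: sum_subtractf scaleR_diff_left)
    also have "\<dots> \<le> (\<Sum>i\<in>I. \<epsilon> / real n)"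
    proof (rule sum_norm_le)
      fix i assume i: "i \<in> I"
      have "norm ((c i - of_int (j i) * h i) *\<^sub>R w i) \<le> h i / 2 * norm (w i)"
        unfolding norm_scaleR by (rule mult_right_mono[OF close[OF i] norm_ge_zero])
      also have "\<dots> = \<epsilon> / real n" using assms(6)[OF i] by (simp add: h_def)
      finally show "norm ((c i - of_int (j i) * h i) *\<^sub>R w i) \<le> \<epsilon> / real n" .
    qed
    also have "\<dots> = real (card I) / real n * \<epsilon>" by simp
    also have "\<dots> \<le> 1 * \<epsilon>" using assms by (intro mult_right_mono) auto
    finally show "norm ((\<Sum>i\<in>I. c i *\<^sub>R w i) - ?f j) \<le> \<epsilon>" by simp
  qed
  with card finJ show ?thesis by (intro exI[of _ "?f ` J"]) auto
qed

lemma cube_norm_diff: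
  fixes x y :: "real^'n"
  assumes "x \<in> cube \<delta> a" "y \<in> cube \<delta> a"
  shows "norm (x - y) \<le> real CARD('n) * \<delta>"
proof -
  have "norm (x - y) \<le> (\<Sum>i\<in>UNIV. \<bar>(x - y) $ i\<bar>)" by (rule norm_le_l1_cart)
  also have "\<dots> \<le> (\<Sum>i\<in>(UNIV::'n set). \<delta>)"
  proof (rule sum_mono)
    fix i
    have "a $ i \<le> x $ i" "x $ i \<le> a $ i + \<delta>" "a $ i \<le> y $ i" "y $ i \<le> a $ i + \<delta>"
      using assms by (auto simp: cube_def mem_box_cart)
    then show "\<bar>(x - y) $ i\<bar> \<le> \<delta>" by simp
  qed
  finally show ?thesis by simp
qed

lemma cball_subset_cube:
  fixes c :: "real^'n"
  shows "cball c r \<subseteq> cube (2 * r) (c - (\<chi> i. r))"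
proof
  fix y assume "y \<in> cball c r"
  then have "norm (y - c) \<le> r" by (simp add: dist_norm norm_minus_commute)
  then have "\<bar>y $ i - c $ i\<bar> \<le> r" for i
    using component_le_norm_cart[of "y - c" i] by simp
  then show "y \<in> cube (2 * r) (c - (\<chi> i. r))"
    by (auto simp: cube_def mem_box_cart abs_le_iff algebra_simps)
qed

lemma covering_number_le_family:
  assumes "finite I" "X \<subseteq> (\<Union>i\<in>I. cube \<delta> (f i))"
  shows "covering_number \<delta> X \<le> card I"
proof -
  have "covering_number \<delta> X \<le> card ((\<lambda>i. cube \<delta> (f i)) ` I)"
    unfolding covering_number_def using assms by (intro Least_le) (auto intro!: exI[of _ "(\<lambda>i. cube \<delta> (f i)) ` I"])
  also have "\<dots> \<le> card I" by (rule card_image_le) fact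
  finally show ?thesis .
qed

lemma covering_number_le_net:
  fixes X :: "(real^'n) set"
  assumes "finite P" "\<And>x. x \<in> X \<Longrightarrow> \<exists>p\<in>P. norm (x - p) \<le> \<delta> / 2"
  shows "covering_number \<delta> X \<le> card P"
proof (rule covering_number_le_family[OF assms(1)])
  show "X \<subseteq> (\<Union>p\<in>P. cube \<delta> (p - (\<chi> i. \<delta> / 2)))"
  proof
    fix x assume "x \<in> X"
    from assms(2)[OF this] obtain p where p: "p \<in> P" "x \<in> cball p (\<delta> / 2)"
      by (auto simp: dist_norm norm_minus_commute)
    then show "x \<in> (\<Union>p\<in>P. cube \<delta> (p - (\<chi> i. \<delta> / 2)))"
      using cball_subset_cube[of p "\<delta>/2"] by auto
  qed
qed

lemma covering_number_attained:
  fixes X :: "(real^'n) set"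
  assumes "bounded X" "0 < \<delta>"
  obtains T where "finite T" "card T = covering_number \<delta> X" "T \<subseteq> range (cube \<delta>)" "X \<subseteq> \<Union>T"
proof -
  have "compact (closure X)" using assms by (simp add: compact_closure)
  then obtain P where P: "finite P" "closure X \<subseteq> (\<Union>p\<in>P. ball p (\<delta> / 2))"
    using assms(2) unfolding compact_eq_totally_bounded by (metis half_gt_zero)
  let ?T = "(\<lambda>p. cube \<delta> (p - (\<chi> i. \<delta> / 2))) ` P"
  have "X \<subseteq> \<Union>?T"
  proof
    fix x assume "x \<in> X"
    then obtain p where "p \<in> P" "x \<in> ball p (\<delta> / 2)" using P closure_subset by blast
    then show "x \<in> \<Union>?T" using cball_subset_cube[of p "\<delta>/2"] ball_subset_cball by fastforce
  qed
  then have "\<exists>T. finite T \<and> card T = card ?T \<and> T \<subseteq> range (cube \<delta>) \<and> X \<subseteq> \<Union>T"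
    using P(1) by blast
  then have "\<exists>m T. finite T \<and> card T = m \<and> T \<subseteq> range (cube \<delta>) \<and> X \<subseteq> \<Union>T" by blast
  from LeastI_ex[OF this] show ?thesis using that unfolding covering_number_def by blast
qed

text \<open>Cubes of a given side are determined by their corners, so a cover may be handled as a set of points.\<close>
lemma covering_number_attained_corners:
  fixes X :: "(real^'n) set"
  assumes "bounded X" "0 < \<delta>"
  obtains P where "finite P" "card P = covering_number \<delta> X" "X \<subseteq> (\<Union>p\<in>P. cube \<delta> p)"
proof -
  obtain T where T: "finite T" "card T = covering_number \<delta> X" "T \<subseteq> range (cube \<delta>)" "X \<subseteq> \<Union>T"
    using covering_number_attained[OF assms] by blast
  then obtain P where "inj_on (cube \<delta>) P" "T = cube \<delta> ` P"
    using subset_image_inj[of T "cube \<delta>" UNIV] by blast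
  with T show ?thesis using that[of P] by (auto simp: card_image finite_image_iff)
qed

lemma covering_number_mono:
  fixes X Y :: "(real^'n) set"
  assumes "X \<subseteq> Y" "bounded Y" "0 < \<delta>"
  shows "covering_number \<delta> X \<le> covering_number \<delta> Y"
proof -
  obtain P where P: "finite P" "card P = covering_number \<delta> Y" "Y \<subseteq> (\<Union>p\<in>P. cube \<delta> p)"
    using covering_number_attained_corners[OF assms(2,3)] by blast
  then show ?thesis using covering_number_le_family[of P X \<delta> "\<lambda>p. p"] assms(1) by auto
qed

lemma covering_number_antimono:
  fixes X :: "(real^'n) set"
  assumes "bounded X" "0 < \<delta>" "\<delta> \<le> \<delta>'"
  shows "covering_number \<delta>' X \<le> covering_number \<delta> X"
proof -
  obtain P where P: "finite P" "card P = covering_number \<delta> X" "X \<subseteq> (\<Union>p\<in>P. cube \<delta> p)"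
    using covering_number_attained_corners[OF assms(1,2)] by blast
  have "cube \<delta> p \<subseteq> cube \<delta>' p" for p :: "real^'n"
    using assms(3) by (auto simp: cube_def mem_box_cart) (smt (verit))
  then show ?thesis using covering_number_le_family[of P X \<delta>' "\<lambda>p. p"] P by fastforce
qed

lemma covering_number_UN_le:
  fixes X :: "'i \<Rightarrow> (real^'n) set"
  assumes "finite I" "\<And>i. i \<in> I \<Longrightarrow> bounded (X i)" "0 < \<delta>"
  shows "covering_number \<delta> (\<Union>i\<in>I. X i) \<le> (\<Sum>i\<in>I. covering_number \<delta> (X i))"
proof -
  have "\<exists>P. finite P \<and> card P = covering_number \<delta> (X i) \<and> X i \<subseteq> (\<Union>p\<in>P. cube \<delta> p)" if "i \<in> I" for i
    using covering_number_attained_corners[OF assms(2)[OF that] assms(3)] by metis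
  then obtain P where P: "\<And>i. i \<in> I \<Longrightarrow> finite (P i)" "\<And>i. i \<in> I \<Longrightarrow> card (P i) = covering_number \<delta> (X i)"
      "\<And>i. i \<in> I \<Longrightarrow> X i \<subseteq> (\<Union>p\<in>P i. cube \<delta> p)" by metis
  have "covering_number \<delta> (\<Union>i\<in>I. X i) \<le> card (\<Union>i\<in>I. P i)"
    using P assms(1) by (intro covering_number_le_family[where f = "\<lambda>p. p"]) fastforce+
  also have "\<dots> \<le> (\<Sum>i\<in>I. card (P i))" by (rule card_UN_le) fact
  finally show ?thesis using P(2) by simp
qed

lemma covering_number_pos:
  fixes X :: "(real^'n) set"
  assumes "bounded X" "X \<noteq> {}" "0 < \<delta>"
  shows "1 \<le> covering_number \<delta> X"
proof -
  obtain P where P: "finite P" "card P = covering_number \<delta> X" "X \<subseteq> (\<Union>p\<in>P. cube \<delta> p)"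
    using covering_number_attained_corners[OF assms(1,3)] by blast
  then have "P \<noteq> {}" using assms(2) by auto
  then show ?thesis using P by (metis Suc_leI One_nat_def card_gt_0_iff)
qed

lemma covering_number_affine_cball:
  fixes A :: "real^'n^'n"
  assumes "invertible A" "0 < \<delta>" "0 \<le> \<rho>"
  shows "\<exists>P. finite P \<and>
    real (card P) \<le> (\<Prod>i\<in>{1..CARD('n)}. 2 * real CARD('n) * (\<rho> * singular_value A i / \<delta>) + 2) \<and>
    (\<forall>x. norm (x - a) \<le> \<rho> \<longrightarrow> (\<exists>p\<in>P. norm (A *v x + b - p) \<le> \<delta> / 2))"
proof -
  let ?I = "{1..CARD('n)}"
  obtain v where v: "singular_frame A v" using singular_frame_exists by metis
  then have fr: "orthonormal_frame CARD('n) v" by (simp add: singular_frame_def)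
  have nv: "norm (v i) = 1" "norm (A *v v i) = singular_value A i" "singular_value A i > 0" if "i \<in> ?I" for i
    using singular_frame_norm_vector[OF v that] singular_value_pos[OF assms(1), of i] that by auto
  have "\<exists>P. finite P \<and> real (card P) \<le> (\<Prod>i\<in>?I. real CARD('n) * (\<rho> * singular_value A i) / (\<delta> / 2) + 2) \<and>
    (\<forall>c. (\<forall>i\<in>?I. \<bar>c i\<bar> * norm (A *v v i) \<le> \<rho> * singular_value A i) \<longrightarrow>
      (\<exists>p\<in>P. norm ((\<Sum>i\<in>?I. c i *\<^sub>R (A *v v i)) - p) \<le> \<delta> / 2))"
  proof (rule grid_net)
    fix i assume i: "i \<in> ?I"
    show "0 \<le> \<rho> * singular_value A i" using assms(3) nv(3)[OF i] by simp
    show "A *v v i \<noteq> 0" using nv(2,3)[OF i] by auto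
  qed (use assms(2) in auto)
  then obtain P where P: "finite P" "real (card P) \<le> (\<Prod>i\<in>?I. real CARD('n) * (\<rho> * singular_value A i) / (\<delta> / 2) + 2)"
    "\<forall>c. (\<forall>i\<in>?I. \<bar>c i\<bar> * norm (A *v v i) \<le> \<rho> * singular_value A i) \<longrightarrow>
      (\<exists>p\<in>P. norm ((\<Sum>i\<in>?I. c i *\<^sub>R (A *v v i)) - p) \<le> \<delta> / 2)" by (elim exE conjE)
  show ?thesis
  proof (intro exI[of _ "(\<lambda>p. A *v a + b + p) ` P"] conjI allI impI)
    show "finite ((\<lambda>p. A *v a + b + p) ` P)" using P by simp
    show "real (card ((\<lambda>p. A *v a + b + p) ` P)) \<le> (\<Prod>i\<in>?I. 2 * real CARD('n) * (\<rho> * singular_value A i / \<delta>) + 2)"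
    proof -
      have "card ((\<lambda>p. A *v a + b + p) ` P) = card P" by (simp add: card_image inj_on_def)
      moreover have "real CARD('n) * (\<rho> * \<sigma>) / (\<delta> / 2) + 2 = 2 * real CARD('n) * (\<rho> * \<sigma> / \<delta>) + 2" for \<sigma>
        by simp
      ultimately show ?thesis using P(2) by (simp only:)
    qed
    fix x assume x: "norm (x - a) \<le> \<rho>"
    have c: "\<bar>v i \<bullet> (x - a)\<bar> * norm (A *v v i) \<le> \<rho> * singular_value A i" if "i \<in> ?I" for i
    proof -
      have "\<bar>v i \<bullet> (x - a)\<bar> \<le> \<rho>" using Cauchy_Schwarz_ineq2[of "v i" "x - a"] nv[OF that] x by simp
      then show ?thesis using nv[OF that] by (simp add: mult_right_mono)
    qed
    have "A *v (x - a) = A *v (\<Sum>i\<in>?I. (v i \<bullet> (x - a)) *\<^sub>R v i)"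
      by (rule arg_cong[OF orthonormal_frame_expand[OF fr]])
    also have "\<dots> = (\<Sum>i\<in>?I. (v i \<bullet> (x - a)) *\<^sub>R (A *v v i))"
      by (simp add: matrix_vector_mult_scaleR linear_sum[OF matrix_vector_mul_linear])
    finally have "A *v x = A *v a + (\<Sum>i\<in>?I. (v i \<bullet> (x - a)) *\<^sub>R (A *v v i))"
      by (simp add: matrix_vector_mult_diff_distrib algebra_simps)
    moreover have "\<exists>p\<in>P. norm ((\<Sum>i\<in>?I. (v i \<bullet> (x - a)) *\<^sub>R (A *v v i)) - p) \<le> \<delta> / 2"
      by (rule P(3)[rule_format]) (rule c)
    then obtain p where "p \<in> P" "norm ((\<Sum>i\<in>?I. (v i \<bullet> (x - a)) *\<^sub>R (A *v v i)) - p) \<le> \<delta> / 2"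
      by blast
    moreover have "a' + s + b - (a' + b + p) = s - p" for a' s p :: "real^'n" by simp
    ultimately show "\<exists>p\<in>(\<lambda>p. A *v a + b + p) ` P. norm (A *v x + b - p) \<le> \<delta> / 2"
      by (intro bexI[of _ "A *v a + b + p"] imageI) (simp_all only:)
  qed
qed

text \<open>A cube of side \<open>\<delta> / \<alpha>\<^sub>m\<close> goes to a set inside an ellipsoid with semi-axes about \<open>\<delta> \<alpha>\<^sub>i / \<alpha>\<^sub>m\<close>, which takes
about \<open>max 1 (\<alpha>\<^sub>i / \<alpha>\<^sub>m)\<close> cubes of side \<open>\<delta>\<close> in the \<open>i\<close>-th direction.\<close>
lemma covering_number_affine_image:
  fixes A :: "real^'n^'n"
  assumes "invertible A" "bounded X" "0 < t" "t \<le> real CARD('n)" "m = nat \<lceil>t\<rceil>" "0 < \<delta>"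
  shows "real (covering_number \<delta> ((\<lambda>x. A *v x + b) ` X)) \<le>
    (2 * (real CARD('n))\<^sup>2 + 2) ^ CARD('n) * (real (covering_number (\<delta> / singular_value A m) X)
      * (sv_function t A * singular_value A m powr (- t)))"
proof -
  let ?I = "{1..CARD('n)}" and ?n = "real CARD('n)" and ?\<sigma> = "singular_value A"
  have m: "1 \<le> m" "m \<le> CARD('n)"
    using assms(5) assms(3,4) by (linarith | simp add: nat_le_iff ceiling_le_iff)+
  have mpos: "?\<sigma> m > 0" using singular_value_pos[OF assms(1)] m by simp
  define \<eta> where "\<eta> = \<delta> / ?\<sigma> m"
  have \<eta>: "\<eta> > 0" using assms mpos by (simp add: \<eta>_def)
  obtain Q where Q: "finite Q" "card Q = covering_number \<eta> X" "X \<subseteq> (\<Union>q\<in>Q. cube \<eta> q)"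
    using covering_number_attained_corners[OF assms(2) \<eta>] by blast
  define M where "M = (\<Prod>i\<in>?I. 2 * ?n * (?n * \<eta> * ?\<sigma> i / \<delta>) + 2)"
  have "\<exists>P. finite P \<and> real (card P) \<le> M \<and>
     (\<forall>x. norm (x - q) \<le> ?n * \<eta> \<longrightarrow> (\<exists>p\<in>P. norm (A *v x + b - p) \<le> \<delta> / 2))" for q
    unfolding M_def using \<eta> assms(6)
    by (intro covering_number_affine_cball[OF assms(1)]) auto
  then obtain P where P: "\<And>q. finite (P q)" "\<And>q. real (card (P q)) \<le> M"
     "\<And>q x. norm (x - q) \<le> ?n * \<eta> \<Longrightarrow> \<exists>p\<in>P q. norm (A *v x + b - p) \<le> \<delta> / 2" by metis
  have "covering_number \<delta> ((\<lambda>x. A *v x + b) ` X) \<le> card (\<Union>q\<in>Q. P q)"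
  proof (rule covering_number_le_net)
    show "finite (\<Union>q\<in>Q. P q)" using Q P by auto
    fix y assume "y \<in> (\<lambda>x. A *v x + b) ` X"
    then obtain x where x: "x \<in> X" "y = A *v x + b" by auto
    then obtain q where q: "q \<in> Q" "x \<in> cube \<eta> q" using Q by auto
    moreover have "q \<in> cube \<eta> q" using \<eta> by (auto simp: cube_def mem_box_cart)
    ultimately have "norm (x - q) \<le> ?n * \<eta>" using cube_norm_diff by blast
    from P(3)[OF this] show "\<exists>p\<in>\<Union> (P ` Q). norm (y - p) \<le> \<delta> / 2" using x q by auto
  qed
  also have "\<dots> \<le> (\<Sum>q\<in>Q. card (P q))" by (rule card_UN_le) (rule Q)
  finally have "real (covering_number \<delta> ((\<lambda>x. A *v x + b) ` X)) \<le> (\<Sum>q\<in>Q. real (card (P q)))"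
    by (metis of_nat_le_iff of_nat_sum)
  also have "\<dots> \<le> (\<Sum>q\<in>Q. M)" by (intro sum_mono P)
  also have "\<dots> = real (covering_number \<eta> X) * M" using Q by simp
  also have "\<dots> \<le> real (covering_number \<eta> X) * ((2 * ?n\<^sup>2 + 2) ^ CARD('n) * (\<Prod>i\<in>?I. max 1 (?\<sigma> i / ?\<sigma> m)))"
  proof (rule mult_left_mono)
    have "M \<le> (\<Prod>i\<in>?I. (2 * ?n\<^sup>2 + 2) * max 1 (?\<sigma> i / ?\<sigma> m))"
      unfolding M_def
    proof (intro prod_mono conjI)
      fix i assume i: "i \<in> ?I"
      have \<sigma>0: "?\<sigma> i > 0" using singular_value_pos[OF assms(1)] i by simp
      have eq: "2 * ?n * (?n * \<eta> * ?\<sigma> i / \<delta>) + 2 = 2 * ?n\<^sup>2 * (?\<sigma> i / ?\<sigma> m) + 2 * 1"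
        using assms(6) by (simp add: \<eta>_def power2_eq_square)
      show "0 \<le> 2 * ?n * (?n * \<eta> * ?\<sigma> i / \<delta>) + 2"
        unfolding eq using \<sigma>0 mpos by simp
      show "2 * ?n * (?n * \<eta> * ?\<sigma> i / \<delta>) + 2 \<le> (2 * ?n\<^sup>2 + 2) * max 1 (?\<sigma> i / ?\<sigma> m)"
        unfolding eq distrib_right by (intro add_mono mult_left_mono) auto
    qed
    then show "M \<le> (2 * ?n\<^sup>2 + 2) ^ CARD('n) * (\<Prod>i\<in>?I. max 1 (?\<sigma> i / ?\<sigma> m))"
      by (simp add: prod.distrib)
  qed simp
  finally show ?thesis
    unfolding sv_function_axis_ratios[OF assms(1,3,4,5)] \<eta>_def by (simp add: mult_ac)
qed

section \<open>Box dimensions\<close>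

lemma upper_box_dim_leI:
  fixes F :: "(real^'n) set"
  assumes "bounded F" "F \<noteq> {}" "0 < \<delta>\<^sub>0" "0 < K"
    "\<And>\<delta>. 0 < \<delta> \<Longrightarrow> \<delta> < \<delta>\<^sub>0 \<Longrightarrow> real (covering_number \<delta> F) \<le> K * \<delta> powr (- t)"
  shows "upper_box_dim F \<le> ereal t"
proof -
  let ?g = "\<lambda>\<delta>::real. ln K / - ln \<delta> + t"
  have "eventually (\<lambda>\<delta>. \<delta> \<in> {0<..<min \<delta>\<^sub>0 1}) (at_right (0::real))"
    using assms(3) by (intro eventually_at_right_real) auto
  then have "eventually (\<lambda>\<delta>. ereal (ln (real (covering_number \<delta> F)) / - ln \<delta>) \<le> ereal (?g \<delta>)) (at_right 0)"
  proof eventually_elim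
    case (elim \<delta>)
    then have \<delta>: "0 < \<delta>" "\<delta> < \<delta>\<^sub>0" "\<delta> < 1" by auto
    have "1 \<le> covering_number \<delta> F" using assms \<delta> by (intro covering_number_pos) auto
    then have "ln (real (covering_number \<delta> F)) \<le> ln (K * \<delta> powr (- t))"
      using assms(4) assms(5)[OF \<delta>(1,2)] \<delta> by (subst ln_le_cancel_iff) auto
    also have "\<dots> = ln K - t * ln \<delta>" using \<delta> assms(4) by (simp add: ln_mult ln_powr)
    finally have "ln (real (covering_number \<delta> F)) / - ln \<delta> \<le> (ln K - t * ln \<delta>) / - ln \<delta>"
      using \<delta> by (intro divide_right_mono) auto
    also have "\<dots> = ?g \<delta>" using \<delta> by (simp add: field_simps)
    finally show ?case by simp
  qed
  then have "upper_box_dim F \<le> Limsup (at_right 0) (\<lambda>\<delta>. ereal (?g \<delta>))"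
    unfolding upper_box_dim_def by (rule Limsup_mono)
  also have "\<dots> = ereal t"
  proof (rule lim_imp_Limsup)
    have "filterlim (\<lambda>\<delta>::real. - ln \<delta>) at_top (at_right 0)"
      using ln_at_0 by (simp add: filterlim_uminus_at_top)
    then have "((\<lambda>\<delta>::real. ln K / - ln \<delta>) \<longlongrightarrow> 0) (at_right 0)"
      by (rule real_tendsto_divide_at_top[OF tendsto_const])
    then have "(?g \<longlongrightarrow> 0 + t) (at_right 0)" by (intro tendsto_add tendsto_const)
    then show "((\<lambda>\<delta>. ereal (?g \<delta>)) \<longlongrightarrow> ereal t) (at_right 0)" by simp
  qed simp
  finally show ?thesis .
qed

lemma lower_box_dim_geI:
  fixes F :: "(real^'n) set"
  assumes "0 < \<delta>\<^sub>0" "0 < K"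
    "\<And>\<delta>. 0 < \<delta> \<Longrightarrow> \<delta> < \<delta>\<^sub>0 \<Longrightarrow> K * \<delta> powr (- t) \<le> real (covering_number \<delta> F)"
  shows "ereal t \<le> lower_box_dim F"
proof -
  let ?g = "\<lambda>\<delta>::real. ln K / - ln \<delta> + t"
  have "eventually (\<lambda>\<delta>. \<delta> \<in> {0<..<min \<delta>\<^sub>0 1}) (at_right (0::real))"
    using assms(1) by (intro eventually_at_right_real) auto
  then have ev: "eventually (\<lambda>\<delta>. ereal (?g \<delta>) \<le> ereal (ln (real (covering_number \<delta> F)) / - ln \<delta>)) (at_right 0)"
  proof eventually_elim
    case (elim \<delta>)
    then have \<delta>: "0 < \<delta>" "\<delta> < \<delta>\<^sub>0" "\<delta> < 1" by auto
    have "0 < K * \<delta> powr (- t)" using assms \<delta> by simp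
    then have "ln (K * \<delta> powr (- t)) \<le> ln (real (covering_number \<delta> F))"
      using assms(3)[OF \<delta>(1,2)] by (subst ln_le_cancel_iff) auto
    moreover have "ln (K * \<delta> powr (- t)) = ln K - t * ln \<delta>" using \<delta> assms(2) by (simp add: ln_mult ln_powr)
    ultimately have "(ln K - t * ln \<delta>) / - ln \<delta> \<le> ln (real (covering_number \<delta> F)) / - ln \<delta>"
      using \<delta> by (intro divide_right_mono) auto
    moreover have "(ln K - t * ln \<delta>) / - ln \<delta> = ?g \<delta>" using \<delta> by (simp add: field_simps)
    ultimately show ?case by simp
  qed
  have "ereal t = Liminf (at_right 0) (\<lambda>\<delta>. ereal (?g \<delta>))"
  proof (rule lim_imp_Liminf[symmetric])
    have "filterlim (\<lambda>\<delta>::real. - ln \<delta>) at_top (at_right 0)"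
      using ln_at_0 by (simp add: filterlim_uminus_at_top)
    then have "((\<lambda>\<delta>::real. ln K / - ln \<delta>) \<longlongrightarrow> 0) (at_right 0)"
      by (rule real_tendsto_divide_at_top[OF tendsto_const])
    then have "(?g \<longlongrightarrow> 0 + t) (at_right 0)" by (intro tendsto_add tendsto_const)
    then show "((\<lambda>\<delta>. ereal (?g \<delta>)) \<longlongrightarrow> ereal t) (at_right 0)" by simp
  qed simp
  also have "\<dots> \<le> lower_box_dim F"
    unfolding lower_box_dim_def by (rule Liminf_mono) (rule ev)
  finally show ?thesis .
qed

text \<open>The limit superior gives the bound for small \<open>\<delta>\<close>; for the other \<open>\<delta> \<le> 1\<close> covering numbers are bounded
because they decrease in \<open>\<delta>\<close>.\<close>
lemma covering_number_le_of_upper_box_dim: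
  fixes X :: "(real^'n) set"
  assumes "bounded X" "X \<noteq> {}" "upper_box_dim X < ereal t" "0 < t"
  shows "\<exists>K>0. \<forall>\<delta>. 0 < \<delta> \<longrightarrow> \<delta> \<le> 1 \<longrightarrow> real (covering_number \<delta> X) \<le> K * \<delta> powr (- t)"
proof -
  have "eventually (\<lambda>\<delta>. ereal (ln (real (covering_number \<delta> X)) / - ln \<delta>) < ereal t) (at_right 0)"
    using assms(3) unfolding upper_box_dim_def by (rule Limsup_lessD)
  then obtain b where b: "b > 0" "\<And>\<delta>. 0 < \<delta> \<Longrightarrow> \<delta> < b \<Longrightarrow> ln (real (covering_number \<delta> X)) / - ln \<delta> < t"
    unfolding eventually_at_right_field by auto
  define d where "d = min b 1 / 2"
  have d: "0 < d" "d < b" "d < 1" using b by (auto simp: d_def min_def)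
  have small: "real (covering_number \<delta> X) \<le> \<delta> powr (- t)" if "0 < \<delta>" "\<delta> \<le> d" for \<delta>
  proof -
    have \<delta>: "\<delta> < b" "\<delta> < 1" using that d by auto
    have N: "1 \<le> covering_number \<delta> X" using assms that by (intro covering_number_pos) auto
    have "ln (real (covering_number \<delta> X)) < - t * ln \<delta>"
      using b(2)[OF that(1) \<delta>(1)] \<delta>(2) that(1) by (simp add: field_simps)
    then have "exp (ln (real (covering_number \<delta> X))) < exp (- t * ln \<delta>)" by simp
    then show ?thesis using N that by (simp add: powr_def)
  qed
  let ?K = "max 1 (real (covering_number d X))"
  show ?thesis
  proof (intro exI[of _ ?K] conjI allI impI)
    fix \<delta> :: real assume \<delta>: "0 < \<delta>" "\<delta> \<le> 1"
    have p1: "1 \<le> \<delta> powr (- t)" using \<delta> assms(4) by (simp add: powr_minus powr_le1 one_le_inverse_iff)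
    show "real (covering_number \<delta> X) \<le> ?K * \<delta> powr (- t)"
    proof (cases "\<delta> \<le> d")
      case True
      have "real (covering_number \<delta> X) \<le> 1 * \<delta> powr (- t)" using small[OF \<delta>(1) True] by simp
      also have "\<dots> \<le> ?K * \<delta> powr (- t)" by (intro mult_right_mono) auto
      finally show ?thesis .
    next
      case False
      have "real (covering_number \<delta> X) \<le> real (covering_number d X)"
        using covering_number_antimono[OF assms(1) d(1), of \<delta>] False by simp
      also have "\<dots> \<le> ?K * 1" by simp
      also have "\<dots> \<le> ?K * \<delta> powr (- t)" using p1 by (intro mult_left_mono) auto
      finally show ?thesis .
    qed
  qed simp
qed

text \<open>Cover a ball, as the ellipsoid of the identity matrix.\<close>
lemma upper_box_dim_le_dimension:
  fixes F :: "(real^'n) set"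
  assumes "bounded F" "F \<noteq> {}"
  shows "upper_box_dim F \<le> ereal (real CARD('n))"
proof -
  obtain \<rho> where \<rho>: "0 < \<rho>" "\<And>x. x \<in> F \<Longrightarrow> norm x \<le> \<rho>" using assms(1) by (meson bounded_pos)
  let ?A = "mat 1 :: real^'n^'n" and ?n = "real CARD('n)"
  define c where "c = 2 * ?n * (\<rho> * singular_value ?A 1) + 2"
  have inv: "invertible ?A" unfolding invertible_def by (intro exI[of _ "mat 1"]) simp
  have c: "c > 0" unfolding c_def using \<rho> singular_value_pos[OF inv, of 1] by (simp add: add_pos_pos)
  show ?thesis
  proof (rule upper_box_dim_leI[OF assms, of 1 "c ^ CARD('n)"])
    fix \<delta> :: real assume \<delta>: "0 < \<delta>" "\<delta> < 1"
    obtain P where P: "finite P"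
      "real (card P) \<le> (\<Prod>i\<in>{1..CARD('n)}. 2 * ?n * (\<rho> * singular_value ?A i / \<delta>) + 2)"
      "\<And>x. norm (x - 0) \<le> \<rho> \<Longrightarrow> \<exists>p\<in>P. norm (?A *v x + 0 - p) \<le> \<delta> / 2"
      using covering_number_affine_cball[OF inv \<delta>(1) less_imp_le[OF \<rho>(1)], of 0 0] by blast
    have "covering_number \<delta> F \<le> card P"
      using P(1,3) \<rho>(2) by (intro covering_number_le_net) (auto simp: matrix_vector_mul_lid)
    also have "real (card P) \<le> (\<Prod>i\<in>{1..CARD('n)}. c / \<delta>)"
    proof (rule order_trans[OF P(2)], intro prod_mono conjI)
      fix i assume i: "i \<in> {1..CARD('n)}"
      have \<sigma>: "0 < singular_value ?A i" "singular_value ?A i \<le> singular_value ?A 1"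
        using i singular_value_pos[OF inv, of i] singular_value_antimono[of 1 i ?A] by auto
      show "0 \<le> 2 * ?n * (\<rho> * singular_value ?A i / \<delta>) + 2" using \<sigma> \<rho> \<delta> by simp
      have "2 * ?n * (\<rho> * singular_value ?A i / \<delta>) + 2 \<le> 2 * ?n * (\<rho> * singular_value ?A 1 / \<delta>) + 2 / \<delta>"
        using \<sigma> \<rho> \<delta> by (intro add_mono mult_left_mono divide_right_mono) (auto simp: divide_simps)
      also have "\<dots> = c / \<delta>" by (simp add: c_def add_divide_distrib)
      finally show "2 * ?n * (\<rho> * singular_value ?A i / \<delta>) + 2 \<le> c / \<delta>" .
    qed
    finally show "real (covering_number \<delta> F) \<le> c ^ CARD('n) * \<delta> powr (- ?n)"
      using \<delta> by (simp add: powr_minus powr_realpow power_mult_distrib power_inverse divide_inverse)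
  qed (use c in auto)
qed

lemma box_dim_mono:
  fixes X Y :: "(real^'n) set"
  assumes "X \<subseteq> Y" "bounded Y" "X \<noteq> {}"
  shows "upper_box_dim X \<le> upper_box_dim Y" "lower_box_dim X \<le> lower_box_dim Y"
proof -
  have "eventually (\<lambda>\<delta>. \<delta> \<in> {0<..<1}) (at_right (0::real))"
    by (intro eventually_at_right_real) auto
  then have ev: "eventually (\<lambda>\<delta>. ereal (ln (real (covering_number \<delta> X)) / - ln \<delta>)
    \<le> ereal (ln (real (covering_number \<delta> Y)) / - ln \<delta>)) (at_right 0)"
  proof eventually_elim
    case (elim \<delta>)
    have "1 \<le> covering_number \<delta> X"
      using assms elim bounded_subset by (intro covering_number_pos) auto
    moreover have "covering_number \<delta> X \<le> covering_number \<delta> Y"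
      using assms elim by (intro covering_number_mono) auto
    ultimately have "ln (real (covering_number \<delta> X)) \<le> ln (real (covering_number \<delta> Y))"
      by (subst ln_le_cancel_iff) auto
    then show ?case using elim by (simp add: divide_right_mono_neg)
  qed
  show "upper_box_dim X \<le> upper_box_dim Y" unfolding upper_box_dim_def using ev by (rule Limsup_mono)
  show "lower_box_dim X \<le> lower_box_dim Y" unfolding lower_box_dim_def using ev by (rule Liminf_mono)
qed

lemma lower_le_upper_box_dim: "lower_box_dim X \<le> upper_box_dim X"
  unfolding lower_box_dim_def upper_box_dim_def by (rule Liminf_le_Limsup) simp

lemma lower_box_dim_nonneg:
  fixes X :: "(real^'n) set"
  assumes "bounded X" "X \<noteq> {}"
  shows "0 \<le> lower_box_dim X"
proof -
  have "ereal 0 \<le> lower_box_dim X"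
    using covering_number_pos[OF assms] by (intro lower_box_dim_geI[of 1 1]) auto
  then show ?thesis by (simp add: zero_ereal_def)
qed

section \<open>Projections along a direction\<close>

lemma orthonormal_basis_of_exists:
  fixes V :: "'a::euclidean_space set"
  assumes "subspace V"
  shows "orthonormal_basis_of V (SOME B. orthonormal_basis_of V B)"
proof -
  have "\<exists>B. orthonormal_basis_of V B"
    by (rule orthonormal_basis_subspace[OF assms])
       (auto simp: orthonormal_basis_of_def)
  then show ?thesis by (rule someI_ex)
qed

lemma orthonormal_basis_of_card:
  fixes V :: "'a::euclidean_space set"
  assumes "orthonormal_basis_of V B"
  shows "finite B" "card B = dim V"
proof -
  have B: "pairwise orthogonal B" "\<And>b. b \<in> B \<Longrightarrow> norm b = 1" "span B = V"
    using assms unfolding orthonormal_basis_of_def by simp_all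
  have "0 \<notin> B" using B(2)[of 0] by auto
  then have ind: "independent B" using B(1) by (intro pairwise_orthogonal_independent)
  then show "finite B" by (rule independent_imp_finite)
  show "card B = dim V" unfolding B(3)[symmetric] dim_span by (rule dim_eq_card_independent[OF ind, symmetric])
qed

text \<open>In coordinates with respect to the chosen orthonormal basis, a ball lies in a product of intervals of
length \<open>2 * \<epsilon>\<close>.\<close>
lemma subspace_lebesgue_cball_le:
  fixes V :: "'a::euclidean_space set"
  assumes "subspace V" "0 \<le> \<epsilon>"
  shows "cball p \<epsilon> \<in> sets (subspace_lebesgue V)"
    "emeasure (subspace_lebesgue V) (cball p \<epsilon>) \<le> ennreal ((2 * \<epsilon>) ^ dim V)"
proof -
  define B where "B = (SOME B. orthonormal_basis_of V B)"
  have B: "orthonormal_basis_of V B" unfolding B_def by (rule orthonormal_basis_of_exists[OF assms(1)])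
  note finB = orthonormal_basis_of_card[OF B]
  define T where "T = (\<lambda>f. \<Sum>b\<in>B. f b *\<^sub>R b)"
  define M where "M = (\<Pi>\<^sub>M b\<in>B. (lborel :: real measure))"
  interpret product_sigma_finite "\<lambda>_::'a. lborel :: real measure" by standard
  have T: "T \<in> measurable M borel" unfolding T_def M_def by measurable
  have eq: "subspace_lebesgue V = completion (distr M borel T)"
    unfolding subspace_lebesgue_def Let_def B_def[symmetric] T_def M_def ..
  have S: "cball p \<epsilon> \<in> sets (distr M borel T)" by simp
  then show "cball p \<epsilon> \<in> sets (subspace_lebesgue V)" unfolding eq by (rule sets_completionI_sets)
  let ?J = "\<lambda>b. {p \<bullet> b - \<epsilon>..p \<bullet> b + \<epsilon>}"
  have sub: "T -` cball p \<epsilon> \<inter> space M \<subseteq> Pi\<^sub>E B ?J"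
  proof
    fix f assume f: "f \<in> T -` cball p \<epsilon> \<inter> space M"
    show "f \<in> Pi\<^sub>E B ?J"
    proof (rule PiE_I)
      fix b assume b: "b \<in> B"
      have "T f \<bullet> b = (\<Sum>b'\<in>B. f b' * (b' \<bullet> b))" unfolding T_def by (simp add: inner_sum_left)
      also have "\<dots> = (\<Sum>b'\<in>B. if b' = b then f b' else 0)"
        using B b unfolding orthonormal_basis_of_def pairwise_def orthogonal_def
        by (intro sum.cong) (auto simp: norm_eq_1)
      also have "\<dots> = f b" using b finB by simp
      finally have "f b - p \<bullet> b = (T f - p) \<bullet> b" by (simp add: inner_diff_left)
      then have "\<bar>f b - p \<bullet> b\<bar> \<le> norm (T f - p) * norm b" by (simp add: Cauchy_Schwarz_ineq2)
      also have "\<dots> \<le> \<epsilon>"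
        using f B b unfolding orthonormal_basis_of_def by (auto simp: dist_norm norm_minus_commute)
      finally show "f b \<in> ?J b" by (auto simp: abs_le_iff)
    next
      fix b assume "b \<notin> B" then show "f b = undefined" using f by (auto simp: M_def space_PiM PiE_def extensional_def)
    qed
  qed
  have "emeasure (subspace_lebesgue V) (cball p \<epsilon>) = emeasure M (T -` cball p \<epsilon> \<inter> space M)"
    unfolding eq using S T by (simp add: emeasure_distr)
  also have "\<dots> \<le> emeasure M (Pi\<^sub>E B ?J)"
    unfolding M_def by (intro emeasure_mono sub[unfolded M_def] sets_PiM_I_finite finB) auto
  also have "\<dots> = (\<Prod>b\<in>B. ennreal (2 * \<epsilon>))"
    unfolding M_def using finB assms(2) by (subst emeasure_PiM) auto
  also have "\<dots> = ennreal ((2 * \<epsilon>) ^ dim V)"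
    using finB assms(2) by (simp add: ennreal_power)
  finally show "emeasure (subspace_lebesgue V) (cball p \<epsilon>) \<le> ennreal ((2 * \<epsilon>) ^ dim V)" .
qed

lemma subspace_lebesgue_le_net:
  fixes V :: "'a::euclidean_space set"
  assumes "subspace V" "0 \<le> \<epsilon>" "finite P" "X \<subseteq> (\<Union>p\<in>P. cball p \<epsilon>)"
  shows "emeasure (subspace_lebesgue V) X \<le> ennreal (real (card P) * (2 * \<epsilon>) ^ dim V)"
proof -
  let ?M = "subspace_lebesgue V"
  have "emeasure ?M X \<le> emeasure ?M (\<Union>p\<in>P. cball p \<epsilon>)"
    using assms by (intro emeasure_mono sets.finite_UN subspace_lebesgue_cball_le)
  also have "\<dots> \<le> (\<Sum>p\<in>P. emeasure ?M (cball p \<epsilon>))"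
    using assms by (intro emeasure_subadditive_finite) (auto intro: subspace_lebesgue_cball_le)
  also have "\<dots> \<le> (\<Sum>p\<in>P. ennreal ((2 * \<epsilon>) ^ dim V))"
    using assms by (intro sum_mono subspace_lebesgue_cball_le)
  also have "\<dots> = ennreal (real (card P) * (2 * \<epsilon>) ^ dim V)"
    using assms(2) by (simp add: ennreal_mult' ennreal_of_nat_eq_real_of_nat)
  finally show ?thesis .
qed

lemma orthogonal_projection_along:
  fixes e :: "real^'n"
  assumes "norm e = 1"
  defines "\<pi> \<equiv> \<lambda>x. x - (x \<bullet> e) *\<^sub>R e"
  shows "\<pi> \<in> orthogonal_projections (CARD('n) - 1)"
    "subspace (range \<pi>)" "dim (range \<pi>) = CARD('n) - 1"
proof -
  have ee: "e \<bullet> e = 1" using assms(1) by (simp add: norm_eq_1)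
  let ?V = "{x. e \<bullet> x = 0}"
  have "range \<pi> = ?V"
  proof (intro equalityI subsetI)
    fix x assume "x \<in> range \<pi>"
    then show "x \<in> ?V" by (auto simp: \<pi>_def inner_diff_right ee inner_commute)
  next
    fix x assume "x \<in> ?V"
    then have "\<pi> x = x" by (simp add: \<pi>_def inner_commute)
    then show "x \<in> range \<pi>" by (metis rangeI)
  qed
  moreover have "subspace ?V" by (rule subspace_hyperplane)
  moreover have "dim ?V = CARD('n) - 1"
    using dim_hyperplane[of e] assms(1) by (cases "e = 0") auto
  moreover have "orthogonal_projection_onto ?V \<pi>"
    unfolding orthogonal_projection_onto_def orthogonal_def
    by (auto simp: \<pi>_def inner_diff_right inner_diff_left ee inner_commute)
  ultimately show "\<pi> \<in> orthogonal_projections (CARD('n) - 1)"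
    "subspace (range \<pi>)" "dim (range \<pi>) = CARD('n) - 1"
    unfolding orthogonal_projections_def by auto
qed

text \<open>The form in which the lower bound for the volumes of projections is used. The map in the formula is
the orthogonal projection along \<open>e\<close>, and a net of \<open>card P\<close> balls of radius \<open>\<epsilon>\<close> for the image of \<open>C\<close> cannot
be too small, because each ball has measure at most \<open>(2 * \<epsilon>) ^ (n - 1)\<close>.\<close>
definition shadow_content_ge :: "real \<Rightarrow> (real^'n) set \<Rightarrow> bool" where
  "shadow_content_ge \<eta> C \<longleftrightarrow> (\<forall>e \<epsilon> P. norm e = 1 \<longrightarrow> 0 \<le> \<epsilon> \<longrightarrow> finite P \<longrightarrow>
     (\<forall>x\<in>C. \<exists>p\<in>P. norm (x - (x \<bullet> e) *\<^sub>R e - p) \<le> \<epsilon>) \<longrightarrow>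
     \<eta> \<le> real (card P) * (2 * \<epsilon>) ^ (CARD('n) - 1))"

lemma ex_shadow_content_ge:
  fixes C :: "(real^'n) set"
  assumes "(INF \<pi>\<in>orthogonal_projections (CARD('n) - 1).
            emeasure (subspace_lebesgue (range \<pi>)) (\<pi> ` C)) > 0"
  shows "\<exists>\<eta>>0. shadow_content_ge \<eta> C"
proof -
  let ?inf = "(INF \<pi>\<in>orthogonal_projections (CARD('n) - 1).
            emeasure (subspace_lebesgue (range \<pi>)) (\<pi> ` C))"
  obtain \<eta>' where \<eta>': "0 < \<eta>'" "\<eta>' < ?inf" using assms dense by blast
  have top: "\<eta>' < top" by (rule order.strict_trans2[OF \<eta>'(2) top_greatest])
  define \<eta> where "\<eta> = enn2real \<eta>'"
  have \<eta>: "0 < \<eta>" "ennreal \<eta> = \<eta>'"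
    using \<eta>' top unfolding \<eta>_def by (auto simp: enn2real_positive_iff)
  have "shadow_content_ge \<eta> C"
    unfolding shadow_content_ge_def
  proof (intro allI impI)
    fix e :: "real^'n" and \<epsilon> :: real and P :: "(real^'n) set"
    assume a: "norm e = 1" "0 \<le> \<epsilon>" "finite P"
      and net: "\<forall>x\<in>C. \<exists>p\<in>P. norm (x - (x \<bullet> e) *\<^sub>R e - p) \<le> \<epsilon>"
    let ?\<pi> = "\<lambda>x. x - (x \<bullet> e) *\<^sub>R e"
    note pr = orthogonal_projection_along[OF a(1)]
    have "ennreal \<eta> \<le> ?inf" using \<eta>' \<eta> by simp
    also have "\<dots> \<le> emeasure (subspace_lebesgue (range ?\<pi>)) (?\<pi> ` C)" by (rule INF_lower) (rule pr)
    also have "\<dots> \<le> ennreal (real (card P) * (2 * \<epsilon>) ^ dim (range ?\<pi>))"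
    proof (rule subspace_lebesgue_le_net)
      show "?\<pi> ` C \<subseteq> (\<Union>p\<in>P. cball p \<epsilon>)"
        using net by (auto simp: dist_norm norm_minus_commute)
    qed (use a pr in auto)
    finally show "\<eta> \<le> real (card P) * (2 * \<epsilon>) ^ (CARD('n) - 1)"
      using a(2) pr(3) by simp
  qed
  then show ?thesis using \<eta>(1) by blast
qed

text \<open>Let \<open>e\<close> be the right singular vector for the smallest singular value \<open>\<alpha>\<^sub>n\<close>. The preimage of a cube of
side \<open>\<delta>\<close> is long in the direction \<open>e\<close>, but its projection along \<open>e\<close> lies in a box with sides about
\<open>\<delta> / \<alpha>\<^sub>i\<close> for \<open>i < n\<close>. As the projection of \<open>C\<close> has volume at least \<open>\<eta>\<close>, at least about
\<open>\<eta> (\<alpha>\<^sub>1 \<cdots> \<alpha>\<^sub>n\<^sub>-\<^sub>1) / \<delta> ^ (n - 1)\<close> cubes are needed, and the product of all singular values is \<open>\<bar>det A\<bar>\<close>.\<close>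
lemma affine_image_cube_count:
  fixes A :: "real^'n^'n" and C :: "(real^'n) set"
  assumes "invertible A" "0 < \<delta>"
    and net: "shadow_content_ge \<eta> C"
    and T: "finite T" "T \<subseteq> range (cube \<delta>)" "(\<lambda>x. A *v x + b) ` C \<subseteq> \<Union>T"
  shows "\<eta> / (2 * (real CARD('n) + 2) * real CARD('n) * \<delta>) ^ (CARD('n) - 1)
     * (\<bar>det A\<bar> / singular_value A CARD('n)) \<le> real (card T)"
proof -
  let ?n = "CARD('n)" and ?\<sigma> = "singular_value A"
  let ?I = "{1..<?n}"
  obtain v where v: "singular_frame A v" using singular_frame_exists by metis
  then have fr: "orthonormal_frame ?n v" by (simp add: singular_frame_def)
  have pos: "?\<sigma> i > 0" if "i \<in> {1..?n}" for i
    using singular_value_pos[OF assms(1), of i] that by auto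
  have pos1: "?\<sigma> 1 > 0" and posn: "?\<sigma> ?n > 0" using pos by simp_all
  define e where "e = v ?n"
  have e1: "norm e = 1" unfolding e_def using singular_frame_norm_vector[OF v] by simp
  define \<rho> where "\<rho> = real ?n * \<delta>"
  \<comment> \<open>With no side \<open>r i\<close> of the box shorter than the radius, rounding up in \<open>grid_net\<close> costs a constant factor.\<close>
  define \<epsilon> where "\<epsilon> = \<rho> / ?\<sigma> 1"
  have \<rho>: "\<rho> > 0" unfolding \<rho>_def using assms(2) by simp
  have \<epsilon>: "\<epsilon> > 0" unfolding \<epsilon>_def using \<rho> pos1 by simp
  define r where "r i = \<rho> / ?\<sigma> i" for i
  have r: "r i > 0" "\<epsilon> \<le> r i" if "i \<in> ?I" for i
  proof -
    show "r i > 0" unfolding r_def using \<rho> pos[of i] that by simp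
    show "\<epsilon> \<le> r i" unfolding r_def \<epsilon>_def
      using \<rho> pos[of i] that singular_value_antimono[of 1 i A] by (intro divide_left_mono) auto
  qed
  have vn: "norm (v i) = 1" if "i \<in> ?I" for i using singular_frame_norm_vector[OF v, of i] that by simp
  have "\<exists>P. finite P \<and> real (card P) \<le> (\<Prod>i\<in>?I. real ?n * r i / \<epsilon> + 2) \<and>
    (\<forall>c. (\<forall>i\<in>?I. \<bar>c i\<bar> * norm (v i) \<le> r i) \<longrightarrow> (\<exists>p\<in>P. norm ((\<Sum>i\<in>?I. c i *\<^sub>R v i) - p) \<le> \<epsilon>))"
  proof (rule grid_net)
    show "0 \<le> r i" if "i \<in> ?I" for i using r(1)[OF that] by simp
    show "v i \<noteq> 0" if "i \<in> ?I" for i using vn[OF that] by auto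
  qed (use \<epsilon> in auto)
  then obtain P where P: "finite P" "real (card P) \<le> (\<Prod>i\<in>?I. real ?n * r i / \<epsilon> + 2)"
    "\<forall>c. (\<forall>i\<in>?I. \<bar>c i\<bar> * norm (v i) \<le> r i) \<longrightarrow> (\<exists>p\<in>P. norm ((\<Sum>i\<in>?I. c i *\<^sub>R v i) - p) \<le> \<epsilon>)"
    by (elim exE conjE)
  let ?\<pi> = "\<lambda>x. x - (x \<bullet> e) *\<^sub>R e"
  have proj: "?\<pi> x = (\<Sum>i\<in>?I. (v i \<bullet> x) *\<^sub>R v i)" for x
  proof -
    have "{1..?n} = insert ?n ?I" by (simp add: insert_absorb atLeastLessThan_eq_atLeastAtMost_diff)
    then have "(\<Sum>i\<in>{1..?n}. (v i \<bullet> x) *\<^sub>R v i) = (\<Sum>i\<in>insert ?n ?I. (v i \<bullet> x) *\<^sub>R v i)" by (rule arg_cong)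
    also have "\<dots> = (v ?n \<bullet> x) *\<^sub>R v ?n + (\<Sum>i\<in>?I. (v i \<bullet> x) *\<^sub>R v i)"
      by (rule sum.insert) auto
    finally have "x = (v ?n \<bullet> x) *\<^sub>R v ?n + (\<Sum>i\<in>?I. (v i \<bullet> x) *\<^sub>R v i)"
      using orthonormal_frame_expand[OF fr, of x] by (rule trans[rotated])
    then have "x - (v ?n \<bullet> x) *\<^sub>R v ?n = (\<Sum>i\<in>?I. (v i \<bullet> x) *\<^sub>R v i)"
      by (simp only: diff_eq_eq add.commute)
    then show ?thesis unfolding e_def inner_commute[of x] .
  qed
  \<comment> \<open>A point of \<open>C\<close> that is mapped into \<open>Q\<close>; the net of the box is translated to its projection.\<close>
  define z where "z Q = (SOME x. x \<in> C \<and> A *v x + b \<in> Q)" for Q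
  let ?P = "(\<lambda>(Q, p). ?\<pi> (z Q) + p) ` (T \<times> P)"
  have "\<eta> \<le> real (card ?P) * (2 * \<epsilon>) ^ (?n - 1)"
  proof (rule net[unfolded shadow_content_ge_def, rule_format, OF e1 less_imp_le[OF \<epsilon>]])
    show "finite ?P" using T(1) P(1) by simp
    fix x assume x: "x \<in> C"
    then obtain Q where Q: "Q \<in> T" "A *v x + b \<in> Q" using T(3) by blast
    have "z Q \<in> C \<and> A *v z Q + b \<in> Q" unfolding z_def by (rule someI[of _ x]) (simp add: x Q)
    moreover obtain a where "Q = cube \<delta> a" using Q(1) T(2) by blast
    ultimately have "norm ((A *v x + b) - (A *v z Q + b)) \<le> \<rho>"
      unfolding \<rho>_def using Q(2) by (intro cube_norm_diff) auto
    then have close: "norm (A *v (x - z Q)) \<le> \<rho>"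
      by (simp add: matrix_vector_mult_diff_distrib)
    have "\<bar>v i \<bullet> (x - z Q)\<bar> * norm (v i) \<le> r i" if i: "i \<in> ?I" for i
    proof -
      have "(?\<sigma> i)\<^sup>2 * (v i \<bullet> (x - z Q))\<^sup>2 \<le> (norm (A *v (x - z Q)))\<^sup>2"
        unfolding singular_frame_norm[OF v] using i
        by (intro member_le_sum[where f = "\<lambda>i. (?\<sigma> i)\<^sup>2 * (v i \<bullet> (x - z Q))\<^sup>2"]) auto
      also have "\<dots> \<le> \<rho>\<^sup>2" using close by (intro power_mono) auto
      finally have "(?\<sigma> i * \<bar>v i \<bullet> (x - z Q)\<bar>)\<^sup>2 \<le> \<rho>\<^sup>2" by (simp add: power_mult_distrib)
      then have "?\<sigma> i * \<bar>v i \<bullet> (x - z Q)\<bar> \<le> \<rho>" by (rule power2_le_imp_le) (use \<rho> in simp)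
      then show ?thesis using pos[of i] i vn[OF i] by (simp add: r_def field_simps)
    qed
    then have "\<forall>i\<in>?I. \<bar>v i \<bullet> (x - z Q)\<bar> * norm (v i) \<le> r i" by blast
    with P(3) have "\<exists>p\<in>P. norm ((\<Sum>i\<in>?I. (v i \<bullet> (x - z Q)) *\<^sub>R v i) - p) \<le> \<epsilon>"
      by (auto dest!: spec[of _ "\<lambda>i. v i \<bullet> (x - z Q)"])
    then obtain p where p: "p \<in> P" "norm (?\<pi> (x - z Q) - p) \<le> \<epsilon>" unfolding proj by blast
    have "?\<pi> x - (?\<pi> (z Q) + p) = ?\<pi> (x - z Q) - p" by (simp add: inner_diff_left scaleR_diff_left)
    then have "norm (?\<pi> x - (?\<pi> (z Q) + p)) \<le> \<epsilon>" using p(2) by (simp only:)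
    moreover have "?\<pi> (z Q) + p \<in> ?P" using Q(1) p(1) by force
    ultimately show "\<exists>q\<in>?P. norm (?\<pi> x - q) \<le> \<epsilon>" by blast
  qed
  also have "\<dots> \<le> (real (card T) * real (card P)) * (2 * \<epsilon>) ^ (?n - 1)"
  proof (rule mult_right_mono)
    have "card ?P \<le> card (T \<times> P)" using T(1) P(1) by (intro card_image_le) simp
    then show "real (card ?P) \<le> real (card T) * real (card P)"
      unfolding card_cartesian_product of_nat_mult[symmetric] of_nat_le_iff .
  qed (use \<epsilon> in simp)
  also have "\<dots> \<le> real (card T) * (\<Prod>i\<in>?I. (real ?n + 2) * (r i / \<epsilon>)) * (2 * \<epsilon>) ^ (?n - 1)"
  proof (intro mult_right_mono mult_left_mono order_trans[OF P(2)] prod_mono conjI)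
    fix i assume i: "i \<in> ?I"
    show "0 \<le> real ?n * r i / \<epsilon> + 2" using r(1)[OF i] \<epsilon> by simp
    have "1 \<le> r i / \<epsilon>" using r(2)[OF i] \<epsilon> by simp
    then show "real ?n * r i / \<epsilon> + 2 \<le> (real ?n + 2) * (r i / \<epsilon>)"
      unfolding distrib_right times_divide_eq_right[symmetric] by simp
  qed (use \<epsilon> in auto)
  also have "\<dots> = real (card T) * (\<Prod>i\<in>?I. (real ?n + 2) * (r i / \<epsilon>) * (2 * \<epsilon>))"
    by (simp only: prod.distrib prod_constant card_atLeastLessThan mult.assoc power_mult_distrib)
  also have "(\<Prod>i\<in>?I. (real ?n + 2) * (r i / \<epsilon>) * (2 * \<epsilon>)) = (\<Prod>i\<in>?I. (2 * (real ?n + 2) * real ?n * \<delta>) / ?\<sigma> i)"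
    using \<epsilon> by (intro prod.cong refl) (simp add: r_def \<rho>_def)
  also have "\<dots> = (2 * (real ?n + 2) * real ?n * \<delta>) ^ (?n - 1) / (\<Prod>i\<in>?I. ?\<sigma> i)"
    by (simp only: prod_dividef prod_constant card_atLeastLessThan)
  finally have main: "\<eta> \<le> real (card T) * ((2 * (real ?n + 2) * real ?n * \<delta>) ^ (?n - 1) / (\<Prod>i\<in>?I. ?\<sigma> i))" .
  have "(\<Prod>i\<in>{1..?n}. ?\<sigma> i) = ?\<sigma> ?n * (\<Prod>i\<in>?I. ?\<sigma> i)"
  proof -
    have "{1..?n} = insert ?n ?I" by (simp add: insert_absorb atLeastLessThan_eq_atLeastAtMost_diff)
    then have "(\<Prod>i\<in>{1..?n}. ?\<sigma> i) = (\<Prod>i\<in>insert ?n ?I. ?\<sigma> i)" by (rule arg_cong)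
    also have "\<dots> = ?\<sigma> ?n * (\<Prod>i\<in>?I. ?\<sigma> i)"
      by (rule prod.insert) auto
    finally show ?thesis .
  qed
  then have prodI: "(\<Prod>i\<in>?I. ?\<sigma> i) = \<bar>det A\<bar> / ?\<sigma> ?n"
    using prod_singular_values[of A] posn by (simp add: field_simps)
  have Ipos: "(\<Prod>i\<in>?I. ?\<sigma> i) > 0"
  proof (rule prod_pos)
    show "0 < ?\<sigma> i" if "i \<in> ?I" for i using pos[of i] that by simp
  qed
  define D where "D = (2 * (real ?n + 2) * real ?n * \<delta>) ^ (?n - 1)"
  have D: "D > 0" unfolding D_def using assms(2) by (intro zero_less_power mult_pos_pos) auto
  have "\<eta> / D * (\<Prod>i\<in>?I. ?\<sigma> i) \<le> real (card T)"
    using main D Ipos unfolding D_def[symmetric] by (simp add: field_simps)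
  then show ?thesis unfolding prodI D_def .
qed

section \<open>Words and cut sets\<close>

lemma finite_words: "finite (words N k)"
proof -
  have "words N k = {w. set w \<subseteq> {1..N} \<and> length w = k}" by (auto simp: words_def)
  then show ?thesis by (simp add: finite_lists_length_eq)
qed

lemma words_nonempty: "1 \<le> N \<Longrightarrow> words N k \<noteq> {}"
proof -
  assume "1 \<le> N"
  then have "replicate k 1 \<in> words N k" by (auto simp: words_def)
  then show ?thesis by blast
qed

text \<open>With \<open>G\<close> given by a threshold for a singular value, these words have that singular value
comparable to the threshold, and every long word passes through one of them.\<close>
definition exit_words :: "nat \<Rightarrow> nat list set \<Rightarrow> nat list set" where
  "exit_words N G = {u \<in> G. \<exists>i\<in>{1..N}. u @ [i] \<notin> G}"

lemma word_exits:
  assumes "[] \<in> G" "w \<notin> G" "set w \<subseteq> {1..N}"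
  shows "\<exists>u i v. w = u @ [i] @ v \<and> u \<in> exit_words N G"
  using assms(2,3)
proof (induction w rule: rev_induct)
  case Nil
  then show ?case using assms(1) by simp
next
  case (snoc i w)
  show ?case
  proof (cases "w \<in> G")
    case True
    then have "w \<in> exit_words N G" using snoc.prems by (auto simp: exit_words_def)
    then show ?thesis by (intro exI[of _ w] exI[of _ i] exI[of _ "[]"]) simp
  next
    case False
    then obtain u j v where "w = u @ [j] @ v" "u \<in> exit_words N G"
      using snoc by auto
    then show ?thesis by (intro exI[of _ u] exI[of _ j] exI[of _ "v @ [i]"]) simp
  qed
qed

lemma words_split_exits:
  assumes "[] \<in> G" "w \<in> words N k" "w \<notin> G"
  shows "\<exists>u i v. w = u @ [i] @ v \<and> u \<in> exit_words N G \<and> i \<in> {1..N} \<and> v \<in> words N (k - length u - 1)"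
proof -
  obtain u i v where "w = u @ [i] @ v" "u \<in> exit_words N G"
    using word_exits[OF assms(1,3), of N] assms(2) by (auto simp: words_def)
  then show ?thesis using assms(2)
    by (intro exI[of _ u] exI[of _ i] exI[of _ v]) (auto simp: words_def)
qed

text \<open>Cut a word longer than all words of \<open>G\<close> right after a letter with which it leaves \<open>G\<close>. If the
product of sums were at most \<open>1\<close>, submultiplicativity would let the sum over words of length \<open>k\<close> be
bounded by those over the shorter remainders, so by induction all of them would be bounded.\<close>
lemma submultiplicative_exit_sum:
  fixes \<psi> :: "nat list \<Rightarrow> real"
  assumes nonneg: "\<And>w. 0 \<le> \<psi> w"
    and submult: "\<And>u v. set u \<subseteq> {1..N} \<Longrightarrow> set v \<subseteq> {1..N} \<Longrightarrow> \<psi> (u @ v) \<le> \<psi> u * \<psi> v"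
    and unbounded: "\<And>B. \<exists>k. B < (\<Sum>w\<in>words N k. \<psi> w)"
    and G: "finite G" "[] \<in> G" "\<And>w. w \<in> G \<Longrightarrow> set w \<subseteq> {1..N}"
  shows "1 < (\<Sum>u\<in>exit_words N G. \<psi> u) * (\<Sum>i\<in>{1..N}. \<psi> [i])"
proof (rule ccontr)
  assume "\<not> ?thesis"
  then have q: "(\<Sum>u\<in>exit_words N G. \<psi> u) * (\<Sum>i\<in>{1..N}. \<psi> [i]) \<le> 1" by simp
  let ?H = "exit_words N G"
  define g where "g k = (\<Sum>w\<in>words N k. \<psi> w)" for k
  have g0: "0 \<le> g k" for k unfolding g_def by (intro sum_nonneg nonneg)
  have H: "?H \<subseteq> G" by (auto simp: exit_words_def)
  then have finH: "finite ?H" using G(1) by (rule finite_subset)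
  define L where "L = Max (length ` G)"
  have L: "length w \<le> L" if "w \<in> G" for w unfolding L_def using G(1) that by simp
  define B where "B = (\<Sum>k\<le>L. g k)"
  have bound: "g k \<le> B" for k
  proof (induction k rule: less_induct)
    case (less k)
    show ?case
    proof (cases "k \<le> L")
      case True
      then show ?thesis unfolding B_def by (intro member_le_sum g0) auto
    next
      case False
      have B0: "0 \<le> B" unfolding B_def by (intro sum_nonneg g0)
      let ?D = "Sigma (?H \<times> {1..N}) (\<lambda>(u, i). words N (k - length u - 1))"
      let ?f = "\<lambda>((u, i), v). u @ [i] @ v"
      have finD: "finite ?D" using finH by (intro finite_SigmaI finite_cartesian_product) (auto simp: finite_words)
      have sub: "words N k \<subseteq> ?f ` ?D"
      proof
        fix w assume w: "w \<in> words N k"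
        then have "w \<notin> G" using L[of w] False by (auto simp: words_def)
        then obtain u i v where "w = u @ [i] @ v" "u \<in> ?H" "i \<in> {1..N}" "v \<in> words N (k - length u - 1)"
          using words_split_exits[OF G(2) w] by blast
        then have "((u, i), v) \<in> ?D" "w = ?f ((u, i), v)" by auto
        then show "w \<in> ?f ` ?D" by blast
      qed
      have "g k \<le> sum \<psi> (?f ` ?D)"
        unfolding g_def using finD sub nonneg by (intro sum_mono2) auto
      also have "\<dots> \<le> sum (\<psi> \<circ> ?f) ?D" by (rule sum_image_le[OF finD]) (rule nonneg)
      also have "\<dots> = (\<Sum>p\<in>?H \<times> {1..N}. \<Sum>v\<in>words N (k - length (fst p) - 1). \<psi> (fst p @ [snd p] @ v))"
        using finH by (subst sum.Sigma) (auto simp: finite_words case_prod_beta intro!: sum.cong)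
      also have "\<dots> \<le> (\<Sum>p\<in>?H \<times> {1..N}. \<psi> (fst p) * \<psi> [snd p] * B)"
      proof (rule sum_mono)
        fix p assume p: "p \<in> ?H \<times> {1..N}"
        obtain u i where ui: "p = (u, i)" by (cases p)
        have u: "set u \<subseteq> {1..N}" "i \<in> {1..N}" using p ui H G(3) by auto
        have "(\<Sum>v\<in>words N (k - length u - 1). \<psi> (u @ [i] @ v)) \<le> (\<Sum>v\<in>words N (k - length u - 1). \<psi> u * \<psi> [i] * \<psi> v)"
        proof (rule sum_mono)
          fix v assume "v \<in> words N (k - length u - 1)"
          then have v: "set v \<subseteq> {1..N}" by (simp add: words_def)
          have "\<psi> (u @ [i] @ v) \<le> \<psi> u * \<psi> ([i] @ v)" using u v by (intro submult) auto
          also have "\<dots> \<le> \<psi> u * (\<psi> [i] * \<psi> v)" using u v by (intro mult_left_mono submult nonneg) auto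
          finally show "\<psi> (u @ [i] @ v) \<le> \<psi> u * \<psi> [i] * \<psi> v" by (simp only: mult.assoc)
        qed
        also have "\<dots> = \<psi> u * \<psi> [i] * g (k - length u - 1)" by (simp add: g_def sum_distrib_left)
        also have "\<dots> \<le> \<psi> u * \<psi> [i] * B"
          using False by (intro mult_left_mono less.IH mult_nonneg_nonneg nonneg) auto
        finally show "(\<Sum>v\<in>words N (k - length (fst p) - 1). \<psi> (fst p @ [snd p] @ v)) \<le> \<psi> (fst p) * \<psi> [snd p] * B"
          using ui by simp
      qed
      also have "\<dots> = (\<Sum>u\<in>?H. \<psi> u) * (\<Sum>i\<in>{1..N}. \<psi> [i]) * B"
        by (simp only: sum_distrib_right[symmetric] sum_product sum.cartesian_product case_prod_unfold)
      also have "\<dots> \<le> 1 * B" by (rule mult_right_mono[OF q B0])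
      finally show ?thesis by simp
    qed
  qed
  obtain k where "B < g k" using unbounded[of B] unfolding g_def by blast
  then show False using bound[of k] by simp
qed

lemma word_map_Nil: "word_map S [] = id" by (simp add: word_map_def)
lemma word_map_Cons: "word_map S (i # w) = S i \<circ> word_map S w" by (simp add: word_map_def)
lemma word_map_append: "word_map S (u @ v) = word_map S u \<circ> word_map S v"
  by (induction u) (auto simp: word_map_Nil word_map_Cons)

lemma singular_value_first_le:
  fixes A :: "real^'n^'n"
  assumes "\<And>x. norm (A *v x) \<le> k * norm x"
  shows "singular_value A 1 \<le> k"
proof -
  obtain v where v: "singular_frame A v" using singular_frame_exists by metis
  from singular_frame_norm_vector[OF v, of 1] assms[of "v 1"] show ?thesis by simp
qed

section \<open>Words of an affine system and their pressure sums\<close>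

text \<open>An affine iterated function system with its matrices, translations and a common contraction ratio
made explicit.\<close>
locale affine_system =
  fixes N :: nat and S :: "nat \<Rightarrow> real^'n \<Rightarrow> real^'n"
    and A :: "nat \<Rightarrow> real^'n^'n" and b :: "nat \<Rightarrow> real^'n" and c :: real
  assumes N: "1 \<le> N"
    and inv: "\<And>i. i \<in> {1..N} \<Longrightarrow> invertible (A i)"
    and S_eq: "\<And>i. i \<in> {1..N} \<Longrightarrow> S i = (\<lambda>x. A i *v x + b i)"
    and c: "0 < c" "c < 1"
    and contr: "\<And>i x. i \<in> {1..N} \<Longrightarrow> norm (A i *v x) \<le> c * norm x"
begin

definition word_matrix :: "nat list \<Rightarrow> real^'n^'n" where
  "word_matrix w = foldr (\<lambda>i B. A i ** B) w (mat 1)"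

lemma word_matrix_Nil: "word_matrix [] = mat 1" and word_matrix_Cons: "word_matrix (i # w) = A i ** word_matrix w"
  by (simp_all add: word_matrix_def)

lemma word_matrix_append: "word_matrix (u @ v) = word_matrix u ** word_matrix v"
  by (induction u) (simp_all add: word_matrix_Nil word_matrix_Cons matrix_mul_assoc)

lemma word_matrix_single: "word_matrix [i] = A i" by (simp add: word_matrix_Nil word_matrix_Cons)

lemma invertible_word_matrix: "set w \<subseteq> {1..N} \<Longrightarrow> invertible (word_matrix w)"
proof (induction w)
  case Nil
  show ?case unfolding word_matrix_Nil invertible_def by (intro exI[of _ "mat 1"]) simp
next
  case (Cons i w)
  then show ?case unfolding word_matrix_Cons by (intro invertible_mult inv) auto
qed

lemma word_map_affine: "set w \<subseteq> {1..N} \<Longrightarrow> word_map S w = (\<lambda>x. word_matrix w *v x + word_map S w 0)"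
proof (induction w)
  case Nil
  show ?case by (simp add: word_map_Nil word_matrix_Nil fun_eq_iff)
next
  case (Cons i w)
  then have i: "i \<in> {1..N}" and w: "word_map S w = (\<lambda>x. word_matrix w *v x + word_map S w 0)" by auto
  have "word_map S (i # w) x = word_matrix (i # w) *v x + word_map S (i # w) 0" for x
  proof -
    have "word_map S (i # w) x = A i *v (word_map S w x) + b i"
      by (simp add: word_map_Cons S_eq[OF i])
    also have "word_map S w x = word_matrix w *v x + word_map S w 0" by (subst w) simp
    also have "A i *v \<dots> + b i = A i *v (word_matrix w *v x) + (A i *v word_map S w 0 + b i)"
      by (simp only: matrix_vector_right_distrib add.assoc)
    also have "\<dots> = word_matrix (i # w) *v x + word_map S (i # w) 0"
      by (simp only: matrix_vector_mul_assoc word_matrix_Cons word_map_Cons o_apply S_eq[OF i])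
    finally show ?thesis .
  qed
  then show ?case by blast
qed

lemma linear_part_word: "set w \<subseteq> {1..N} \<Longrightarrow> linear_part (word_map S w) = word_matrix w"
proof -
  assume w: "set w \<subseteq> {1..N}"
  have "word_map S w x - word_map S w 0 = word_matrix w *v x" for x
    using fun_cong[OF word_map_affine[OF w], of x] by simp
  then show ?thesis unfolding linear_part_def by (simp add: matrix_of_matrix_vector_mul)
qed

lemma norm_word_matrix_le: "set w \<subseteq> {1..N} \<Longrightarrow> norm (word_matrix w *v x) \<le> c ^ length w * norm x"
proof (induction w)
  case (Cons i w)
  have "norm (word_matrix (i # w) *v x) \<le> c * norm (word_matrix w *v x)"
    using Cons.prems contr by (simp add: word_matrix_Cons matrix_vector_mul_assoc[symmetric])
  also have "\<dots> \<le> c * (c ^ length w * norm x)"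
    using Cons c by (intro mult_left_mono) auto
  finally show ?case by (simp add: mult.assoc)
qed (simp add: word_matrix_Nil)

lemma singular_value_word_matrix_le: "set w \<subseteq> {1..N} \<Longrightarrow> singular_value (word_matrix w) 1 \<le> c ^ length w"
  by (intro singular_value_first_le norm_word_matrix_le)

definition pressure_sum :: "real \<Rightarrow> nat \<Rightarrow> real" where
  "pressure_sum t k = (\<Sum>w\<in>words N k. sv_function t (word_matrix w))"

lemma singular_value_word_matrix_less_1: "w \<in> words N k \<Longrightarrow> 1 \<le> k \<Longrightarrow> singular_value (word_matrix w) 1 < 1"
proof -
  assume w: "w \<in> words N k" "1 \<le> k"
  then have "singular_value (word_matrix w) 1 \<le> c ^ k" using singular_value_word_matrix_le[of w] by (simp add: words_def)
  also have "\<dots> < 1" using c w by (simp add: power_less_one_iff)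
  finally show ?thesis .
qed

lemma affinity_exponent_works:
  assumes "1 \<le> k"
  shows "0 \<le> affinity_exponent N S k" "pressure_sum (affinity_exponent N S k) k = 1"
proof -
  have "(\<Sum>w\<in>words N k. sv_function t (linear_part (word_map S w))) = pressure_sum t k" for t
    unfolding pressure_sum_def by (intro sum.cong refl) (simp add: linear_part_word words_def)
  then have eq: "affinity_exponent N S k = (THE t. 0 \<le> t \<and> pressure_sum t k = 1)"
    unfolding affinity_exponent_def by simp
  have "\<exists>!t. 0 \<le> t \<and> pressure_sum t k = 1"
    unfolding pressure_sum_def
    using finite_words words_nonempty[OF N] singular_value_word_matrix_less_1[OF _ assms] invertible_word_matrix
    by (intro ex1_sv_pressure_zero) (auto simp: words_def)
  from theI'[OF this] show "0 \<le> affinity_exponent N S k" "pressure_sum (affinity_exponent N S k) k = 1"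
    unfolding eq by auto
qed

lemma pressure_sum_antimono:
  assumes "0 \<le> t" "t \<le> t'" "1 \<le> k"
  shows "pressure_sum t' k \<le> pressure_sum t k"
proof (cases "t = t'")
  case False
  show ?thesis unfolding pressure_sum_def
  proof (rule sum_mono)
    fix w assume w: "w \<in> words N k"
    then have "invertible (word_matrix w)" by (intro invertible_word_matrix) (simp add: words_def)
    then have "sv_function t' (word_matrix w) < sv_function t (word_matrix w)"
      using False assms singular_value_word_matrix_less_1[OF w] by (intro sv_function_strict_antimono) auto
    then show "sv_function t' (word_matrix w) \<le> sv_function t (word_matrix w)" by simp
  qed
qed simp

lemma pressure_sum_decay:
  assumes "0 \<le> t" "t \<le> t'" "t' \<le> real CARD('n)"
  shows "pressure_sum t' k \<le> (c powr (t' - t)) ^ k * pressure_sum t k"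
proof -
  have "pressure_sum t' k \<le> (\<Sum>w\<in>words N k. (c powr (t' - t)) ^ k * sv_function t (word_matrix w))"
    unfolding pressure_sum_def
  proof (rule sum_mono)
    fix w assume w: "w \<in> words N k"
    then have sw: "set w \<subseteq> {1..N}" "length w = k" by (auto simp: words_def)
    have "sv_function t' (word_matrix w) \<le> (c ^ k) powr (t' - t) * sv_function t (word_matrix w)"
      using sv_function_decay[OF invertible_word_matrix[OF sw(1)] assms singular_value_word_matrix_le[OF sw(1)]] sw(2) by simp
    also have "(c ^ k) powr (t' - t) = (c powr (t' - t)) ^ k"
      using c by (simp add: powr_realpow[symmetric] powr_powr mult.commute)
    finally show "sv_function t' (word_matrix w) \<le> (c powr (t' - t)) ^ k * sv_function t (word_matrix w)" .
  qed
  then show ?thesis by (simp add: pressure_sum_def sum_distrib_left)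
qed

lemma sv_function_word_matrix_nonneg: "set w \<subseteq> {1..N} \<Longrightarrow> 0 \<le> t \<Longrightarrow> 0 \<le> sv_function t (word_matrix w)"
  using sv_function_pos[OF invertible_word_matrix, of w t] by simp

lemma pressure_sum_nonneg: "0 \<le> t \<Longrightarrow> 0 \<le> pressure_sum t k"
  unfolding pressure_sum_def by (intro sum_nonneg sv_function_word_matrix_nonneg) (simp_all add: words_def)

lemma affinity_dimension_nonneg:
  assumes "has_affinity_dimension N S s"
  shows "0 \<le> s"
proof -
  have "eventually (\<lambda>k. 0 \<le> affinity_exponent N S k) sequentially"
    using eventually_ge_at_top[of 1] by eventually_elim (rule affinity_exponent_works)
  then show ?thesis
    using assms unfolding has_affinity_dimension_def by (intro tendsto_lowerbound) auto
qed

text \<open>With \<open>s < t' < t\<close>, the sums for \<open>t'\<close> are at most \<open>1\<close> from some \<open>k\<close> on, since then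
\<open>affinity_exponent N S k < t'\<close>; passing to \<open>t\<close> gains a geometric factor.\<close>
lemma summable_pressure_sum:
  assumes "has_affinity_dimension N S s" "s < t" "t \<le> real CARD('n)"
  shows "summable (pressure_sum t)"
proof -
  note s0 = affinity_dimension_nonneg[OF assms(1)]
  obtain t' where t': "s < t'" "t' < t" using dense[OF assms(2)] by blast
  have "eventually (\<lambda>k. affinity_exponent N S k < t') sequentially"
    using assms(1) t' unfolding has_affinity_dimension_def by (intro order_tendstoD) auto
  then have ev: "eventually (\<lambda>k. norm (pressure_sum t k) \<le> (c powr (t - t')) ^ k) sequentially"
    using eventually_ge_at_top[of 1]
  proof eventually_elim
    case (elim k)
    have "pressure_sum t k \<le> (c powr (t - t')) ^ k * pressure_sum t' k"
      using s0 t' assms by (intro pressure_sum_decay) auto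
    also have "\<dots> \<le> (c powr (t - t')) ^ k * pressure_sum (affinity_exponent N S k) k"
      using elim affinity_exponent_works(1)[of k] by (intro mult_left_mono pressure_sum_antimono) auto
    also have "\<dots> = (c powr (t - t')) ^ k" using affinity_exponent_works(2)[of k] elim by simp
    finally show ?case using pressure_sum_nonneg[of t k] s0 assms by simp
  qed
  have "c powr (t - t') < 1" using powr_less_mono'[of c 0 "t - t'"] c t' by simp
  then have "summable (\<lambda>k. (c powr (t - t')) ^ k)" by (intro summable_geometric) simp
  then show ?thesis by (rule summable_comparison_test_ev[OF ev])
qed

text \<open>With \<open>t < t' < s\<close>, the sums for \<open>t'\<close> are at least \<open>1\<close> from some \<open>k\<close> on; passing down to \<open>t\<close> gains a
geometric factor.\<close>
lemma pressure_sum_unbounded: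
  assumes "has_affinity_dimension N S s" "0 \<le> t" "t < s" "s \<le> real CARD('n)"
  shows "\<exists>k. B < pressure_sum t k"
proof -
  obtain t' where t': "t < t'" "t' < s" using dense[OF assms(3)] by blast
  define q where "q = c powr (t' - t)"
  have q: "0 < q" "q < 1" using powr_less_mono'[of c 0 "t' - t"] c t' by (auto simp: q_def)
  have "eventually (\<lambda>k. t' < affinity_exponent N S k) sequentially"
    using assms(1) t' unfolding has_affinity_dimension_def by (intro order_tendstoD) auto
  moreover have "eventually (\<lambda>k. q ^ k * (\<bar>B\<bar> + 1) < 1) sequentially"
  proof -
    have "(\<lambda>k. q ^ k * (\<bar>B\<bar> + 1)) \<longlonglongrightarrow> 0 * (\<bar>B\<bar> + 1)"
      using q by (intro tendsto_mult tendsto_const LIMSEQ_power_zero) simp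
    then show ?thesis by (rule order_tendstoD(2)) simp
  qed
  ultimately have "eventually (\<lambda>k. B < pressure_sum t k) sequentially"
    using eventually_ge_at_top[of 1]
  proof eventually_elim
    case (elim k)
    have "1 = pressure_sum (affinity_exponent N S k) k" using affinity_exponent_works(2)[of k] elim by simp
    also have "\<dots> \<le> pressure_sum t' k"
      using elim t' assms by (intro pressure_sum_antimono) auto
    also have "\<dots> \<le> q ^ k * pressure_sum t k"
      unfolding q_def using t' assms by (intro pressure_sum_decay) auto
    finally have "q ^ k * (\<bar>B\<bar> + 1) < q ^ k * pressure_sum t k" using elim by linarith
    then have "\<bar>B\<bar> + 1 < pressure_sum t k" using q by simp
    then show ?case by linarith
  qed
  then show ?thesis by (rule eventually_happens'[OF sequentially_bot])
qed

text \<open>One more letter shrinks a singular value at most by the factor \<open>a\<close>, the smallest of the singular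
values of the matrices \<open>A i\<close>, so exit words have singular values comparable to the threshold that defines \<open>G\<close>.\<close>
lemma smallest_axis:
  obtains a where "0 < a" "\<And>w i m. set w \<subseteq> {1..N} \<Longrightarrow> i \<in> {1..N} \<Longrightarrow> 1 \<le> m \<Longrightarrow> m \<le> CARD('n) \<Longrightarrow>
    singular_value (word_matrix w) m * a \<le> singular_value (word_matrix (w @ [i])) m"
proof -
  let ?f = "\<lambda>i. singular_value (A i) CARD('n)"
  define a where "a = Min (?f ` {1..N})"
  have ne: "finite (?f ` {1..N})" "?f ` {1..N} \<noteq> {}" using N by auto
  have "\<forall>x\<in>?f ` {1..N}. 0 < x" using singular_value_pos[OF inv] by auto
  then have a0: "0 < a" unfolding a_def using Min_gr_iff[OF ne] by blast
  show ?thesis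
  proof (rule that[OF a0])
    fix w i m assume w: "set w \<subseteq> {1..N}" and i: "i \<in> {1..N}" and m: "1 \<le> m" "m \<le> CARD('n)"
    have "a \<le> ?f i" unfolding a_def using ne i by (intro Min_le) auto
    then have "singular_value (word_matrix w) m * a \<le> singular_value (word_matrix w) m * ?f i"
      using m by (intro mult_left_mono singular_value_nonneg) auto
    also have "\<dots> \<le> singular_value (word_matrix w ** A i) m" by (rule singular_value_mult_ge[OF inv[OF i] m])
    also have "word_matrix w ** A i = word_matrix (w @ [i])" by (simp add: word_matrix_append word_matrix_single)
    finally show "singular_value (word_matrix w) m * a \<le> singular_value (word_matrix (w @ [i])) m" .
  qed
qed

lemma singular_value_word_matrix_Nil: "1 \<le> m \<Longrightarrow> m \<le> CARD('n) \<Longrightarrow> 1 \<le> singular_value (word_matrix []) m"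
  by (rule singular_value_geI[OF subspace_UNIV]) (auto simp: word_matrix_Nil)

lemma finite_large_words:
  assumes "0 < \<delta>" "1 \<le> m" "m \<le> CARD('n)"
  obtains L where "{w. set w \<subseteq> {1..N} \<and> \<delta> \<le> singular_value (word_matrix w) m} \<subseteq> (\<Union>k<L. words N k)"
proof -
  obtain L where L: "c ^ L < \<delta>" using real_arch_pow_inv[OF assms(1) c(2)] by blast
  show ?thesis
  proof (rule that[of L], rule subsetI)
    fix w assume w: "w \<in> {w. set w \<subseteq> {1..N} \<and> \<delta> \<le> singular_value (word_matrix w) m}"
    then have "\<delta> \<le> singular_value (word_matrix w) 1"
      using singular_value_antimono[of 1 m "word_matrix w"] assms by auto
    also have "\<dots> \<le> c ^ length w" using w by (intro singular_value_word_matrix_le) simp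
    finally have "c ^ L < c ^ length w" using L by simp
    then have "length w < L" using c by (metis power_decreasing not_less less_imp_le)
    then show "w \<in> (\<Union>k<L. words N k)" using w by (auto simp: words_def)
  qed
qed

end

section \<open>Covering the inhomogeneous set from above\<close>

context affine_system
begin

lemma word_map_subset:
  assumes F: "inhomogeneous_set N S C F"
  shows "set w \<subseteq> {1..N} \<Longrightarrow> word_map S w ` F \<subseteq> F"
proof (induction w)
  case Nil
  show ?case by (simp add: word_map_Nil)
next
  case (Cons i w)
  have "word_map S (i # w) ` F = S i ` (word_map S w ` F)" by (simp add: word_map_Cons image_comp)
  also have "\<dots> \<subseteq> S i ` F" using Cons by (intro image_mono) auto
  also have "\<dots> \<subseteq> (\<Union>i\<in>{1..N}. S i ` F) \<union> C" using Cons.prems by auto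
  also have "\<dots> = F" using F unfolding inhomogeneous_set_def by blast
  finally show ?case .
qed

lemma condensation_subset: "inhomogeneous_set N S C F \<Longrightarrow> C \<subseteq> F"
  unfolding inhomogeneous_set_def by blast

lemma inhomogeneous_set_unroll:
  assumes F: "inhomogeneous_set N S C F"
  shows "F \<subseteq> (\<Union>j<k. \<Union>w\<in>words N j. word_map S w ` C) \<union> (\<Union>w\<in>words N k. word_map S w ` F)"
proof (induction k)
  case 0
  have "[] \<in> words N 0" by (simp add: words_def)
  then show ?case by (auto simp: word_map_Nil)
next
  case (Suc k)
  have step: "word_map S w ` F \<subseteq> word_map S w ` C \<union> (\<Union>w\<in>words N (Suc k). word_map S w ` F)"
    if w: "w \<in> words N k" for w
  proof
    fix x assume "x \<in> word_map S w ` F"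
    then obtain y where y: "y \<in> F" "x = word_map S w y" by blast
    then consider "y \<in> C" | i z where "i \<in> {1..N}" "z \<in> F" "y = S i z"
      using F unfolding inhomogeneous_set_def by blast
    then show "x \<in> word_map S w ` C \<union> (\<Union>w\<in>words N (Suc k). word_map S w ` F)"
    proof cases
      case 1 then show ?thesis using y by blast
    next
      case 2
      then have "w @ [i] \<in> words N (Suc k)" "x = word_map S (w @ [i]) z"
        using w y by (auto simp: words_def word_map_append word_map_Cons word_map_Nil)
      then show ?thesis using 2 by blast
    qed
  qed
  have "(\<Union>w\<in>words N k. word_map S w ` F)
      \<subseteq> (\<Union>w\<in>words N k. word_map S w ` C) \<union> (\<Union>w\<in>words N (Suc k). word_map S w ` F)"
  proof (rule UN_least)
    fix w assume w: "w \<in> words N k"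
    then have "word_map S w ` C \<subseteq> (\<Union>w\<in>words N k. word_map S w ` C)" by (rule UN_upper)
    then show "word_map S w ` F \<subseteq> (\<Union>w\<in>words N k. word_map S w ` C) \<union> (\<Union>w\<in>words N (Suc k). word_map S w ` F)"
      by (intro order_trans[OF step[OF w]] Un_mono subset_refl)
  qed
  then have "F \<subseteq> (\<Union>j<k. \<Union>w\<in>words N j. word_map S w ` C) \<union>
      ((\<Union>w\<in>words N k. word_map S w ` C) \<union> (\<Union>w\<in>words N (Suc k). word_map S w ` F))"
    by (rule order_trans[OF Suc.IH Un_mono[OF subset_refl]])
  then show ?case by (simp only: lessThan_Suc UN_insert Un_ac)
qed

text \<open>Unroll the defining equation of \<open>F\<close> to words of length \<open>k\<close>, all of which have left \<open>G\<close>. A copy whose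
word is outside \<open>G\<close> lies in the copy of \<open>F\<close> for an exit word among its prefixes.\<close>
lemma inhomogeneous_set_exit_cover:
  assumes F: "inhomogeneous_set N S C F" and G: "[] \<in> G" "G \<subseteq> (\<Union>j<k. words N j)"
  shows "F \<subseteq> (\<Union>w\<in>G. word_map S w ` C) \<union> (\<Union>w\<in>exit_words N G. word_map S w ` F)"
proof -
  have out: "word_map S w ` F \<subseteq> (\<Union>w\<in>exit_words N G. word_map S w ` F)"
    if "w \<notin> G" "set w \<subseteq> {1..N}" for w
  proof -
    obtain u i v where w: "w = u @ [i] @ v" "u \<in> exit_words N G"
      using word_exits[OF G(1) \<open>w \<notin> G\<close> \<open>set w \<subseteq> {1..N}\<close>] by blast
    then have "word_map S w ` F = word_map S u ` (word_map S ([i] @ v) ` F)"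
      by (simp only: word_map_append image_comp)
    also have "\<dots> \<subseteq> word_map S u ` F"
      using \<open>set w \<subseteq> {1..N}\<close> w(1) by (intro image_mono word_map_subset[OF F]) auto
    finally show ?thesis using w(2) by blast
  qed
  have "word_map S w ` C \<subseteq> (\<Union>w\<in>G. word_map S w ` C) \<union> (\<Union>w\<in>exit_words N G. word_map S w ` F)"
    if "set w \<subseteq> {1..N}" for w
  proof (cases "w \<in> G")
    case False
    have "word_map S w ` C \<subseteq> word_map S w ` F" using condensation_subset[OF F] by blast
    then show ?thesis using out[OF False that] by blast
  qed blast
  moreover have "word_map S w ` F \<subseteq> (\<Union>w\<in>G. word_map S w ` C) \<union> (\<Union>w\<in>exit_words N G. word_map S w ` F)" if "w \<in> words N k" for w
  proof (rule le_supI2, rule out)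
    show "w \<notin> G" using G(2) that by (auto simp: words_def)
    show "set w \<subseteq> {1..N}" using that by (simp add: words_def)
  qed
  ultimately have "(\<Union>j<k. \<Union>w\<in>words N j. word_map S w ` C) \<union> (\<Union>w\<in>words N k. word_map S w ` F)
      \<subseteq> (\<Union>w\<in>G. word_map S w ` C) \<union> (\<Union>w\<in>exit_words N G. word_map S w ` F)"
    by (intro Un_least UN_least) (simp_all add: words_def)
  then show ?thesis by (rule order_trans[OF inhomogeneous_set_unroll[OF F]])
qed

lemma covering_number_word_image:
  assumes "set w \<subseteq> {1..N}" "bounded X" "0 < t" "t \<le> real CARD('n)" "m = nat \<lceil>t\<rceil>" "0 < \<delta>"
  shows "real (covering_number \<delta> (word_map S w ` X)) \<le>
    (2 * (real CARD('n))\<^sup>2 + 2) ^ CARD('n) * (real (covering_number (\<delta> / singular_value (word_matrix w) m) X)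
      * (sv_function t (word_matrix w) * singular_value (word_matrix w) m powr (- t)))"
  using covering_number_affine_image[OF invertible_word_matrix[OF assms(1)] assms(2-6), of "word_map S w 0"]
  unfolding word_map_affine[OF assms(1), symmetric] .

lemma bounded_word_image:
  assumes "set w \<subseteq> {1..N}" "bounded X"
  shows "bounded (word_map S w ` X)"
proof -
  have "bounded ((\<lambda>x. word_matrix w *v x) ` X)"
    by (rule bounded_linear_image[OF assms(2)]) (rule matrix_vector_mul_bounded_linear)
  then have "bounded ((\<lambda>y. word_map S w 0 + y) ` ((\<lambda>x. word_matrix w *v x) ` X))" by (rule bounded_translation)
  moreover have "word_map S w ` X = (\<lambda>y. word_map S w 0 + y) ` ((\<lambda>x. word_matrix w *v x) ` X)"
    unfolding image_comp by (subst word_map_affine[OF assms(1)]) (simp add: o_def add.commute)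
  ultimately show ?thesis by simp
qed

text \<open>With \<open>G\<close> the words whose \<open>m\<close>-th singular value exceeds \<open>\<delta>\<close>, each copy of \<open>C\<close> costs at most a
constant times \<open>\<phi>\<^sup>t(w) * \<delta> powr -t\<close>. The same holds for the copies of \<open>F\<close> at exit words, where \<open>\<delta> / \<alpha>\<^sub>m\<close>
is bounded below by a positive constant.\<close>
lemma covering_number_inhomogeneous_set_le:
  assumes F: "inhomogeneous_set N S C F" and t: "0 < t" "t \<le> real CARD('n)"
    and summ: "summable (pressure_sum t)"
    and KC: "0 < K" "\<And>\<delta>. 0 < \<delta> \<Longrightarrow> \<delta> \<le> 1 \<Longrightarrow> real (covering_number \<delta> C) \<le> K * \<delta> powr (- t)"
  shows "\<exists>K'>0. \<forall>\<delta>. 0 < \<delta> \<longrightarrow> \<delta> < 1 \<longrightarrow> real (covering_number \<delta> F) \<le> K' * \<delta> powr (- t)"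
proof -
  define m where "m = nat \<lceil>t\<rceil>"
  have m: "1 \<le> m" "m \<le> CARD('n)"
    unfolding m_def using t by (linarith | simp add: nat_le_iff ceiling_le_iff)+
  obtain a where a: "0 < a" "\<And>w i m. set w \<subseteq> {1..N} \<Longrightarrow> i \<in> {1..N} \<Longrightarrow> 1 \<le> m \<Longrightarrow> m \<le> CARD('n) \<Longrightarrow>
    singular_value (word_matrix w) m * a \<le> singular_value (word_matrix (w @ [i])) m"
    using smallest_axis by blast
  have bF: "bounded F" using F unfolding inhomogeneous_set_def by (simp add: compact_imp_bounded)
  then have bC: "bounded C" using condensation_subset[OF F] by (rule bounded_subset)
  define \<kappa> where "\<kappa> = (2 * (real CARD('n))\<^sup>2 + 2) ^ CARD('n)"
  have \<kappa>: "0 < \<kappa>" unfolding \<kappa>_def by (intro zero_less_power add_nonneg_pos) auto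
  define K2 where "K2 = real (covering_number a F)"
  define Z where "Z = (\<Sum>k. pressure_sum t k)"
  have Z0: "0 \<le> Z" unfolding Z_def using t by (intro suminf_nonneg summ pressure_sum_nonneg) auto
  \<comment> \<open>The summand \<open>1\<close> only makes the constant positive.\<close>
  define K' where "K' = \<kappa> * (K + K2) * Z + 1"
  have K2: "0 \<le> K2" unfolding K2_def by simp
  have K'pos: "0 < K'" unfolding K'_def using \<kappa> KC(1) K2 Z0
    by (intro add_nonneg_pos mult_nonneg_nonneg) auto
  show ?thesis
  proof (intro exI[of _ K'] conjI allI impI K'pos)
    fix \<delta> :: real assume \<delta>: "0 < \<delta>" "\<delta> < 1"
    let ?\<alpha> = "\<lambda>w. singular_value (word_matrix w) m"
    define G where "G = {w. set w \<subseteq> {1..N} \<and> \<delta> < ?\<alpha> w}"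
    obtain L where "{w. set w \<subseteq> {1..N} \<and> \<delta> \<le> ?\<alpha> w} \<subseteq> (\<Union>k<L. words N k)"
      using finite_large_words[OF \<delta>(1) m] by blast
    moreover have "G \<subseteq> {w. set w \<subseteq> {1..N} \<and> \<delta> \<le> ?\<alpha> w}" by (auto simp: G_def)
    ultimately have GL: "G \<subseteq> (\<Union>k<L. words N k)" by (rule subset_trans[rotated])
    have finL: "finite (\<Union>k<L. words N k)" by (simp add: finite_words)
    have finG: "finite G" using GL finL by (rule finite_subset)
    have Nil: "[] \<in> G" using singular_value_word_matrix_Nil[OF m] \<delta> by (simp add: G_def)
    have HG: "exit_words N G \<subseteq> G" by (auto simp: exit_words_def)
    have finH: "finite (exit_words N G)" using HG finG by (rule finite_subset)
    have \<phi>0: "0 \<le> sv_function t (word_matrix w)" if "w \<in> G" for w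
      using that t by (intro sv_function_word_matrix_nonneg) (auto simp: G_def)
    have bw: "bounded (word_map S w ` X)" if "w \<in> G" "bounded X" for w X
      using that by (intro bounded_word_image) (auto simp: G_def)
    have C_part: "real (covering_number \<delta> (word_map S w ` C)) \<le> \<kappa> * K * \<delta> powr (- t) * sv_function t (word_matrix w)"
      if w: "w \<in> G" for w
    proof -
      have \<alpha>: "0 < ?\<alpha> w" "\<delta> / ?\<alpha> w \<le> 1" using w \<delta> by (auto simp: G_def)
      have "real (covering_number \<delta> (word_map S w ` C)) \<le>
          \<kappa> * (real (covering_number (\<delta> / ?\<alpha> w) C) * (sv_function t (word_matrix w) * ?\<alpha> w powr (- t)))"
        unfolding \<kappa>_def using w t \<delta> bC by (intro covering_number_word_image m_def) (auto simp: G_def)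
      also have "\<dots> \<le> \<kappa> * ((K * (\<delta> / ?\<alpha> w) powr (- t)) * (sv_function t (word_matrix w) * ?\<alpha> w powr (- t)))"
        using \<kappa> \<phi>0[OF w] \<alpha> \<delta> by (intro mult_left_mono mult_right_mono KC(2) mult_nonneg_nonneg) auto
      also have "\<dots> = \<kappa> * K * ((\<delta> / ?\<alpha> w) powr (- t) * ?\<alpha> w powr (- t)) * sv_function t (word_matrix w)"
        by (simp only: mult_ac)
      also have "(\<delta> / ?\<alpha> w) powr (- t) * ?\<alpha> w powr (- t) = \<delta> powr (- t)"
        using \<delta> \<alpha> by (simp add: powr_mult[symmetric])
      finally show ?thesis .
    qed
    have F_part: "real (covering_number \<delta> (word_map S w ` F)) \<le> \<kappa> * K2 * \<delta> powr (- t) * sv_function t (word_matrix w)"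
      if w: "w \<in> exit_words N G" for w
    proof -
      have wG: "w \<in> G" using w HG by blast
      then have sw: "set w \<subseteq> {1..N}" "\<delta> < ?\<alpha> w" by (auto simp: G_def)
      have \<alpha>: "0 < ?\<alpha> w" using sw \<delta> by simp
      obtain i where i: "i \<in> {1..N}" "w @ [i] \<notin> G" using w by (auto simp: exit_words_def)
      then have "?\<alpha> (w @ [i]) \<le> \<delta>" using sw by (auto simp: G_def)
      then have "?\<alpha> w * a \<le> \<delta>" using a(2)[OF sw(1) i(1) m] by simp
      then have "a \<le> \<delta> / ?\<alpha> w" using \<alpha> by (simp add: field_simps)
      then have cov: "real (covering_number (\<delta> / ?\<alpha> w) F) \<le> K2"
        unfolding K2_def using covering_number_antimono[OF bF a(1)] by simp
      have pw: "?\<alpha> w powr (- t) \<le> \<delta> powr (- t)" using sw \<delta> t by (intro powr_mono2') auto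
      have "real (covering_number \<delta> (word_map S w ` F)) \<le>
          \<kappa> * (real (covering_number (\<delta> / ?\<alpha> w) F) * (sv_function t (word_matrix w) * ?\<alpha> w powr (- t)))"
        unfolding \<kappa>_def using sw t \<delta> bF by (intro covering_number_word_image m_def) auto
      also have "\<dots> \<le> \<kappa> * (K2 * (sv_function t (word_matrix w) * \<delta> powr (- t)))"
        using \<kappa> \<phi>0[OF wG] pw cov K2 by (intro mult_left_mono mult_mono) auto
      also have "\<dots> = \<kappa> * K2 * \<delta> powr (- t) * sv_function t (word_matrix w)" by (simp only: mult_ac)
      finally show ?thesis .
    qed
    have sumG: "(\<Sum>w\<in>G. sv_function t (word_matrix w)) \<le> Z"
    proof -
      have "(\<Sum>w\<in>G. sv_function t (word_matrix w)) \<le> (\<Sum>w\<in>(\<Union>k<L. words N k). sv_function t (word_matrix w))"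
        using GL finL t by (intro sum_mono2 sv_function_word_matrix_nonneg) (auto simp: words_def)
      also have "\<dots> = (\<Sum>k<L. pressure_sum t k)"
        unfolding pressure_sum_def by (rule sum.UNION_disjoint) (auto simp: finite_words, auto simp: words_def)
      also have "\<dots> \<le> Z" unfolding Z_def
        using t by (intro sum_le_suminf summ) (auto intro: pressure_sum_nonneg)
      finally show ?thesis .
    qed
    have sumH: "(\<Sum>w\<in>exit_words N G. sv_function t (word_matrix w)) \<le> Z"
      using sum_mono2[OF finG HG] \<phi>0 sumG by (intro order_trans[OF sum_mono2[OF finG HG] sumG]) auto
    let ?X = "\<Union>w\<in>G. word_map S w ` C" and ?Y = "\<Union>w\<in>exit_words N G. word_map S w ` F"
    have bX: "bounded ?X" and bY: "bounded ?Y"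
      using finG finH bw bC bF HG by (auto intro!: bounded_UN)
    have "covering_number \<delta> F \<le> covering_number \<delta> (\<Union>j\<in>{True, False}. if j then ?X else ?Y)"
      using inhomogeneous_set_exit_cover[OF F Nil GL] bX bY \<delta> by (intro covering_number_mono) auto
    also have "\<dots> \<le> (\<Sum>j\<in>{True, False}. covering_number \<delta> (if j then ?X else ?Y))"
      using bX bY \<delta> by (intro covering_number_UN_le) auto
    also have "\<dots> = covering_number \<delta> ?X + covering_number \<delta> ?Y" by simp
    also have "\<dots> \<le> (\<Sum>w\<in>G. covering_number \<delta> (word_map S w ` C))
        + (\<Sum>w\<in>exit_words N G. covering_number \<delta> (word_map S w ` F))"
      using finG finH bw bC bF \<delta> HG by (intro add_mono covering_number_UN_le) auto
    finally have "real (covering_number \<delta> F) \<le> (\<Sum>w\<in>G. real (covering_number \<delta> (word_map S w ` C)))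
        + (\<Sum>w\<in>exit_words N G. real (covering_number \<delta> (word_map S w ` F)))"
      by (simp only: of_nat_le_iff of_nat_add[symmetric] of_nat_sum[symmetric])
    also have "\<dots> \<le> (\<Sum>w\<in>G. \<kappa> * K * \<delta> powr (- t) * sv_function t (word_matrix w))
        + (\<Sum>w\<in>exit_words N G. \<kappa> * K2 * \<delta> powr (- t) * sv_function t (word_matrix w))"
      by (intro add_mono sum_mono C_part F_part)
    also have "\<dots> = \<kappa> * K * \<delta> powr (- t) * (\<Sum>w\<in>G. sv_function t (word_matrix w))
        + \<kappa> * K2 * \<delta> powr (- t) * (\<Sum>w\<in>exit_words N G. sv_function t (word_matrix w))"
      by (simp only: sum_distrib_left)
    also have "\<dots> \<le> \<kappa> * K * \<delta> powr (- t) * Z + \<kappa> * K2 * \<delta> powr (- t) * Z"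
      using \<kappa> KC(1) K2 by (intro add_mono mult_left_mono sumG sumH mult_nonneg_nonneg) auto
    also have "\<dots> = (\<kappa> * (K + K2) * Z) * \<delta> powr (- t)" by (simp add: algebra_simps)
    also have "\<dots> \<le> K' * \<delta> powr (- t)" unfolding K'_def by (intro mult_right_mono) auto
    finally show "real (covering_number \<delta> F) \<le> K' * \<delta> powr (- t)" .
  qed
qed

section \<open>Separated copies of the condensation set\<close>

text \<open>The open set \<open>D\<close> has disjoint images under different words: at the first letter where the words differ
the images lie in different \<open>S i ` U\<close>, and if one word is a prefix of the other then one of the images
lies in \<open>D\<close> and the other in some \<open>S i ` U\<close> up to a common injective map. As \<open>D\<close> contains the
\<open>r\<close>-neighbourhood of \<open>C\<close>, its image under a word contains the neighbourhood of the copy of \<open>C\<close> whose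
radius is \<open>r\<close> times the smallest singular value.\<close>
lemma COSC_separation:
  assumes "COSC N S C" "compact C"
  shows "\<exists>r>0. \<forall>v w. set v \<subseteq> {1..N} \<longrightarrow> set w \<subseteq> {1..N} \<longrightarrow> v \<noteq> w \<longrightarrow>
     (\<forall>p\<in>C. \<forall>q\<in>C. r * singular_value (word_matrix v) CARD('n) \<le> norm (word_map S v p - word_map S w q))"
proof -
  obtain U where U': "open U" "C \<subseteq> U - (\<Union>i\<in>{1..N}. closure (S i ` U))"
    "\<forall>i\<in>{1..N}. S i ` U \<subseteq> U"
    "\<forall>i\<in>{1..N}. \<forall>j\<in>{1..N}. i \<noteq> j \<longrightarrow> S i ` U \<inter> S j ` U = {}"
    using assms(1) unfolding COSC_def by (elim exE conjE)
  note U = U'(1,2) U'(3)[rule_format] U'(4)[rule_format]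
  define D where "D = U - (\<Union>i\<in>{1..N}. closure (S i ` U))"
  have "open D" unfolding D_def using U(1) by (intro open_Diff closed_UN) auto
  then obtain r where r: "0 < r" "(\<Union>x\<in>C. ball x r) \<subseteq> D"
    using U(2) unfolding D_def by (rule compact_subset_open_imp_ball_epsilon_subset[OF assms(2)])
  have DU: "D \<subseteq> U" by (auto simp: D_def)
  have wU: "word_map S w ` U \<subseteq> U" if "set w \<subseteq> {1..N}" for w
    using that
  proof (induction w)
    case (Cons i w)
    have "word_map S (i # w) ` U = S i ` (word_map S w ` U)" by (simp add: word_map_Cons image_comp)
    also have "\<dots> \<subseteq> S i ` U" using Cons by (intro image_mono) auto
    also have "\<dots> \<subseteq> U" using Cons.prems by (intro U(3)) auto
    finally show ?case .
  qed (simp add: word_map_Nil)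
  have tail: "word_map S (i # w) x \<in> S i ` U" if "set (i # w) \<subseteq> {1..N}" "x \<in> D" for i w x
  proof -
    have "word_map S w x \<in> U" using wU[of w] that DU by auto
    then show ?thesis by (simp add: word_map_Cons)
  qed
  have not_D: "x \<notin> S i ` U" if "x \<in> D" "i \<in> {1..N}" for x i
    using that closure_subset[of "S i ` U"] unfolding D_def by blast
  have disj: "word_map S v x \<noteq> word_map S w y"
    if "set v \<subseteq> {1..N}" "set w \<subseteq> {1..N}" "v \<noteq> w" "x \<in> D" "y \<in> D" for v w x y
    using that(1-3)
  proof (induction v arbitrary: w)
    case Nil
    then obtain j w' where w: "w = j # w'" by (cases w) auto
    have "word_map S w y \<in> S j ` U" using tail[of j w' y] Nil that(5) w by simp
    moreover have "x \<notin> S j ` U" using not_D[OF that(4)] Nil.prems w by simp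
    ultimately show ?case by (auto simp: word_map_Nil)
  next
    case (Cons i v)
    note v = Cons
    have vi: "word_map S (i # v) x \<in> S i ` U" using tail Cons.prems(1) that(4) by blast
    show ?case
    proof (cases w)
      case Nil
      then show ?thesis using vi not_D[OF that(5), of i] Cons.prems(1) by (auto simp: word_map_Nil)
    next
      case (Cons j w')
      have wj: "word_map S w y \<in> S j ` U" using tail[of j w' y] v(3) that(5) Cons by simp
      show ?thesis
      proof (cases "i = j")
        case False
        then have "S i ` U \<inter> S j ` U = {}" using v(2,3) Cons by (intro U(4)) auto
        then have "word_map S (i # v) x \<notin> S j ` U" using vi unfolding disjoint_iff by blast
        then show ?thesis using wj by metis
      next
        case True
        have i: "i \<in> {1..N}" using v(2) by simp
        have "inj ((*v) (A i))" by (rule inj_matrix_vector_mult[OF inv[OF i]])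
        then have inj: "inj (S i)" unfolding S_eq[OF i] inj_def by simp
        have "word_map S v x \<noteq> word_map S w' y" using v True Cons by (intro v(1)) auto
        then show ?thesis using inj True Cons by (simp add: word_map_Cons inj_eq)
      qed
    qed
  qed
  show ?thesis
  proof (intro exI[of _ r] conjI allI impI ballI r(1))
    fix v w p q
    assume vw: "set v \<subseteq> {1..N}" "set w \<subseteq> {1..N}" "v \<noteq> w" and pq: "p \<in> C" "q \<in> C"
    let ?y = "word_map S w q"
    obtain B where B: "word_matrix v ** B = mat 1" using invertible_word_matrix[OF vw(1)] invertible_def by blast
    define q' where "q' = B *v (?y - word_map S v 0)"
    have "word_matrix v *v q' = ?y - word_map S v 0" unfolding q'_def by (simp add: matrix_vector_mul_assoc B)
    then have y: "?y = word_map S v q'" using fun_cong[OF word_map_affine[OF vw(1)], of q'] by simp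
    have "p \<in> D" "q \<in> D" using subsetD[OF U(2)] pq unfolding D_def by simp_all
    have far: "r \<le> norm (p - q')"
    proof (rule ccontr)
      assume "\<not> r \<le> norm (p - q')"
      then have "q' \<in> ball p r" by (simp add: dist_norm)
      then have "q' \<in> D" using pq(1) by (intro subsetD[OF r(2)] UN_I)
      then show False using disj[OF vw _ \<open>q \<in> D\<close>, of q'] y by simp
    qed
    have "r * singular_value (word_matrix v) CARD('n) \<le> norm (p - q') * singular_value (word_matrix v) CARD('n)"
      using far by (intro mult_right_mono singular_value_nonneg) auto
    also have "\<dots> \<le> norm (word_matrix v *v (p - q'))"
      using norm_ge_last_singular_value[of "word_matrix v" "p - q'"] by (simp only: mult.commute)
    also have "word_matrix v *v (p - q') = word_map S v p - ?y"
      using fun_cong[OF word_map_affine[OF vw(1)], of p] fun_cong[OF word_map_affine[OF vw(1)], of q'] y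
      by (simp add: matrix_vector_mult_diff_distrib)
    finally show "r * singular_value (word_matrix v) CARD('n) \<le> norm (word_map S v p - word_map S w q)" .
  qed
qed

text \<open>The submultiplicative majorant of the singular value function from \<open>sv_function_le_det\<close>.\<close>
definition det_weight :: "real \<Rightarrow> nat list \<Rightarrow> real" where
  "det_weight t w = \<bar>det (word_matrix w)\<bar> * singular_value (word_matrix w) CARD('n) powr (t - real CARD('n))"

lemma det_weight_nonneg: "0 \<le> det_weight t w" by (simp add: det_weight_def)

lemma det_weight_pos: "set w \<subseteq> {1..N} \<Longrightarrow> 0 < det_weight t w"
  unfolding det_weight_def using invertible_word_matrix[of w] singular_value_pos[OF invertible_word_matrix, of w "CARD('n)"]
  by (simp add: invertible_det_nz)

lemma det_weight_submult:
  assumes "t \<le> real CARD('n)" "set u \<subseteq> {1..N}" "set v \<subseteq> {1..N}"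
  shows "det_weight t (u @ v) \<le> det_weight t u * det_weight t v"
proof -
  let ?\<alpha> = "\<lambda>w. singular_value (word_matrix w) CARD('n)" and ?e = "t - real CARD('n)"
  have pos: "0 < ?\<alpha> u" "0 < ?\<alpha> v"
    using singular_value_pos[OF invertible_word_matrix[OF assms(2)], of "CARD('n)"]
      singular_value_pos[OF invertible_word_matrix[OF assms(3)], of "CARD('n)"] by simp_all
  have "?\<alpha> u * ?\<alpha> v \<le> ?\<alpha> (u @ v)"
    unfolding word_matrix_append using invertible_word_matrix[OF assms(3)] by (intro singular_value_mult_ge) auto
  then have "?\<alpha> (u @ v) powr ?e \<le> (?\<alpha> u * ?\<alpha> v) powr ?e"
    using assms(1) pos by (intro powr_mono2') auto
  then have "det_weight t (u @ v) \<le> \<bar>det (word_matrix (u @ v))\<bar> * (?\<alpha> u powr ?e * ?\<alpha> v powr ?e)"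
    unfolding det_weight_def using pos by (intro mult_left_mono) (simp_all add: powr_mult)
  also have "\<dots> = det_weight t u * det_weight t v"
    by (simp add: det_weight_def word_matrix_append det_mul abs_mult mult_ac)
  finally show ?thesis .
qed

lemma det_weight_unbounded:
  assumes "has_affinity_dimension N S s" "0 \<le> t" "t < s" "s \<le> real CARD('n)"
  shows "\<exists>k. B < (\<Sum>w\<in>words N k. det_weight t w)"
proof -
  obtain k where k: "B < pressure_sum t k" using pressure_sum_unbounded[OF assms] by blast
  have "pressure_sum t k \<le> (\<Sum>w\<in>words N k. det_weight t w)"
    unfolding pressure_sum_def det_weight_def
    using assms by (intro sum_mono sv_function_le_det invertible_word_matrix) (auto simp: words_def)
  with k show ?thesis by (intro exI[of _ k]) simp
qed

text \<open>\<open>H\<close> is the set of exit words of the set of words whose smallest singular value \<open>\<alpha>\<^sub>n\<close> is at least \<open>\<delta>\<close>.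
Their weights sum up to at least a constant, and \<open>\<bar>det\<bar> / \<alpha>\<^sub>n\<close> is the weight times \<open>\<alpha>\<^sub>n\<close> to the power
\<open>n - 1 - t\<close>, where \<open>\<alpha>\<^sub>n\<close> is comparable to \<open>\<delta>\<close>.\<close>
lemma exit_words_det_weight:
  assumes dim: "has_affinity_dimension N S s" "0 \<le> t" "t < s" "s \<le> real CARD('n)"
  shows "\<exists>\<kappa>>0. \<forall>\<delta>. 0 < \<delta> \<longrightarrow> \<delta> < 1 \<longrightarrow>
    (\<exists>H. finite H \<and> (\<forall>w\<in>H. set w \<subseteq> {1..N} \<and> \<delta> \<le> singular_value (word_matrix w) CARD('n)) \<and>
     \<kappa> * \<delta> powr (real CARD('n) - 1 - t) \<le> (\<Sum>w\<in>H. \<bar>det (word_matrix w)\<bar> / singular_value (word_matrix w) CARD('n)))"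
proof -
  let ?n = "CARD('n)"
  let ?\<alpha> = "\<lambda>w. singular_value (word_matrix w) ?n"
  let ?p = "real ?n - 1 - t"
  have n: "1 \<le> ?n" "?n \<le> ?n" by simp_all
  obtain a where a: "0 < a" "\<And>w i m. set w \<subseteq> {1..N} \<Longrightarrow> i \<in> {1..N} \<Longrightarrow> 1 \<le> m \<Longrightarrow> m \<le> ?n \<Longrightarrow>
    singular_value (word_matrix w) m * a \<le> singular_value (word_matrix (w @ [i])) m"
    using smallest_axis by blast
  define \<Psi> where "\<Psi> = (\<Sum>i\<in>{1..N}. det_weight t [i])"
  have \<Psi>: "0 < \<Psi>" unfolding \<Psi>_def using N by (intro sum_pos det_weight_pos) auto
  \<comment> \<open>On \<open>[\<delta>, \<delta> / a]\<close> the function \<open>x powr ?p\<close> is smallest at one of the ends, depending on the sign of \<open>?p\<close>.\<close>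
  define \<mu> where "\<mu> = min 1 (a powr (- ?p))"
  have \<mu>: "0 < \<mu>" unfolding \<mu>_def using a(1) by simp
  show ?thesis
  proof (intro exI[of _ "\<mu> / \<Psi>"] conjI allI impI)
    show "0 < \<mu> / \<Psi>" using \<mu> \<Psi> by simp
    fix \<delta> :: real assume \<delta>: "0 < \<delta>" "\<delta> < 1"
    define G where "G = {w. set w \<subseteq> {1..N} \<and> \<delta> \<le> ?\<alpha> w}"
    obtain L where "G \<subseteq> (\<Union>k<L. words N k)"
      using finite_large_words[OF \<delta>(1) n] unfolding G_def by blast
    then have finG: "finite G" by (rule finite_subset) (simp add: finite_words)
    let ?H = "exit_words N G"
    have HG: "?H \<subseteq> G" by (auto simp: exit_words_def)
    have "[] \<in> G" using singular_value_word_matrix_Nil[OF n] \<delta> by (simp add: G_def)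
    then have "1 < (\<Sum>u\<in>?H. det_weight t u) * \<Psi>"
      unfolding \<Psi>_def using finG dim
      by (intro submultiplicative_exit_sum det_weight_nonneg det_weight_submult det_weight_unbounded[OF dim])
         (auto simp: G_def)
    then have big: "1 / \<Psi> \<le> (\<Sum>u\<in>?H. det_weight t u)" using \<Psi> by (simp add: field_simps)
    have each: "\<mu> * \<delta> powr ?p * det_weight t w \<le> \<bar>det (word_matrix w)\<bar> / ?\<alpha> w" if w: "w \<in> ?H" for w
    proof -
      have sw: "set w \<subseteq> {1..N}" "\<delta> \<le> ?\<alpha> w" using w HG by (auto simp: G_def)
      obtain i where i: "i \<in> {1..N}" "w @ [i] \<notin> G" using w by (auto simp: exit_words_def)
      then have "?\<alpha> (w @ [i]) < \<delta>" using sw by (auto simp: G_def)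
      then have "?\<alpha> w * a \<le> \<delta>" using a(2)[OF sw(1) i(1) n] by simp
      then have up: "?\<alpha> w \<le> \<delta> / a" using a(1) by (simp add: field_simps)
      have pos: "0 < ?\<alpha> w" using sw \<delta> by simp
      have "\<mu> * \<delta> powr ?p \<le> ?\<alpha> w powr ?p"
      proof (cases "0 \<le> ?p")
        case True
        have "\<mu> * \<delta> powr ?p \<le> 1 * \<delta> powr ?p" unfolding \<mu>_def by (intro mult_right_mono) auto
        also have "\<dots> \<le> ?\<alpha> w powr ?p" using sw True \<delta> by (simp add: powr_mono2)
        finally show ?thesis .
      next
        case False
        have "\<mu> * \<delta> powr ?p \<le> a powr (- ?p) * \<delta> powr ?p" unfolding \<mu>_def by (intro mult_right_mono) auto
        also have "\<dots> = (\<delta> / a) powr ?p" using a(1) \<delta> by (simp add: powr_divide powr_minus_divide del: minus_diff_eq)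
        also have "\<dots> \<le> ?\<alpha> w powr ?p" using False up pos by (intro powr_mono2') auto
        finally show ?thesis .
      qed
      then have "\<mu> * \<delta> powr ?p * det_weight t w \<le> ?\<alpha> w powr ?p * det_weight t w"
        by (intro mult_right_mono det_weight_nonneg)
      also have "\<dots> = \<bar>det (word_matrix w)\<bar> * (?\<alpha> w powr ?p * ?\<alpha> w powr (t - real ?n))"
        by (simp add: det_weight_def)
      also have "?\<alpha> w powr ?p * ?\<alpha> w powr (t - real ?n) = ?\<alpha> w powr (- 1)"
        by (simp add: powr_add[symmetric])
      also have "\<bar>det (word_matrix w)\<bar> * ?\<alpha> w powr (- 1) = \<bar>det (word_matrix w)\<bar> / ?\<alpha> w"
        using pos by (simp add: powr_minus divide_inverse)
      finally show ?thesis .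
    qed
    have "\<mu> / \<Psi> * \<delta> powr ?p = \<mu> * \<delta> powr ?p * (1 / \<Psi>)" by simp
    also have "\<dots> \<le> \<mu> * \<delta> powr ?p * (\<Sum>u\<in>?H. det_weight t u)"
      using big \<mu> by (intro mult_left_mono) auto
    also have "\<dots> = (\<Sum>u\<in>?H. \<mu> * \<delta> powr ?p * det_weight t u)" by (simp only: sum_distrib_left)
    also have "\<dots> \<le> (\<Sum>w\<in>?H. \<bar>det (word_matrix w)\<bar> / ?\<alpha> w)" by (intro sum_mono each)
    finally have "\<mu> / \<Psi> * \<delta> powr ?p \<le> (\<Sum>w\<in>?H. \<bar>det (word_matrix w)\<bar> / ?\<alpha> w)" .
    moreover have "finite ?H" using HG finG by (rule finite_subset)
    moreover have "\<forall>w\<in>?H. set w \<subseteq> {1..N} \<and> \<delta> \<le> ?\<alpha> w" using HG by (auto simp: G_def)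
    ultimately show "\<exists>H. finite H \<and> (\<forall>w\<in>H. set w \<subseteq> {1..N} \<and> \<delta> \<le> ?\<alpha> w) \<and>
      \<mu> / \<Psi> * \<delta> powr ?p \<le> (\<Sum>w\<in>H. \<bar>det (word_matrix w)\<bar> / ?\<alpha> w)" by blast
  qed
qed

text \<open>A cube of side \<open>\<delta>\<close> cannot meet two of the copies of \<open>C\<close> that belong to words with smallest singular value
at least \<open>h * \<delta>\<close>, so the counts for the single copies add up.\<close>
lemma covering_number_inhomogeneous_set_ge:
  assumes dim: "has_affinity_dimension N S s" "0 \<le> t" "t < s" "s \<le> real CARD('n)"
    and F: "inhomogeneous_set N S C F" and C: "COSC N S C" "compact C"
    and proj: "(INF \<pi>\<in>orthogonal_projections (CARD('n) - 1).
            emeasure (subspace_lebesgue (range \<pi>)) (\<pi> ` C)) > 0"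
  shows "\<exists>K>0. \<exists>d>0. \<forall>\<delta>. 0 < \<delta> \<longrightarrow> \<delta> < d \<longrightarrow> K * \<delta> powr (- t) \<le> real (covering_number \<delta> F)"
proof -
  let ?n = "CARD('n)"
  let ?\<alpha> = "\<lambda>w. singular_value (word_matrix w) ?n"
  let ?p = "real ?n - 1 - t"
  obtain \<eta> where \<eta>: "0 < \<eta>" "shadow_content_ge \<eta> C"
    using ex_shadow_content_ge[OF proj] by blast
  obtain r where r: "0 < r" "\<forall>v w. set v \<subseteq> {1..N} \<longrightarrow> set w \<subseteq> {1..N} \<longrightarrow> v \<noteq> w \<longrightarrow>
     (\<forall>p\<in>C. \<forall>q\<in>C. r * ?\<alpha> v \<le> norm (word_map S v p - word_map S w q))"
    using COSC_separation[OF C] by (elim exE conjE)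
  obtain \<kappa> where \<kappa>: "0 < \<kappa>" "\<forall>\<delta>. 0 < \<delta> \<longrightarrow> \<delta> < 1 \<longrightarrow>
    (\<exists>H. finite H \<and> (\<forall>w\<in>H. set w \<subseteq> {1..N} \<and> \<delta> \<le> ?\<alpha> w) \<and>
     \<kappa> * \<delta> powr ?p \<le> (\<Sum>w\<in>H. \<bar>det (word_matrix w)\<bar> / ?\<alpha> w))"
    using exit_words_det_weight[OF dim] by (elim exE conjE)
  have bF: "bounded F" using F unfolding inhomogeneous_set_def by (simp add: compact_imp_bounded)
  \<comment> \<open>Such copies have distance at least \<open>r * h * \<delta>\<close>, twice the bound \<open>n * \<delta>\<close> for the diameter of a cube.\<close>
  define h where "h = 2 * real ?n / r"
  have h: "0 < h" unfolding h_def using r by simp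
  define k where "k = 2 * (real ?n + 2) * real ?n"
  have k: "0 < k" unfolding k_def by simp
  define K where "K = \<eta> / k ^ (?n - 1) * (\<kappa> * h powr ?p)"
  have K: "0 < K" unfolding K_def using \<eta>(1) k \<kappa>(1) h by simp
  show ?thesis
  proof (rule exI[of _ K], rule conjI[OF K], rule exI[of _ "1 / h"], intro conjI allI impI)
    show "0 < 1 / h" using h by simp
    fix \<delta> :: real assume \<delta>: "0 < \<delta>" "\<delta> < 1 / h"
    have h\<delta>: "0 < h * \<delta>" "h * \<delta> < 1" using \<delta> h by (auto simp: field_simps)
    obtain H where H: "finite H" "\<And>w. w \<in> H \<Longrightarrow> set w \<subseteq> {1..N}" "\<And>w. w \<in> H \<Longrightarrow> h * \<delta> \<le> ?\<alpha> w"
      "\<kappa> * (h * \<delta>) powr ?p \<le> (\<Sum>w\<in>H. \<bar>det (word_matrix w)\<bar> / ?\<alpha> w)"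
      using \<kappa>(2)[rule_format, OF h\<delta>] by blast
    obtain T where T: "finite T" "card T = covering_number \<delta> F" "T \<subseteq> range (cube \<delta>)" "F \<subseteq> \<Union>T"
      by (rule covering_number_attained[OF bF \<delta>(1)])
    define T' where "T' w = {Q\<in>T. Q \<inter> word_map S w ` C \<noteq> {}}" for w
    have CF: "word_map S w ` C \<subseteq> F" if "w \<in> H" for w
      using word_map_subset[OF F H(2)[OF that]] condensation_subset[OF F] by blast
    have T'cov: "word_map S w ` C \<subseteq> \<Union>(T' w)" if "w \<in> H" for w
      using CF[OF that] T(4) unfolding T'_def by blast
    have disj: "T' v \<inter> T' w = {}" if vw: "v \<in> H" "w \<in> H" "v \<noteq> w" for v w
    proof (rule ccontr)
      assume "T' v \<inter> T' w \<noteq> {}"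
      then obtain Q x y where Q: "Q \<in> T" "x \<in> Q" "x \<in> word_map S v ` C" "y \<in> Q" "y \<in> word_map S w ` C"
        unfolding T'_def by blast
      then obtain p q where pq: "p \<in> C" "q \<in> C" "x = word_map S v p" "y = word_map S w q" by blast
      obtain c' where "Q = cube \<delta> c'" using Q(1) T(3) by blast
      then have "norm (x - y) \<le> real ?n * \<delta>" using Q by (intro cube_norm_diff) auto
      moreover have "r * ?\<alpha> v \<le> norm (x - y)"
        unfolding pq using H(2) vw pq by (intro r(2)[rule_format]) auto
      moreover have "r * (h * \<delta>) \<le> r * ?\<alpha> v" using H(3)[OF vw(1)] r(1) by (intro mult_left_mono) auto
      moreover have "r * (h * \<delta>) = 2 * (real ?n * \<delta>)" using r(1) by (simp add: h_def)
      moreover have "0 < real ?n * \<delta>" using \<delta> by simp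
      ultimately show False by linarith
    qed
    have finT': "finite (T' w)" for w using T(1) by (simp add: T'_def)
    have count: "\<eta> / (k * \<delta>) ^ (?n - 1) * (\<bar>det (word_matrix w)\<bar> / ?\<alpha> w) \<le> real (card (T' w))" if w: "w \<in> H" for w
      unfolding k_def
    proof (rule affine_image_cube_count[OF invertible_word_matrix[OF H(2)[OF w]] \<delta>(1) \<eta>(2) finT'])
      show "T' w \<subseteq> range (cube \<delta>)" using T(3) by (auto simp: T'_def)
      show "(\<lambda>x. word_matrix w *v x + word_map S w 0) ` C \<subseteq> \<Union> (T' w)"
        unfolding word_map_affine[OF H(2)[OF w], symmetric] by (rule T'cov[OF w])
    qed
    have "K * \<delta> powr (- t) = \<eta> / (k * \<delta>) ^ (?n - 1) * (\<kappa> * (h * \<delta>) powr ?p)"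
    proof -
      have "\<delta> powr ?p / \<delta> ^ (?n - 1) = \<delta> powr (- t)"
        using \<delta> by (simp add: powr_realpow[symmetric] powr_diff[symmetric] of_nat_diff)
      then have "K * \<delta> powr (- t) = \<eta> / k ^ (?n - 1) * (\<kappa> * h powr ?p) * (\<delta> powr ?p / \<delta> ^ (?n - 1))"
        by (simp only: K_def)
      also have "\<dots> = \<eta> / (k * \<delta>) ^ (?n - 1) * (\<kappa> * (h * \<delta>) powr ?p)"
        using h \<delta> by (simp add: powr_mult power_mult_distrib)
      finally show ?thesis .
    qed
    also have "\<dots> \<le> \<eta> / (k * \<delta>) ^ (?n - 1) * (\<Sum>w\<in>H. \<bar>det (word_matrix w)\<bar> / ?\<alpha> w)"
      using \<eta>(1) k \<delta> by (intro mult_left_mono H(4)) auto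
    also have "\<dots> = (\<Sum>w\<in>H. \<eta> / (k * \<delta>) ^ (?n - 1) * (\<bar>det (word_matrix w)\<bar> / ?\<alpha> w))" by (rule sum_distrib_left)
    also have "\<dots> \<le> (\<Sum>w\<in>H. real (card (T' w)))" by (intro sum_mono count)
    also have "\<dots> = real (card (\<Union>w\<in>H. T' w))"
      using H(1) finT' disj by (subst card_UN_disjoint) auto
    also have "\<dots> \<le> real (card T)"
      using T(1) by (intro of_nat_mono card_mono) (auto simp: T'_def)
    finally show "K * \<delta> powr (- t) \<le> real (covering_number \<delta> F)" using T(2) by simp
  qed
qed

end

section \<open>The box dimensions of the inhomogeneous set\<close>

lemma affine_IFS_system:
  assumes "affine_IFS N S"
  shows "\<exists>A b c. affine_system N S A b c"
proof -
  have ex: "\<exists>A b. invertible A \<and> S i = (\<lambda>x. A *v x + b)" if "i \<in> {1..N}" for i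
    using assms that unfolding affine_IFS_def by blast
  have "\<forall>i. \<exists>A. i \<in> {1..N} \<longrightarrow> (\<exists>b. invertible A \<and> S i = (\<lambda>x. A *v x + b))"
    using ex by blast
  then obtain A where A: "\<forall>i. i \<in> {1..N} \<longrightarrow> (\<exists>b. invertible (A i) \<and> S i = (\<lambda>x. A i *v x + b))"
    unfolding choice_iff by (elim exE)
  then have "\<forall>i. \<exists>b. i \<in> {1..N} \<longrightarrow> invertible (A i) \<and> S i = (\<lambda>x. A i *v x + b)" by blast
  then obtain b where b: "\<forall>i. i \<in> {1..N} \<longrightarrow> invertible (A i) \<and> S i = (\<lambda>x. A i *v x + b i)"
    unfolding choice_iff by (elim exE)
  have "\<forall>i. \<exists>d. i \<in> {1..N} \<longrightarrow> 0 < d \<and> d < 1 \<and> (\<forall>x y. norm (S i x - S i y) \<le> d * norm (x - y))"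
    using assms unfolding affine_IFS_def contraction_def by blast
  then obtain d where d: "\<forall>i. i \<in> {1..N} \<longrightarrow> 0 < d i \<and> d i < 1 \<and> (\<forall>x y. norm (S i x - S i y) \<le> d i * norm (x - y))"
    unfolding choice_iff by (elim exE)
  have N: "1 \<le> N" using assms by (simp add: affine_IFS_def)
  define c where "c = Max (d ` {1..N})"
  have fin: "finite (d ` {1..N})" "d ` {1..N} \<noteq> {}" using N by auto
  have "c \<in> d ` {1..N}" unfolding c_def by (rule Max_in[OF fin])
  then have c: "0 < c" "c < 1" using d by auto
  have "norm (A i *v x) \<le> c * norm x" if i: "i \<in> {1..N}" for i x
  proof -
    have "S i x - S i 0 = A i *v x" using b i by simp
    then have "norm (A i *v x) \<le> d i * norm x" using d[rule_format, OF i] by (metis diff_zero)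
    also have "\<dots> \<le> c * norm x" unfolding c_def using fin i by (intro mult_right_mono Max_ge) auto
    finally show ?thesis .
  qed
  then have "affine_system N S A b c" using N b c by unfold_locales auto
  then show ?thesis by blast
qed

context affine_system
begin

text \<open>Above the dimension \<open>n\<close> of the space there is nothing to prove; below, the covering bound applies to
every \<open>t\<close> that exceeds the maximum.\<close>
lemma upper_box_dim_inhomogeneous_set_le:
  assumes dim: "has_affinity_dimension N S s"
    and F: "inhomogeneous_set N S C F" and C: "C \<noteq> {}"
  shows "upper_box_dim F \<le> max (ereal s) (upper_box_dim C)"
proof (rule dense_ge)
  fix z assume z: "max (ereal s) (upper_box_dim C) < z"
  have bF: "bounded F" and neF: "F \<noteq> {}"
    using F unfolding inhomogeneous_set_def by (simp_all add: compact_imp_bounded)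
  have bC: "bounded C" using bF condensation_subset[OF F] by (rule bounded_subset)
  have s0: "0 \<le> s" by (rule affinity_dimension_nonneg[OF dim])
  show "upper_box_dim F \<le> z"
  proof (cases z)
    case (real t)
    then have t: "s < t" "upper_box_dim C < ereal t" using z by simp_all
    have t0: "0 < t" using s0 t by simp
    show ?thesis
    proof (cases "t \<le> real CARD('n)")
      case True
      obtain K where K: "0 < K" "\<forall>\<delta>. 0 < \<delta> \<longrightarrow> \<delta> \<le> 1 \<longrightarrow> real (covering_number \<delta> C) \<le> K * \<delta> powr (- t)"
        using covering_number_le_of_upper_box_dim[OF bC C t(2) t0] by blast
      obtain K' where K': "0 < K'" "\<forall>\<delta>. 0 < \<delta> \<longrightarrow> \<delta> < 1 \<longrightarrow> real (covering_number \<delta> F) \<le> K' * \<delta> powr (- t)"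
        using covering_number_inhomogeneous_set_le[OF F t0 True summable_pressure_sum[OF dim t(1) True] K(1) K(2)[rule_format]]
        by blast
      have "upper_box_dim F \<le> ereal t"
        using K' by (intro upper_box_dim_leI[OF bF neF zero_less_one K'(1)]) auto
      then show ?thesis using real by simp
    next
      case False
      have "upper_box_dim F \<le> ereal (real CARD('n))" by (rule upper_box_dim_le_dimension[OF bF neF])
      also have "\<dots> \<le> z" using False real by simp
      finally show ?thesis .
    qed
  next
    case PInf then show ?thesis by simp
  next
    case MInf then show ?thesis using z by simp
  qed
qed

lemma lower_box_dim_inhomogeneous_set_ge:
  assumes dim: "has_affinity_dimension N S s" "s \<le> real CARD('n)"
    and F: "inhomogeneous_set N S C F" and C: "COSC N S C" "compact C"
    and proj: "(INF \<pi>\<in>orthogonal_projections (CARD('n) - 1).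
            emeasure (subspace_lebesgue (range \<pi>)) (\<pi> ` C)) > 0"
  shows "ereal s \<le> lower_box_dim F"
proof (rule dense_le)
  fix z assume z: "z < ereal s"
  have bF: "bounded F" and neF: "F \<noteq> {}"
    using F unfolding inhomogeneous_set_def by (simp_all add: compact_imp_bounded)
  show "z \<le> lower_box_dim F"
  proof (cases "0 \<le> z")
    case True
    then obtain t where t: "z = ereal t" "0 \<le> t" "t < s" using z by (cases z) auto
    obtain K d where K: "0 < K" "0 < d"
      "\<forall>\<delta>. 0 < \<delta> \<longrightarrow> \<delta> < d \<longrightarrow> K * \<delta> powr (- t) \<le> real (covering_number \<delta> F)"
      using covering_number_inhomogeneous_set_ge[OF dim(1) t(2,3) dim(2) F C proj] by (elim exE conjE)
    show ?thesis unfolding t(1) using K(3) by (intro lower_box_dim_geI[OF K(2,1)]) auto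
  next
    case False
    then show ?thesis using lower_box_dim_nonneg[OF bF neF] by simp
  qed
qed

end

theorem proposition2p4:
  fixes S :: "nat \<Rightarrow> real^'n \<Rightarrow> real^'n"
    and N :: nat
    and C F :: "(real^'n) set"
    and s :: real
  assumes "affine_IFS N S"
    and "has_affinity_dimension N S s"
    and "s \<le> real CARD('n)"
    and "C \<noteq> {}" and "compact C"
    and "COSC N S C"
    and "inhomogeneous_set N S C F"
    and "(INF \<pi>\<in>orthogonal_projections (CARD('n) - 1).
            emeasure (subspace_lebesgue (range \<pi>)) (\<pi> ` C)) > 0"
  shows "upper_box_dim F = max (ereal s) (upper_box_dim C) \<and>
         max (ereal s) (lower_box_dim C) \<le> lower_box_dim F \<and>
         lower_box_dim F \<le> max (ereal s) (upper_box_dim C)"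
proof -
  obtain A b c where sys: "affine_system N S A b c" using affine_IFS_system[OF assms(1)] by blast
  note upper = affine_system.upper_box_dim_inhomogeneous_set_le[OF sys assms(2,7,4)]
  note lower = affine_system.lower_box_dim_inhomogeneous_set_ge[OF sys assms(2,3,7,6,5,8)]
  have "bounded F" using assms(7) unfolding inhomogeneous_set_def by (simp add: compact_imp_bounded)
  note mono = box_dim_mono[OF affine_system.condensation_subset[OF sys assms(7)] this assms(4)]
  have lu: "lower_box_dim F \<le> upper_box_dim F" by (rule lower_le_upper_box_dim)
  have "upper_box_dim F = max (ereal s) (upper_box_dim C)"
    using upper mono(1) order_trans[OF lower lu] by (intro antisym max.boundedI)
  then show ?thesis
    using lower mono(2) lu by simp
qed

end
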